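(* Let $1\le p\le n-1$ and $\Omega_\ell=(-\ell,\ell)^p\times\omega_2$ for $\ell>0$. Let $q>1$, and let $F:\mathbb{R}^n\to\mathbb{R}$ satisfy, for some constants $\alpha,\lambda,\Lambda>0$ and all $\xi,\eta\in\mathbb{R}^n$, $$2F\Big(\frac{\xi+\eta}{2}\Big)+\alpha|\xi-\eta|^q\le F(\xi)+F(\eta)\qquad\text{and}\qquad \lambda|\xi|^q\le F(\xi)\le\Lambda|\xi|^q .$$ Let $f\in L^{q'}(\omega_2)$, $\frac1q+\frac1{q'}=1$, with $f\ge0$ a.e. For $\ell>0$ let $u_\ell$ be the unique minimizer of $E_{\Omega_\ell}$ over $W_0^{1,q}(\Omega_\ell)$, extended by $0$ outside $\Omega_\ell$. Then there is a function $\tilde u_\infty=\tilde u_\infty(X_2)$ on $\omega_2$, depending only on $X_2$, such that $u_\ell\to\tilde u_\infty$ pointwise as $\ell\to\infty$; that is, for every sequence $\ell_k\to\infty$, $u_{\ell_k}(X_1,X_2)\to\tilde u_\infty(X_2)$ for almost every $(X_1,X_2)\in\mathbb{R}^p\times\omega_2$.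
   Context: Let $n\ge2$; $\omega_2\subset\mathbb{R}^{n-p}$ is open and bounded. Points of $\mathbb{R}^p\times\omega_2$ are written $X=(X_1,X_2)$. The function $f=f(X_2)$ depends only on $X_2$. The functional is $$E_{\Omega_\ell}(u)=\int_{\Omega_\ell}\big(F(\nabla u)-fu\big)\,dX,\quad u\in W_0^{1,q}(\Omega_\ell).$$ Its minimizer exists and is unique under the stated hypotheses. *)

theory Defs
  imports "HOL-Analysis.Analysis"
begin

definition grad :: "('a::euclidean_space \<Rightarrow> real) \<Rightarrow> 'a \<Rightarrow> 'a" where
  "grad \<phi> x = (\<Sum>b\<in>Basis. frechet_derivative \<phi> (at x) b *\<^sub>R b)"

primrec C_diff :: "nat \<Rightarrow> ('a::euclidean_space \<Rightarrow> real) \<Rightarrow> bool" where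
  "C_diff 0 \<phi> \<longleftrightarrow> continuous_on UNIV \<phi>"
| "C_diff (Suc k) \<phi> \<longleftrightarrow> (\<forall>x. \<phi> differentiable (at x)) \<and>
     (\<forall>b\<in>Basis. C_diff k (\<lambda>x. frechet_derivative \<phi> (at x) b))"

text \<open>The space of smooth functions on the whole space whose support is a compact
  subset of \<open>\<Omega>\<close>.\<close>

definition test_functions :: "'a::euclidean_space set \<Rightarrow> ('a \<Rightarrow> real) set" where
  "test_functions \<Omega> = {\<phi>. (\<forall>k. C_diff k \<phi>) \<and>
     (\<exists>K. compact K \<and> K \<subseteq> \<Omega> \<and> (\<forall>x. x \<notin> K \<longrightarrow> \<phi> x = 0))}"

text \<open>Elements of \<open>L\<^sup>q(\<Omega>)\<close> and of the Sobolev spaces are represented by functions on the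
  whole space; their values outside \<open>\<Omega>\<close> are irrelevant, and functions equal almost
  everywhere on \<open>\<Omega>\<close> are not identified.\<close>

definition Lq :: "real \<Rightarrow> 'a::euclidean_space set \<Rightarrow> ('a \<Rightarrow> 'b::euclidean_space) set" where
  "Lq q \<Omega> = {u. u \<in> borel_measurable (lebesgue_on \<Omega>) \<and>
     integrable (lebesgue_on \<Omega>) (\<lambda>x. norm (u x) powr q)}"

definition L1_loc :: "'a::euclidean_space set \<Rightarrow> ('a \<Rightarrow> 'b::euclidean_space) set" where
  "L1_loc \<Omega> = {u. \<forall>K. compact K \<and> K \<subseteq> \<Omega> \<longrightarrow> integrable (lebesgue_on K) u}"

definition has_weak_gradient ::
    "'a::euclidean_space set \<Rightarrow> ('a \<Rightarrow> real) \<Rightarrow> ('a \<Rightarrow> 'a) \<Rightarrow> bool" where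
  "has_weak_gradient \<Omega> u G \<longleftrightarrow> u \<in> L1_loc \<Omega> \<and> G \<in> L1_loc \<Omega> \<and>
     (\<forall>\<phi>\<in>test_functions \<Omega>. \<forall>b\<in>Basis.
        (\<integral>x. u x * frechet_derivative \<phi> (at x) b \<partial>(lebesgue_on \<Omega>))
          = - (\<integral>x. (G x \<bullet> b) * \<phi> x \<partial>(lebesgue_on \<Omega>)))"

text \<open>For open \<open>\<Omega>\<close> the weak gradient is unique up to null sets, so the choice below is
  immaterial.\<close>

definition weak_grad :: "'a::euclidean_space set \<Rightarrow> ('a \<Rightarrow> real) \<Rightarrow> 'a \<Rightarrow> 'a" where
  "weak_grad \<Omega> u = (SOME G. has_weak_gradient \<Omega> u G)"

definition W1 :: "real \<Rightarrow> 'a::euclidean_space set \<Rightarrow> ('a \<Rightarrow> real) set" where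
  "W1 q \<Omega> = {u. u \<in> Lq q \<Omega> \<and> (\<exists>G. G \<in> Lq q \<Omega> \<and> has_weak_gradient \<Omega> u G)}"

text \<open>The closure of the test functions in the Sobolev norm.\<close>

definition W1_0 :: "real \<Rightarrow> 'a::euclidean_space set \<Rightarrow> ('a \<Rightarrow> real) set" where
  "W1_0 q \<Omega> = {u. u \<in> W1 q \<Omega> \<and>
     (\<exists>\<phi>. (\<forall>k::nat. \<phi> k \<in> test_functions \<Omega>) \<and>
        (\<lambda>k. \<integral>x. norm (\<phi> k x - u x) powr q \<partial>(lebesgue_on \<Omega>)) \<longlonglongrightarrow> 0 \<and>
        (\<lambda>k. \<integral>x. norm (grad (\<phi> k) x - weak_grad \<Omega> u x) powr q \<partial>(lebesgue_on \<Omega>))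
          \<longlonglongrightarrow> 0)}"

definition energy ::
    "('a::euclidean_space \<Rightarrow> real) \<Rightarrow> ('a \<Rightarrow> real) \<Rightarrow> 'a set \<Rightarrow> ('a \<Rightarrow> real) \<Rightarrow> real" where
  "energy F f \<Omega> u = (\<integral>X. F (weak_grad \<Omega> u X) - f X * u X \<partial>(lebesgue_on \<Omega>))"

definition is_energy_minimizer ::
    "real \<Rightarrow> ('a::euclidean_space \<Rightarrow> real) \<Rightarrow> ('a \<Rightarrow> real) \<Rightarrow> 'a set \<Rightarrow> ('a \<Rightarrow> real) \<Rightarrow> bool" where
  "is_energy_minimizer q F f \<Omega> u \<longleftrightarrow>
     u \<in> W1_0 q \<Omega> \<and> (\<forall>v\<in>W1_0 q \<Omega>. energy F f \<Omega> u \<le> energy F f \<Omega> v)"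

text \<open>With \<open>p = CARD('p)\<close> and \<open>n = CARD('p) + CARD('m)\<close>, the space \<open>\<real>\<^sup>n\<close> is
  rendered as \<open>(real ^ 'p) \<times> (real ^ 'm)\<close>, whose norm is the Euclidean one; index types
  being nonempty, \<open>1 \<le> p \<le> n - 1\<close> and \<open>n \<ge> 2\<close> hold automatically.\<close>

definition cylinder ::
    "real \<Rightarrow> (real ^ 'm) set \<Rightarrow> ((real ^ 'p) \<times> (real ^ 'm)) set" where
  "cylinder l \<omega> = {x. \<forall>i. - l < x $ i \<and> x $ i < l} \<times> \<omega>"

end

theory Submission
  imports Defs "HOL-Real_Asymp.Real_Asymp"
begin

text \<open>The minimizers are ordered: if \<open>\<Omega>\<close> is contained in \<open>\<Omega>'\<close>, then \<open>u \<le> u'\<close>, because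
  \<open>E (min u u') + E (max u u') \<le> E u + E u'\<close> and uniform convexity makes minimizers unique.
  Since \<open>f\<close> does not see \<open>X\<^sub>1\<close>, the same holds for translates: \<open>u\<^sub>l (X\<^sub>1 + a, X\<^sub>2) \<le> u\<^sub>l\<^sub>' (X\<^sub>1, X\<^sub>2)\<close>
  whenever all \<open>\<bar>a\<^sub>i\<bar> \<le> l' - l\<close>. Hence \<open>u\<^sub>l\<close> increases with \<open>l\<close>, and its limit is invariant under all
  translations in \<open>X\<^sub>1\<close>. The limit is finite: testing with \<open>0\<close>, the Poincare inequality in a
  direction of \<open>\<omega>\<^sub>2\<close> gives \<open>\<integral> u\<^sub>l\<^sup>q \<le> C l\<^sup>p\<close>, and averaging \<open>u\<^sub>l (X) \<le> u\<^sub>2\<^sub>l (X\<^sub>1 - a, X\<^sub>2)\<close> over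
  \<open>a \<in> (-l, l)\<^sup>p\<close> turns this into a bound on \<open>\<integral> u\<^sub>l\<^sup>q\<close> over \<open>Q \<times> \<omega>\<^sub>2\<close>, uniform in \<open>l\<close>, for every
  bounded \<open>Q\<close>.\<close>

section \<open>Smooth functions and test functions\<close>

text \<open>The Poincare inequality uses a direction of \<open>\<omega>\<^sub>2\<close> because the
  width of the cylinder there does not grow with \<open>l\<close>, so its constant is uniform. The
  resulting bound of order \<open>l^p\<close> still says nothing about a fixed bounded piece; it
  becomes local because the set of admissible shifts has measure of the same order. As
  \<open>weak_grad\<close> is a choice, the argument runs on pairs of a function and a gradient,
  approximated together by test functions. Only at the end are these identified with
  \<open>W1_0\<close>, through uniqueness of weak gradients. The same uniqueness makes the gradient
  vanish almost everywhere on the zero set of a nonnegative function, which the min-max inequality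
  needs where both minimizers vanish. Every comparison holds outside a null set that depends on the
  two sizes and on the shift, and there are uncountably many of these. The limit is therefore taken
  along integer sizes, a given sequence is squeezed between them, and Fubini turns invariance under
  each single shift into independence of \<open>X\<^sub>1\<close>.\<close>

lemma has_derivative_grad:
  assumes "\<phi> differentiable (at x)"
  shows "(\<phi> has_derivative (\<lambda>h. grad \<phi> x \<bullet> h)) (at x)"
proof -
  let ?D = "frechet_derivative \<phi> (at x)"
  have D: "(\<phi> has_derivative ?D) (at x)"
    using assms frechet_derivative_works by blast
  interpret bounded_linear ?D
    using D has_derivative_bounded_linear by blast
  have "?D h = grad \<phi> x \<bullet> h" for h
  proof -
    have "?D h = ?D (\<Sum>b\<in>Basis. (h \<bullet> b) *\<^sub>R b)" by (simp add: euclidean_representation)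
    also have "\<dots> = (\<Sum>b\<in>Basis. (h \<bullet> b) * ?D b)" by (simp add: sum scaleR)
    also have "\<dots> = grad \<phi> x \<bullet> h"
      by (simp add: grad_def inner_sum_left inner_commute[of h] inner_sum_right mult.commute)
    finally show ?thesis .
  qed
  then show ?thesis using D by (metis (no_types, lifting) ext)
qed

lemma frechet_derivative_eqI: "(\<phi> has_derivative D) (at x) \<Longrightarrow> frechet_derivative \<phi> (at x) = D"
  by (metis frechet_derivative_at)

lemma grad_eqI:
  fixes \<phi> :: "'a::euclidean_space \<Rightarrow> real"
  assumes "(\<phi> has_derivative (\<lambda>h. v \<bullet> h)) (at x)"
  shows "grad \<phi> x = v"
proof -
  have "grad \<phi> x = (\<Sum>b\<in>Basis. (v \<bullet> b) *\<^sub>R b)"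
    unfolding grad_def frechet_derivative_eqI[OF assms] by simp
  then show ?thesis by (simp add: euclidean_representation)
qed

lemma grad_inner_Basis: "b \<in> Basis \<Longrightarrow> grad \<phi> x \<bullet> b = frechet_derivative \<phi> (at x) b"
  by (simp add: grad_def inner_sum_left_Basis)

section \<open>Stability of k-fold differentiability under algebraic operations and
  composition\<close>

lemma C_diff_continuous: "C_diff k \<phi> \<Longrightarrow> continuous_on UNIV \<phi>"
  by (cases k) (auto simp: continuous_on_eq_continuous_at differentiable_imp_continuous_within)

lemma C_diff_SucD: "C_diff (Suc k) \<phi> \<Longrightarrow> C_diff k \<phi>"
proof (induction k arbitrary: \<phi>)
  case 0
  then show ?case using C_diff_continuous C_diff.simps(1) by blast
next
  case (Suc k)
  then show ?case by (metis C_diff.simps(2))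
qed

lemma C_diff_SucI:
  assumes "\<And>x. (\<phi> has_derivative D x) (at x)" "\<And>b. b \<in> Basis \<Longrightarrow> C_diff k (\<lambda>x. D x b)"
  shows "C_diff (Suc k) \<phi>"
  using assms by (auto simp: frechet_derivative_eqI[OF assms(1)] differentiable_def)

lemma C_diff_Suc_has_derivative:
  "C_diff (Suc k) \<phi> \<Longrightarrow> (\<phi> has_derivative frechet_derivative \<phi> (at x)) (at x)"
  using frechet_derivative_works by auto

lemma C_diff_const: "C_diff k (\<lambda>x. c)"
proof (induction k arbitrary: c)
  case (Suc k)
  show ?case by (rule C_diff_SucI[where D="\<lambda>x h. 0"]) (use Suc in auto)
qed auto

lemma C_diff_inner: "C_diff k (\<lambda>x. x \<bullet> v)"
proof (cases k)
  case (Suc k)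
  show ?thesis unfolding Suc
    by (rule C_diff_SucI[where D="\<lambda>x h. h \<bullet> v"])
      (auto intro!: derivative_eq_intros C_diff_const)
qed (auto intro!: continuous_intros)

lemma C_diff_add: "C_diff k \<phi> \<Longrightarrow> C_diff k \<psi> \<Longrightarrow> C_diff k (\<lambda>x. \<phi> x + \<psi> x)"
proof (induction k arbitrary: \<phi> \<psi>)
  case (Suc k)
  show ?case
    by (rule C_diff_SucI[OF has_derivative_add[OF Suc.prems[THEN C_diff_Suc_has_derivative]]])
      (use Suc in auto)
qed (auto intro: continuous_intros)

lemma C_diff_mult: "C_diff k \<phi> \<Longrightarrow> C_diff k \<psi> \<Longrightarrow> C_diff k (\<lambda>x. \<phi> x * \<psi> x)"
proof (induction k arbitrary: \<phi> \<psi>)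
  case (Suc k)
  show ?case
    by (rule C_diff_SucI[OF has_derivative_mult[OF Suc.prems[THEN C_diff_Suc_has_derivative]]])
      (use Suc.prems Suc.prems[THEN C_diff_SucD] in \<open>auto intro!: C_diff_add Suc.IH\<close>)
qed (auto intro: continuous_intros)

text \<open>Only the composition of \<open>h'\<close> with \<open>\<phi>\<close> has to be of class
  \<open>k\<close>, so an outer function whose derivative is built from the same family
  (exponentials, powers of \<open>t\<^sup>2 + e\<close>, \<open>flat\<close>) is handled by
  induction on \<open>k\<close>.\<close>

lemma C_diff_chain:
  assumes "C_diff (Suc k) \<phi>" "\<And>t. (h has_real_derivative h' t) (at t)"
    and "C_diff k (\<lambda>x. h' (\<phi> x))"
  shows "C_diff (Suc k) (\<lambda>x. h (\<phi> x))"
proof (rule C_diff_SucI)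
  show "((\<lambda>x. h (\<phi> x)) has_derivative (\<lambda>y. h' (\<phi> x) * frechet_derivative \<phi> (at x) y)) (at x)" for x
  proof -
    have "(h has_derivative (*) (h' (\<phi> x))) (at (\<phi> x))"
      using assms(2) has_field_derivative_def by blast
    from has_derivative_compose[OF C_diff_Suc_has_derivative[OF assms(1)] this]
    show ?thesis .
  qed
  show "C_diff k (\<lambda>x. h' (\<phi> x) * frechet_derivative \<phi> (at x) b)" if "b \<in> Basis" for b
    using that assms by (auto intro!: C_diff_mult)
qed

lemma C_diff_exp: "C_diff k \<phi> \<Longrightarrow> C_diff k (\<lambda>x. exp (c * \<phi> x))"
proof (induction k)
  case (Suc k)
  show ?case
    by (rule C_diff_chain[OF Suc.prems, where h="\<lambda>t. exp (c * t)" and h'="\<lambda>t. c * exp (c * t)"])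
      (auto intro!: derivative_eq_intros C_diff_mult C_diff_const Suc.IH Suc.prems[THEN C_diff_SucD]
        simp del: C_diff.simps)
qed (auto intro!: continuous_intros)

text \<open>Each derivative lowers the exponent by 1, hence the induction leaves \<open>a\<close>
  arbitrary; \<open>e > 0\<close> keeps the base positive. The exponent 1/2 gives the smoothed
  absolute value used for minima.\<close>

lemma C_diff_powr:
  assumes "e > 0"
  shows "C_diff k \<phi> \<Longrightarrow> C_diff k (\<lambda>x. ((\<phi> x)\<^sup>2 + e) powr a)"
proof (induction k arbitrary: a)
  case 0
  have "(\<phi> x)\<^sup>2 + e \<noteq> 0" for x using assms by (smt (verit) zero_le_power2)
  then show ?case using 0 by (auto intro!: continuous_intros)
next
  case (Suc k)
  have pos: "t\<^sup>2 + e > 0" for t :: real using assms by (smt (verit) zero_le_power2)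
  show ?case
  proof (rule C_diff_chain[OF Suc.prems, where h="\<lambda>t. (t\<^sup>2 + e) powr a"
        and h'="\<lambda>t. (2 * a) * (t * (t\<^sup>2 + e) powr (a - 1))"])
    show "((\<lambda>t. (t\<^sup>2 + e) powr a) has_real_derivative 2 * a * (t * (t\<^sup>2 + e) powr (a - 1))) (at t)" for t
      using pos[of t] by (auto intro!: derivative_eq_intros simp: powr_diff field_simps)
    show "C_diff k (\<lambda>x. 2 * a * (\<phi> x * ((\<phi> x)\<^sup>2 + e) powr (a - 1)))"
      by (intro C_diff_mult C_diff_const Suc.IH Suc.prems[THEN C_diff_SucD])
  qed
qed

text \<open>The classical function exp(-1/t) together with its quotients by powers of t: derivatives
  are linear combinations within this family, which is what an induction over \<open>C_diff\<close>
  needs.\<close>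

definition flat :: "nat \<Rightarrow> real \<Rightarrow> real" where
  "flat n t = (if t > 0 then exp (- 1 / t) / t ^ n else 0)"

lemma flat_pos_iff: "flat n t > 0 \<longleftrightarrow> t > 0" and flat_nonneg: "flat n t \<ge> 0"
  by (auto simp: flat_def)

lemma flat_lim: "(flat n \<longlongrightarrow> 0) (at 0)"
proof -
  have "((\<lambda>t::real. exp (- 1 / t) / t ^ n) \<longlongrightarrow> 0) (at_right 0)"
    by real_asymp
  then have "(flat n \<longlongrightarrow> 0) (at_right 0)"
    by (rule tendsto_cong[THEN iffD1, rotated]) (auto simp: eventually_at_filter flat_def)
  moreover have "(flat n \<longlongrightarrow> 0) (at_left 0)"
    by (rule tendsto_cong[THEN iffD1, OF _ tendsto_const]) (auto simp: eventually_at_filter flat_def)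
  ultimately show ?thesis by (simp add: filterlim_at_split)
qed

lemma flat_derivative:
  "(flat n has_real_derivative (flat (n + 2) t - real n * flat (n + 1) t)) (at t)"
proof -
  consider "t > 0" | "t < 0" | "t = 0" by linarith
  then show ?thesis
  proof cases
    case 1
    have "((\<lambda>t. exp (- 1 / t) / t ^ n) has_real_derivative (flat (n + 2) t - real n * flat (n + 1) t)) (at t)"
      using 1 by (cases n)
        (auto intro!: derivative_eq_intros simp: flat_def field_simps power2_eq_square,
         metis One_nat_def bot_nat_0.not_eq_extremum mult.commute power_minus_mult)
    then show ?thesis
      by (rule has_field_derivative_transform_within_open[where S="{0<..}"]) (use 1 in \<open>auto simp: flat_def\<close>)
  next
    case 2
    have "((\<lambda>t. 0) has_real_derivative (flat (n + 2) t - real n * flat (n + 1) t)) (at t)"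
      using 2 by (auto simp: flat_def)
    then show ?thesis
      by (rule has_field_derivative_transform_within_open[where S="{..<0}"]) (use 2 in \<open>auto simp: flat_def\<close>)
  next
    case 3
    \<comment> \<open>The difference quotient of \<open>flat n\<close> at 0 is
      \<open>flat (Suc n)\<close>, so the limit at 0, known for every \<open>n\<close>, settles the
      derivative.\<close>
    have "((\<lambda>h. flat n h / h) \<longlongrightarrow> 0) (at 0)"
    proof (rule tendsto_cong[THEN iffD1, OF _ flat_lim[of "Suc n"]])
      show "\<forall>\<^sub>F x in at 0. flat (Suc n) x = flat n x / x"
        by (auto simp: eventually_at_filter flat_def field_simps)
    qed
    then show ?thesis unfolding 3 has_field_derivative_iff by (simp add: flat_def)
  qed
qed

lemma C_diff_flat: "C_diff k \<phi> \<Longrightarrow> C_diff k (\<lambda>x. flat n (\<phi> x))"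
proof (induction k arbitrary: n)
  case 0
  have "continuous_on UNIV (flat n)"
    using flat_derivative DERIV_isCont by (blast intro: continuous_at_imp_continuous_on)
  then show ?case using 0 by (auto intro: continuous_on_compose2)
next
  case (Suc k)
  have "C_diff k (\<lambda>x. flat (n + 2) (\<phi> x) + (- real n) * flat (n + 1) (\<phi> x))"
    using Suc C_diff_SucD by (intro C_diff_add C_diff_mult C_diff_const) blast+
  then show ?case
    by (intro C_diff_chain[OF Suc.prems flat_derivative]) simp
qed

lemma C_diff_prod:
  "(\<And>i. i \<in> I \<Longrightarrow> C_diff k (\<phi> i)) \<Longrightarrow> C_diff k (\<lambda>x. \<Prod>i\<in>I. \<phi> i x)"
  by (induction I rule: infinite_finite_induct) (auto intro!: C_diff_mult C_diff_const)

lemma C_diff_translate: "C_diff k \<phi> \<Longrightarrow> C_diff k (\<lambda>x. \<phi> (x + a))"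
proof (induction k arbitrary: \<phi>)
  case 0
  then have "continuous_on UNIV \<phi>" by simp
  then show ?case
    by (simp, rule continuous_on_compose2[where t=UNIV]) (auto intro!: continuous_intros)
next
  case (Suc k)
  have "((\<lambda>x. \<phi> (x + a)) has_derivative frechet_derivative \<phi> (at (x + a))) (at x)" for x
    using has_derivative_compose[OF has_derivative_add[OF has_derivative_ident has_derivative_const]
        C_diff_Suc_has_derivative[OF Suc.prems]] by simp
  then show ?case by (rule C_diff_SucI) (use Suc in auto)
qed

section \<open>Test functions, their gradients and operations on them\<close>

lemma test_functionsD:
  assumes "\<phi> \<in> test_functions \<Omega>"
  shows "C_diff k \<phi>" "\<phi> differentiable (at x)" "continuous_on UNIV \<phi>"
    "continuous_on UNIV (grad \<phi>)" "x \<notin> \<Omega> \<Longrightarrow> \<phi> x = 0"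
proof -
  have C: "C_diff k \<phi>" for k using assms by (auto simp: test_functions_def)
  show "C_diff k \<phi>" "\<phi> differentiable (at x)" "continuous_on UNIV \<phi>"
    using C C[of "Suc 0"] C_diff_continuous C_diff.simps(2) by blast+
  have "continuous_on UNIV (\<lambda>x. frechet_derivative \<phi> (at x) b)" if "b \<in> Basis" for b
    using C[of "Suc 0"] that by auto
  then show "continuous_on UNIV (grad \<phi>)"
    unfolding grad_def by (auto intro!: continuous_intros)
  show "x \<notin> \<Omega> \<Longrightarrow> \<phi> x = 0" using assms by (auto simp: test_functions_def)
qed

text \<open>The complement of a compact set is open, so the gradient vanishes wherever the function
  does on it, and one \<open>K\<close> serves both.\<close>

lemma test_functions_support:
  assumes "\<phi> \<in> test_functions \<Omega>"
  obtains K where "compact K" "K \<subseteq> \<Omega>" "\<And>x. x \<notin> K \<Longrightarrow> \<phi> x = 0" "\<And>x. x \<notin> K \<Longrightarrow> grad \<phi> x = 0"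
proof -
  obtain K where K: "compact K" "K \<subseteq> \<Omega>" "\<And>x. x \<notin> K \<Longrightarrow> \<phi> x = 0"
    using assms by (auto simp: test_functions_def)
  moreover have "grad \<phi> x = 0" if "x \<notin> K" for x
  proof (rule grad_eqI)
    show "(\<phi> has_derivative (\<lambda>h. 0 \<bullet> h)) (at x)"
    proof (rule has_derivative_transform_within_open[where f="\<lambda>_. 0" and s="-K"])
      show "open (- K)" using K(1) compact_imp_closed by auto
    qed (use that K in auto)
  qed
  ultimately show ?thesis using that by blast
qed

lemma test_functions_grad_outside:
  assumes "\<phi> \<in> test_functions \<Omega>" "x \<notin> \<Omega>"
  shows "grad \<phi> x = 0"
  by (rule test_functions_support[OF assms(1)]) (use assms(2) in auto)

lemma test_functions_bounded:
  assumes "\<phi> \<in> test_functions \<Omega>"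
  obtains B where "\<And>x. \<bar>\<phi> x\<bar> \<le> B" "\<And>x. norm (grad \<phi> x) \<le> B"
proof -
  obtain K where K: "compact K" "\<And>x. x \<notin> K \<Longrightarrow> \<phi> x = 0" "\<And>x. x \<notin> K \<Longrightarrow> grad \<phi> x = 0"
    using test_functions_support[OF assms] by metis
  have "bounded (\<phi> ` K)" "bounded (grad \<phi> ` K)"
    using K(1) test_functionsD(3,4)[OF assms]
    by (auto intro!: compact_imp_bounded compact_continuous_image intro: continuous_on_subset)
  then obtain B1 B2 where "\<And>x. x \<in> K \<Longrightarrow> norm (\<phi> x) \<le> B1" "\<And>x. x \<in> K \<Longrightarrow> norm (grad \<phi> x) \<le> B2"
    unfolding bounded_iff by blast
  then have "\<bar>\<phi> x\<bar> \<le> max 0 (max B1 B2)" "norm (grad \<phi> x) \<le> max 0 (max B1 B2)" for x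
    using K(2,3) by (cases "x \<in> K"; fastforce)+
  then show ?thesis using that by blast
qed

lemma test_functions_mono: "\<Omega> \<subseteq> \<Omega>' \<Longrightarrow> test_functions \<Omega> \<subseteq> test_functions \<Omega>'"
  unfolding test_functions_def by blast

lemma test_functions_lincomb:
  assumes "\<phi> \<in> test_functions \<Omega>" "\<psi> \<in> test_functions \<Omega>"
  shows "(\<lambda>x. a * \<phi> x + b * \<psi> x) \<in> test_functions \<Omega>"
    and "grad (\<lambda>x. a * \<phi> x + b * \<psi> x) = (\<lambda>x. a *\<^sub>R grad \<phi> x + b *\<^sub>R grad \<psi> x)"
proof -
  obtain K L where K: "compact K" "K \<subseteq> \<Omega>" "\<And>x. x \<notin> K \<Longrightarrow> \<phi> x = 0"
    and L: "compact L" "L \<subseteq> \<Omega>" "\<And>x. x \<notin> L \<Longrightarrow> \<psi> x = 0"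
    using assms by (auto simp: test_functions_def)
  have "C_diff k (\<lambda>x. a * \<phi> x + b * \<psi> x)" for k
    using assms by (intro C_diff_add C_diff_mult C_diff_const test_functionsD(1))
  moreover have "compact (K \<union> L)" "K \<union> L \<subseteq> \<Omega>" using K L by auto
  moreover have "x \<notin> K \<union> L \<Longrightarrow> a * \<phi> x + b * \<psi> x = 0" for x using K L by auto
  ultimately show "(\<lambda>x. a * \<phi> x + b * \<psi> x) \<in> test_functions \<Omega>"
    unfolding test_functions_def by blast
  show "grad (\<lambda>x. a * \<phi> x + b * \<psi> x) = (\<lambda>x. a *\<^sub>R grad \<phi> x + b *\<^sub>R grad \<psi> x)"
    by (rule ext, rule grad_eqI)
      (auto intro!: derivative_eq_intros has_derivative_grad test_functionsD(2) assms simp: inner_add_left)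
qed

lemma test_functions_mult:
  assumes "\<phi> \<in> test_functions \<Omega>" "\<psi> \<in> test_functions \<Omega>'"
  shows "(\<lambda>x. \<phi> x * \<psi> x) \<in> test_functions \<Omega>"
    and "grad (\<lambda>x. \<phi> x * \<psi> x) x = \<psi> x *\<^sub>R grad \<phi> x + \<phi> x *\<^sub>R grad \<psi> x"
proof -
  obtain K where K: "compact K" "K \<subseteq> \<Omega>" "\<And>x. x \<notin> K \<Longrightarrow> \<phi> x = 0"
    using assms by (auto simp: test_functions_def)
  have "C_diff k (\<lambda>x. \<phi> x * \<psi> x)" for k
    by (intro C_diff_mult test_functionsD(1)[OF assms(1)] test_functionsD(1)[OF assms(2)])
  moreover have "x \<notin> K \<Longrightarrow> \<phi> x * \<psi> x = 0" for x using K by auto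
  ultimately show "(\<lambda>x. \<phi> x * \<psi> x) \<in> test_functions \<Omega>"
    unfolding test_functions_def using K by blast
  show "grad (\<lambda>x. \<phi> x * \<psi> x) x = \<psi> x *\<^sub>R grad \<phi> x + \<phi> x *\<^sub>R grad \<psi> x"
    by (rule grad_eqI)
      (auto intro!: derivative_eq_intros has_derivative_grad test_functionsD(2)[OF assms(1)]
         test_functionsD(2)[OF assms(2)] simp: inner_add_left)
qed

lemma test_functions_translate:
  assumes "\<phi> \<in> test_functions \<Omega>"
  shows "(\<lambda>x. \<phi> (x + a)) \<in> test_functions ((\<lambda>x. x - a) ` \<Omega>)"
    and "grad (\<lambda>x. \<phi> (x + a)) = (\<lambda>x. grad \<phi> (x + a))"
proof -
  obtain K where K: "compact K" "K \<subseteq> \<Omega>" "\<And>x. x \<notin> K \<Longrightarrow> \<phi> x = 0"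
    using assms by (auto simp: test_functions_def)
  have "compact ((\<lambda>x. x - a) ` K)" using compact_translation_subtract[OF K(1)] .
  moreover have "(\<lambda>x. x - a) ` K \<subseteq> (\<lambda>x. x - a) ` \<Omega>" using K by auto
  moreover have "\<phi> (x + a) = 0" if "x \<notin> (\<lambda>x. x - a) ` K" for x
  proof (rule K(3))
    show "x + a \<notin> K" using that by (metis add_diff_cancel_right' image_eqI)
  qed
  moreover have "C_diff k (\<lambda>x. \<phi> (x + a))" for k
    by (rule C_diff_translate test_functionsD assms)+
  ultimately show "(\<lambda>x. \<phi> (x + a)) \<in> test_functions ((\<lambda>x. x - a) ` \<Omega>)"
    unfolding test_functions_def by blast
  show "grad (\<lambda>x. \<phi> (x + a)) = (\<lambda>x. grad \<phi> (x + a))"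
  proof (rule ext, rule grad_eqI)
    fix x
    show "((\<lambda>x. \<phi> (x + a)) has_derivative (\<lambda>h. grad \<phi> (x + a) \<bullet> h)) (at x)"
      using has_derivative_compose[OF has_derivative_add[OF has_derivative_ident has_derivative_const]
        has_derivative_grad[OF test_functionsD(2)[OF assms]]] by simp
  qed
qed

definition box_bump :: "'a::euclidean_space \<Rightarrow> 'a \<Rightarrow> 'a \<Rightarrow> real" where
  "box_bump a c x = (\<Prod>b\<in>Basis. flat 0 ((x - a) \<bullet> b) * flat 0 ((c - x) \<bullet> b))"

lemma box_bump_nonneg: "box_bump a c x \<ge> 0"
  unfolding box_bump_def by (intro prod_nonneg) (auto simp: flat_nonneg)

lemma box_bump_pos_iff: "box_bump a c x > 0 \<longleftrightarrow> x \<in> box a c"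
proof
  assume "x \<in> box a c"
  then show "box_bump a c x > 0"
    unfolding box_bump_def by (intro prod_pos) (auto simp: box_def inner_diff_left flat_pos_iff)
next
  assume *: "box_bump a c x > 0"
  show "x \<in> box a c"
  proof (rule ccontr)
    assume "x \<notin> box a c"
    then obtain b where b: "b \<in> Basis" "\<not> (a \<bullet> b < x \<bullet> b \<and> x \<bullet> b < c \<bullet> b)" by (auto simp: box_def)
    then have "flat 0 ((x - a) \<bullet> b) * flat 0 ((c - x) \<bullet> b) = 0"
      by (auto simp: flat_def inner_diff_left)
    then have "box_bump a c x = 0" unfolding box_bump_def using b(1) by (meson finite_Basis prod_zero)
    then show False using * by simp
  qed
qed

text \<open>Smooth functions with values in [0,1] that tend to the indicator of the open box: the
  exponential tends to 0 where the bump is positive and stays 1 elsewhere. Dominated convergence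
  then leads from test functions to boxes without mollification.\<close>

definition box_cutoff :: "'a::euclidean_space \<Rightarrow> 'a \<Rightarrow> nat \<Rightarrow> 'a \<Rightarrow> real" where
  "box_cutoff a c n x = 1 - exp (- real n * box_bump a c x)"

lemma C_diff_box_cutoff: "C_diff k (box_cutoff a c n)"
proof -
  have 1: "C_diff k (\<lambda>x. flat 0 (x \<bullet> b + (- (a \<bullet> b))) * flat 0 (c \<bullet> b + (-1) * (x \<bullet> b)))" for b
    by (intro C_diff_mult C_diff_flat C_diff_add C_diff_inner C_diff_const)
  have "C_diff k (box_bump a c)"
    unfolding box_bump_def by (rule C_diff_prod) (use 1 in \<open>simp add: inner_diff_left\<close>)
  then have "C_diff k (\<lambda>x. 1 + (-1) * exp (- real n * box_bump a c x))"
    by (intro C_diff_add C_diff_mult C_diff_const C_diff_exp)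
  then show ?thesis unfolding box_cutoff_def by simp
qed

lemma box_cutoff_bounds: "0 \<le> box_cutoff a c n x" "box_cutoff a c n x \<le> 1"
  by (auto simp: box_cutoff_def box_bump_nonneg)

lemma box_cutoff_lim: "(\<lambda>n. box_cutoff a c n x) \<longlonglongrightarrow> indicat_real (box a c) x"
proof (cases "x \<in> box a c")
  case True
  then have "box_bump a c x > 0" by (simp add: box_bump_pos_iff)
  then have "(\<lambda>n. 1 - exp (- real n * box_bump a c x)) \<longlonglongrightarrow> 1 - 0"
    by (intro tendsto_diff tendsto_const) real_asymp
  then show ?thesis using True unfolding box_cutoff_def by simp
next
  case False
  then have "box_bump a c x = 0"
    using box_bump_pos_iff[of a c x] box_bump_nonneg[of a c x] by linarith
  then show ?thesis using False by (simp add: box_cutoff_def)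
qed

lemma box_cutoff_test:
  assumes "cbox a c \<subseteq> \<Omega>"
  shows "box_cutoff a c n \<in> test_functions \<Omega>"
proof -
  have "box_cutoff a c n x = 0" if "x \<notin> cbox a c" for x
  proof -
    have "x \<notin> box a c" using that box_subset_cbox by blast
    then have "box_bump a c x = 0"
      using box_bump_pos_iff[of a c x] box_bump_nonneg[of a c x] by linarith
    then show ?thesis by (simp add: box_cutoff_def)
  qed
  then have "\<exists>K. compact K \<and> K \<subseteq> \<Omega> \<and> (\<forall>x. x \<notin> K \<longrightarrow> box_cutoff a c n x = 0)"
    using assms compact_cbox by (intro exI[of _ "cbox a c"]) simp
  then show ?thesis unfolding test_functions_def by (simp add: C_diff_box_cutoff)
qed

section \<open>Closure of the test functions in the Sobolev norm\<close>

text \<open>A substitute for Minkowski's inequality. Only convergence to 0 and the existence of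
  constants matter, so the factor \<open>2 powr q\<close> is harmless and no q-th roots have to be
  taken.\<close>

lemma powr_norm_add:
  fixes a b :: "'b::real_normed_vector"
  assumes "q \<ge> 0"
  shows "norm (a + b) powr q \<le> 2 powr q * (norm a powr q + norm b powr q)"
proof -
  have "norm (a + b) \<le> 2 * max (norm a) (norm b)"
    using norm_triangle_ineq[of a b] by linarith
  then have "norm (a + b) powr q \<le> (2 * max (norm a) (norm b)) powr q"
    using assms by (intro powr_mono2) auto
  also have "\<dots> = 2 powr q * max (norm a) (norm b) powr q" by (rule powr_mult)
  also have "\<dots> \<le> 2 powr q * (norm a powr q + norm b powr q)"
    by (intro mult_left_mono) (auto simp: max_def)
  finally show ?thesis .
qed

text \<open>Below, functions are Borel on the whole space and vanish outside their domain, so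
  that Fubini and translations apply; \<open>Lqd\<close> is the \<open>q\<close>-th power of the distance in \<open>L\<^sup>q\<close>.\<close>

definition Lqb :: "real \<Rightarrow> ('a::euclidean_space \<Rightarrow> 'b::euclidean_space) \<Rightarrow> bool" where
  "Lqb q u \<longleftrightarrow> u \<in> borel_measurable borel \<and> integrable lborel (\<lambda>x. norm (u x) powr q)"

definition Lqd :: "real \<Rightarrow> ('a::euclidean_space \<Rightarrow> 'b::euclidean_space) \<Rightarrow> ('a \<Rightarrow> 'b) \<Rightarrow> real" where
  "Lqd q u v = (LBINT x. norm (u x - v x) powr q)"

lemma LqbD [measurable_dest]: "Lqb q u \<Longrightarrow> u \<in> borel_measurable borel"
  by (simp add: Lqb_def)

lemma Lqb_integrable: "Lqb q u \<Longrightarrow> integrable lborel (\<lambda>x. norm (u x) powr q)"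
  by (simp add: Lqb_def)

lemma Lqb_bound:
  assumes "Lqb q u" "v \<in> borel_measurable borel" "q \<ge> 0" "\<And>x. norm (v x) \<le> norm (u x)"
  shows "Lqb q v"
  unfolding Lqb_def
proof (intro conjI)
  show "integrable lborel (\<lambda>x. norm (v x) powr q)"
  proof (rule Bochner_Integration.integrable_bound[OF Lqb_integrable[OF assms(1)]])
    show "AE x in lborel. norm (norm (v x) powr q) \<le> norm (norm (u x) powr q)"
      using assms by (auto intro!: powr_mono2)
  qed (use assms(2) in measurable)
qed (fact assms)

lemma Lqb_zero: "Lqb q (\<lambda>x. 0)"
  by (auto simp: Lqb_def)

lemma Lqb_scaleR: "Lqb q u \<Longrightarrow> Lqb q (\<lambda>x. c *\<^sub>R u x)"
  by (auto simp: Lqb_def powr_mult)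

lemma Lqb_add:
  assumes u: "Lqb q u" and v: "Lqb q v" and q: "q \<ge> 0"
  shows "Lqb q (\<lambda>x. u x + v x)"
  unfolding Lqb_def
proof (intro conjI)
  note [measurable] = LqbD[OF u] LqbD[OF v]
  show "(\<lambda>x. u x + v x) \<in> borel_measurable borel" by measurable
  have "integrable lborel (\<lambda>x. 2 powr q * (norm (u x) powr q + norm (v x) powr q))"
    using u v by (auto simp: Lqb_def)
  then show "integrable lborel (\<lambda>x. norm (u x + v x) powr q)"
  proof (rule Bochner_Integration.integrable_bound)
    show "AE x in lborel. norm (norm (u x + v x) powr q)
        \<le> norm (2 powr q * (norm (u x) powr q + norm (v x) powr q))"
      using order_trans[OF powr_norm_add[OF q] abs_ge_self] by (intro AE_I2) simp
  qed measurable
qed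

lemma Lqb_diff:
  assumes "Lqb q u" "Lqb q v" "q \<ge> 0"
  shows "Lqb q (\<lambda>x. u x - v x)"
  using Lqb_add[OF assms(1) Lqb_scaleR[OF assms(2), of "-1"] assms(3)] by simp

lemma Lqd_nonneg: "Lqd q u v \<ge> 0"
  by (simp add: Lqd_def)

lemma Lqd_commute: "Lqd q u v = Lqd q v u"
  by (simp add: Lqd_def norm_minus_commute)

text \<open>Three different codomains are allowed, so one bound serves sums, products with bounded
  coefficients, and Lipschitz functions of two arguments.\<close>

lemma Lqd_le_sum:
  fixes f g :: "'a::euclidean_space \<Rightarrow> 'b::euclidean_space" and a b :: "'a \<Rightarrow> 'c::euclidean_space"
    and c d :: "'a \<Rightarrow> 'd::euclidean_space"
  assumes L: "Lqb q f" "Lqb q g" "Lqb q a" "Lqb q b" "Lqb q c" "Lqb q d" and q: "q \<ge> 0"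
    and le: "\<And>x. norm (f x - g x) \<le> norm (a x - b x) + norm (c x - d x)"
  shows "Lqd q f g \<le> 2 powr q * (Lqd q a b + Lqd q c d)"
proof -
  have i: "integrable lborel (\<lambda>x. norm (f x - g x) powr q)" "integrable lborel (\<lambda>x. norm (a x - b x) powr q)"
    "integrable lborel (\<lambda>x. norm (c x - d x) powr q)"
    using L q by (auto intro!: Lqb_integrable Lqb_diff)
  have "norm (f x - g x) powr q \<le> 2 powr q * (norm (a x - b x) powr q + norm (c x - d x) powr q)" for x
  proof -
    have "norm (f x - g x) powr q \<le> norm (norm (a x - b x) + norm (c x - d x)) powr q"
      using le[of x] q by (intro powr_mono2) auto
    then show ?thesis using powr_norm_add[OF q, of "norm (a x - b x)" "norm (c x - d x)"] by simp
  qed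
  then have "Lqd q f g \<le> (LBINT x. 2 powr q * (norm (a x - b x) powr q + norm (c x - d x) powr q))"
    unfolding Lqd_def using i by (intro integral_mono) auto
  also have "\<dots> = 2 powr q * (Lqd q a b + Lqd q c d)" unfolding Lqd_def using i by simp
  finally show ?thesis .
qed

lemma Lqd_add:
  assumes "Lqb q u" "Lqb q v" "Lqb q u'" "Lqb q v'" "q \<ge> 0"
  shows "Lqd q (\<lambda>x. u x + u' x) (\<lambda>x. v x + v' x) \<le> 2 powr q * (Lqd q u v + Lqd q u' v')"
  by (rule Lqd_le_sum) (auto intro!: Lqb_add assms norm_diff_triangle_ineq simp del: real_norm_def)

lemma Lqd_tendsto_zeroI:
  assumes "\<And>k. Lqd q (u k) v \<le> c k" "c \<longlonglongrightarrow> 0"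
  shows "(\<lambda>k. Lqd q (u k) v) \<longlonglongrightarrow> 0"
  by (rule tendsto_sandwich[OF _ _ tendsto_const assms(2)])
    (intro always_eventually allI Lqd_nonneg assms(1))+

lemma Lqd_triangle:
  assumes "Lqb q u" "Lqb q v" "Lqb q w" "q \<ge> 0"
  shows "Lqd q u w \<le> 2 powr q * (Lqd q u v + Lqd q v w)"
  using Lqd_add[of q "\<lambda>x. u x - v x" "\<lambda>x. 0" "\<lambda>x. v x - w x" "\<lambda>x. 0"] assms
  by (simp add: Lqb_diff Lqb_zero) (simp add: Lqd_def)

lemma Lqd_scaleR: "Lqd q (\<lambda>x. c *\<^sub>R u x) (\<lambda>x. c *\<^sub>R v x) = \<bar>c\<bar> powr q * Lqd q u v"
proof -
  have "norm (c *\<^sub>R u x - c *\<^sub>R v x) powr q = \<bar>c\<bar> powr q * norm (u x - v x) powr q" for x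
    by (metis norm_scaleR scaleR_right_diff_distrib powr_mult)
  then show ?thesis by (simp add: Lqd_def)
qed

lemma Lqd_zero_AE:
  assumes "Lqb q u" "Lqb q v" "q > 0" "Lqd q u v \<le> 0"
  shows "AE x in lborel. u x = v x"
proof -
  have "AE x in lborel. norm (u x - v x) powr q = 0"
  proof (subst integral_nonneg_eq_0_iff_AE[symmetric])
    show "integrable lborel (\<lambda>x. norm (u x - v x) powr q)"
      using assms by (auto intro!: Lqb_integrable Lqb_diff)
    show "(LBINT x. norm (u x - v x) powr q) = 0"
      using antisym[OF assms(4) Lqd_nonneg] by (simp add: Lqd_def)
  qed auto
  then show ?thesis by (auto simp: powr_eq_0_iff)
qed

lemma tendsto_powr_0:
  assumes "(f \<longlongrightarrow> 0) F" "\<And>x. f x \<ge> (0::real)" "q > 0"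
  shows "((\<lambda>x. f x powr q) \<longlongrightarrow> 0) F"
  using tendsto_powr'[OF assms(1) tendsto_const[of q]] assms(2,3) by auto

lemma Lqd_dominated:
  fixes u :: "nat \<Rightarrow> 'a::euclidean_space \<Rightarrow> 'b::euclidean_space"
  assumes "\<And>k. u k \<in> borel_measurable borel" "v \<in> borel_measurable borel" "Lqb q (g :: 'a \<Rightarrow> 'c::euclidean_space)" "q > 0"
    and lim: "AE x in lborel. (\<lambda>k. u k x) \<longlonglongrightarrow> v x"
    and bd: "\<And>k x. norm (u k x - v x) \<le> C * norm (g x)"
  shows "(\<lambda>k. Lqd q (u k) v) \<longlonglongrightarrow> 0"
proof -
  note [measurable] = assms(1,2)
  have "(\<lambda>k. Lqd q (u k) v) \<longlonglongrightarrow> (\<integral>x. 0 \<partial>(lborel :: 'a measure))"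
    unfolding Lqd_def
  proof (rule integral_dominated_convergence[where w="\<lambda>x. \<bar>C\<bar> powr q * norm (g x) powr q"])
    show "integrable lborel (\<lambda>x. \<bar>C\<bar> powr q * norm (g x) powr q)"
      using Lqb_integrable[OF assms(3)] by simp
    show "AE x in lborel. (\<lambda>i. norm (u i x - v x) powr q) \<longlonglongrightarrow> 0"
      using lim by eventually_elim (auto intro!: tendsto_powr_0 tendsto_norm_zero assms(4) simp: LIM_zero_iff)
    show "AE x in lborel. norm (norm (u i x - v x) powr q) \<le> \<bar>C\<bar> powr q * norm (g x) powr q" for i
    proof (rule AE_I2)
      fix x :: 'a
      have "norm (u i x - v x) \<le> \<bar>C\<bar> * norm (g x)" using bd[of i x]
        by (smt (verit) mult_right_mono norm_ge_zero)
      then have "norm (u i x - v x) powr q \<le> (\<bar>C\<bar> * norm (g x)) powr q"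
        using assms(4) by (intro powr_mono2) auto
      then show "norm (norm (u i x - v x) powr q) \<le> \<bar>C\<bar> powr q * norm (g x) powr q"
        by (simp add: powr_mult)
    qed
  qed measurable
  then show ?thesis by simp
qed

lemma Lqd_AE_subseq:
  fixes u :: "nat \<Rightarrow> 'a::euclidean_space \<Rightarrow> 'b::euclidean_space"
  assumes "\<And>k. Lqb q (u k)" "Lqb q v" "q > 0" "(\<lambda>k. Lqd q (u k) v) \<longlonglongrightarrow> 0"
  obtains r :: "nat \<Rightarrow> nat" where "strict_mono r" "AE x in lborel. (\<lambda>k. u (r k) x) \<longlonglongrightarrow> v x"
proof -
  have "\<exists>r::nat\<Rightarrow>nat. strict_mono r \<and> (AE x in lborel. (\<lambda>n. norm (u (r n) x - v x) powr q) \<longlonglongrightarrow> 0)"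
    using assms by (intro tendsto_L1_AE_subseq) (auto intro!: Lqb_integrable Lqb_diff simp: Lqd_def)
  then obtain r :: "nat \<Rightarrow> nat" where r: "strict_mono r"
    "AE x in lborel. (\<lambda>n. norm (u (r n) x - v x) powr q) \<longlonglongrightarrow> 0" by blast
  from r(2) have "AE x in lborel. (\<lambda>k. u (r k) x) \<longlonglongrightarrow> v x"
  proof eventually_elim
    case (elim x)
    from tendsto_powr_0[OF elim, of "1 / q"] assms(3) have "(\<lambda>n. norm (u (r n) x - v x)) \<longlonglongrightarrow> 0"
      by (simp add: powr_powr)
    then show ?case by (metis LIM_zero_iff tendsto_norm_zero_iff)
  qed
  then show ?thesis using that r(1) by blast
qed

section \<open>Translations and Lebesgue measure\<close>

lemma lborel_integral_translate:
  fixes f :: "'a::euclidean_space \<Rightarrow> 'b::euclidean_space"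
  assumes "f \<in> borel_measurable borel"
  shows "(LBINT x. f (x + a)) = (LBINT x. f x)"
proof -
  have "(\<integral>x. f x \<partial>distr lborel borel ((+) a)) = (LBINT x. f (a + x))"
    using assms by (intro integral_distr) auto
  then show ?thesis by (simp add: lborel_distr_plus add.commute)
qed

lemma lborel_integrable_translate:
  fixes f :: "'a::euclidean_space \<Rightarrow> 'b::euclidean_space"
  assumes "integrable lborel f"
  shows "integrable lborel (\<lambda>x. f (x + a))"
proof -
  have "integrable (distr lborel borel ((+) a)) f" using assms by (simp add: lborel_distr_plus)
  then show ?thesis
    by (subst (asm) integrable_distr_eq) (use assms in \<open>auto simp: add.commute\<close>)
qed

lemma lborel_nn_integral_translate:
  fixes f :: "'a::euclidean_space \<Rightarrow> ennreal"
  assumes "f \<in> borel_measurable borel"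
  shows "(\<integral>\<^sup>+x. f (x + a) \<partial>lborel) = (\<integral>\<^sup>+x. f x \<partial>lborel)"
proof -
  have "(\<integral>\<^sup>+x. f x \<partial>distr lborel borel ((+) a)) = (\<integral>\<^sup>+x. f (a + x) \<partial>lborel)"
    using assms by (intro nn_integral_distr) auto
  then show ?thesis by (simp add: lborel_distr_plus add.commute)
qed

lemma AE_lborel_translate:
  assumes "AE x in lborel. P (x::'a::euclidean_space)"
  shows "AE x in lborel. P (x + a)"
proof -
  obtain N where N: "N \<in> null_sets lborel" "{x. \<not> P x} \<subseteq> N" using assms by (auto elim!: AE_E simp: null_sets_def)
  have "emeasure lborel ((\<lambda>x. a + x) -` N \<inter> space lborel) = emeasure (distr lborel borel ((+) a)) N"
    using N(1) by (intro emeasure_distr[symmetric]) auto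
  also have "\<dots> = 0" using N(1) by (simp add: lborel_distr_plus null_setsD1)
  finally have "emeasure lborel {x. a + x \<in> N} = 0" by (simp add: vimage_def)
  moreover have "{x. a + x \<in> N} \<in> sets lborel"
    using measurable_sets[of "(+) a" borel borel N] null_setsD2[OF N(1)] by (simp add: vimage_def)
  ultimately show ?thesis using N(2) by (intro AE_I[of _ _ "{x. a + x \<in> N}"]) (auto simp: add.commute)
qed

lemma Lqb_translate: "Lqb q u \<Longrightarrow> Lqb q (\<lambda>x. u (x + a))"
  unfolding Lqb_def using lborel_integrable_translate by auto

lemma Lqd_translate:
  assumes "u \<in> borel_measurable borel" "v \<in> borel_measurable borel"
  shows "Lqd q (\<lambda>x. u (x + a)) (\<lambda>x. v (x + a)) = Lqd q u v"
  unfolding Lqd_def using assms by (intro lborel_integral_translate[where f="\<lambda>x. norm (u x - v x) powr q"]) measurable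

lemma continuous_compact_support_integrable:
  fixes h :: "'a::euclidean_space \<Rightarrow> 'b::euclidean_space"
  assumes "continuous_on UNIV h" "compact K" "\<And>x. x \<notin> K \<Longrightarrow> h x = 0"
  shows "integrable lborel h"
proof -
  have "set_integrable lborel K h"
    unfolding set_integrable_def using assms
    by (intro borel_integrable_compact) (auto intro: continuous_on_subset)
  moreover have "(\<lambda>x. indicator K x *\<^sub>R h x) = h" using assms(3) by (auto simp: indicator_def)
  ultimately show ?thesis by (simp add: set_integrable_def)
qed

lemma Lqb_test:
  assumes "\<phi> \<in> test_functions \<Omega>" "q > 0"
  shows "Lqb q \<phi>" "Lqb q (grad \<phi>)"
proof -
  obtain K where K: "compact K" "\<And>x. x \<notin> K \<Longrightarrow> \<phi> x = 0" "\<And>x. x \<notin> K \<Longrightarrow> grad \<phi> x = 0"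
    using test_functions_support[OF assms(1)] by metis
  have "continuous_on UNIV (\<lambda>x. norm (\<phi> x) powr q)" "continuous_on UNIV (\<lambda>x. norm (grad \<phi> x) powr q)"
    using test_functionsD(3,4)[OF assms(1)] assms(2)
    by (auto intro!: continuous_on_powr'[where g="\<lambda>_. q"] continuous_on_norm continuous_on_rabs continuous_on_const)
  then show "Lqb q \<phi>" "Lqb q (grad \<phi>)"
    unfolding Lqb_def using K test_functionsD(3,4)[OF assms(1)]
    by (auto intro!: continuous_compact_support_integrable[OF _ K(1)] borel_measurable_continuous_onI)
qed

text \<open>\<open>u\<close> lies in \<open>W1_0 q \<Omega>\<close> and \<open>G\<close> is its gradient.\<close>

definition W0_pair :: "real \<Rightarrow> 'a::euclidean_space set \<Rightarrow> ('a \<Rightarrow> real) \<Rightarrow> ('a \<Rightarrow> 'a) \<Rightarrow> bool" where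
  "W0_pair q \<Omega> u G \<longleftrightarrow> Lqb q u \<and> Lqb q G \<and>
     (\<forall>e>0. \<exists>\<phi>\<in>test_functions \<Omega>. Lqd q \<phi> u < e \<and> Lqd q (grad \<phi>) G < e)"

lemma W0_pair_Lqb: "W0_pair q \<Omega> u G \<Longrightarrow> Lqb q u" "W0_pair q \<Omega> u G \<Longrightarrow> Lqb q G"
  by (auto simp: W0_pair_def)

lemma W0_pair_mono: "W0_pair q \<Omega> u G \<Longrightarrow> \<Omega> \<subseteq> \<Omega>' \<Longrightarrow> W0_pair q \<Omega>' u G"
  unfolding W0_pair_def using test_functions_mono by (meson subsetD)

lemma W0_pairE:
  assumes "W0_pair q \<Omega> u G"
  obtains \<phi> where "\<And>k::nat. \<phi> k \<in> test_functions \<Omega>" "(\<lambda>k. Lqd q (\<phi> k) u) \<longlonglongrightarrow> 0" "(\<lambda>k. Lqd q (grad (\<phi> k)) G) \<longlonglongrightarrow> 0"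
proof -
  have "\<forall>k::nat. \<exists>\<phi>\<in>test_functions \<Omega>. Lqd q \<phi> u < 1 / Suc k \<and> Lqd q (grad \<phi>) G < 1 / Suc k"
    using assms by (auto simp: W0_pair_def)
  then obtain \<phi> where \<phi>: "\<And>k. \<phi> k \<in> test_functions \<Omega>" "\<And>k. Lqd q (\<phi> k) u < 1 / Suc k"
    "\<And>k. Lqd q (grad (\<phi> k)) G < 1 / Suc k" by metis
  have lim: "(\<lambda>k. 1 / real (Suc k)) \<longlonglongrightarrow> 0" by (rule LIMSEQ_Suc[OF lim_1_over_n])
  show ?thesis
    by (rule that[OF \<phi>(1)]; rule Lqd_tendsto_zeroI[OF _ lim], rule less_imp_le, rule \<phi>)
qed

text \<open>Closedness under simultaneous convergence of function and gradient. Membership of linear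
  combinations, of minima and of elements of \<open>W1_0\<close> is obtained from it.\<close>

lemma W0_pair_limI:
  assumes W: "\<And>k::nat. W0_pair q \<Omega> (u k) (G k)" and L: "Lqb q v" "Lqb q H" and q: "q > 0"
    and lim: "(\<lambda>k. Lqd q (u k) v) \<longlonglongrightarrow> 0" "(\<lambda>k. Lqd q (G k) H) \<longlonglongrightarrow> 0"
  shows "W0_pair q \<Omega> v H"
  unfolding W0_pair_def
proof (intro conjI allI impI L)
  fix e :: real assume e: "e > 0"
  \<comment> \<open>\<open>2 powr q\<close> is the factor of the quasi-triangle inequality; with
    this \<open>d\<close> it turns two errors below \<open>d\<close> into one below
    \<open>e\<close>.\<close>
  define d where "d = e / (2 * 2 powr q)"
  have d: "d > 0" using e by (simp add: d_def)
  have "\<forall>\<^sub>F k in sequentially. Lqd q (u k) v < d \<and> Lqd q (G k) H < d"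
    using order_tendstoD(2)[OF lim(1) d] order_tendstoD(2)[OF lim(2) d] by eventually_elim auto
  then obtain k where k: "Lqd q (u k) v < d" "Lqd q (G k) H < d"
    using eventually_happens'[OF sequentially_bot] by blast
  obtain \<phi> where \<phi>: "\<phi> \<in> test_functions \<Omega>" "Lqd q \<phi> (u k) < d" "Lqd q (grad \<phi>) (G k) < d"
    using W[of k] d by (auto simp: W0_pair_def)
  have q0: "q \<ge> 0" using q by simp
  have e2: "2 powr q * (d + d) = e" by (simp add: d_def)
  have "Lqd q \<phi> v \<le> 2 powr q * (Lqd q \<phi> (u k) + Lqd q (u k) v)"
    using W[of k] L Lqb_test[OF \<phi>(1) q] q0 by (intro Lqd_triangle) (auto simp: W0_pair_def)
  also have "\<dots> < 2 powr q * (d + d)" using k \<phi> by (intro mult_strict_left_mono) auto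
  finally have 1: "Lqd q \<phi> v < e" using e2 by simp
  have "Lqd q (grad \<phi>) H \<le> 2 powr q * (Lqd q (grad \<phi>) (G k) + Lqd q (G k) H)"
    using W[of k] L Lqb_test[OF \<phi>(1) q] q0 by (intro Lqd_triangle) (auto simp: W0_pair_def)
  also have "\<dots> < 2 powr q * (d + d)" using k \<phi> by (intro mult_strict_left_mono) auto
  finally have 2: "Lqd q (grad \<phi>) H < e" using e2 by simp
  show "\<exists>\<phi>\<in>test_functions \<Omega>. Lqd q \<phi> v < e \<and> Lqd q (grad \<phi>) H < e" using \<phi>(1) 1 2 by blast
qed

lemma W0_pair_test:
  assumes "\<phi> \<in> test_functions \<Omega>" "q > 0"
  shows "W0_pair q \<Omega> \<phi> (grad \<phi>)"
  unfolding W0_pair_def using Lqb_test[OF assms] assms(1)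
  by (auto intro!: bexI[of _ \<phi>] simp: Lqd_def)

lemma Lqd_lincomb_tendsto:
  assumes "\<And>k. Lqb q (u k)" "\<And>k. Lqb q (v k)" "Lqb q u'" "Lqb q v'" "q \<ge> 0"
    and "(\<lambda>k. Lqd q (u k) u') \<longlonglongrightarrow> 0" "(\<lambda>k. Lqd q (v k) v') \<longlonglongrightarrow> 0"
  shows "(\<lambda>k::nat. Lqd q (\<lambda>x. a *\<^sub>R u k x + b *\<^sub>R v k x) (\<lambda>x. a *\<^sub>R u' x + b *\<^sub>R v' x)) \<longlonglongrightarrow> 0"
proof (rule Lqd_tendsto_zeroI)
  show "Lqd q (\<lambda>x. a *\<^sub>R u k x + b *\<^sub>R v k x) (\<lambda>x. a *\<^sub>R u' x + b *\<^sub>R v' x)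
      \<le> 2 powr q * (\<bar>a\<bar> powr q * Lqd q (u k) u' + \<bar>b\<bar> powr q * Lqd q (v k) v')" for k
    by (subst Lqd_scaleR[symmetric])+ (intro Lqd_add Lqb_scaleR assms)
  show "(\<lambda>k. 2 powr q * (\<bar>a\<bar> powr q * Lqd q (u k) u' + \<bar>b\<bar> powr q * Lqd q (v k) v')) \<longlonglongrightarrow> 0"
    by (rule tendsto_eq_intros refl assms(6,7))+ simp
qed

lemma W0_pair_lincomb:
  assumes u: "W0_pair q \<Omega> u G" and v: "W0_pair q \<Omega> v H" and q: "q > 0"
  shows "W0_pair q \<Omega> (\<lambda>x. a * u x + b * v x) (\<lambda>x. a *\<^sub>R G x + b *\<^sub>R H x)"
proof -
  have q0: "q \<ge> 0" using q by simp
  obtain \<phi> \<psi> where \<phi>: "\<And>k::nat. \<phi> k \<in> test_functions \<Omega>" "(\<lambda>k. Lqd q (\<phi> k) u) \<longlonglongrightarrow> 0" "(\<lambda>k. Lqd q (grad (\<phi> k)) G) \<longlonglongrightarrow> 0"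
    and \<psi>: "\<And>k::nat. \<psi> k \<in> test_functions \<Omega>" "(\<lambda>k. Lqd q (\<psi> k) v) \<longlonglongrightarrow> 0" "(\<lambda>k. Lqd q (grad (\<psi> k)) H) \<longlonglongrightarrow> 0"
    using W0_pairE[OF u] W0_pairE[OF v] by metis
  note Lu = W0_pair_Lqb[OF u] and Lv = W0_pair_Lqb[OF v]
  note t = Lqb_test[OF \<phi>(1) q] Lqb_test[OF \<psi>(1) q]
  show ?thesis
  proof (rule W0_pair_limI[where u="\<lambda>k x. a * \<phi> k x + b * \<psi> k x"
        and G="\<lambda>k x. a *\<^sub>R grad (\<phi> k) x + b *\<^sub>R grad (\<psi> k) x", OF _ _ _ q])
    show "W0_pair q \<Omega> (\<lambda>x. a * \<phi> k x + b * \<psi> k x) (\<lambda>x. a *\<^sub>R grad (\<phi> k) x + b *\<^sub>R grad (\<psi> k) x)" for k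
      using W0_pair_test[OF test_functions_lincomb(1)[OF \<phi>(1) \<psi>(1)] q]
      by (simp add: test_functions_lincomb(2)[OF \<phi>(1) \<psi>(1)])
    show "Lqb q (\<lambda>x. a * u x + b * v x)"
      using Lqb_add[OF Lqb_scaleR[OF Lu(1)] Lqb_scaleR[OF Lv(1)] q0] by simp
    show "Lqb q (\<lambda>x. a *\<^sub>R G x + b *\<^sub>R H x)"
      by (intro Lqb_add Lqb_scaleR Lu Lv q0)
    show "(\<lambda>k. Lqd q (\<lambda>x. a * \<phi> k x + b * \<psi> k x) (\<lambda>x. a * u x + b * v x)) \<longlonglongrightarrow> 0"
      using Lqd_lincomb_tendsto[OF t(1,3) Lu(1) Lv(1) q0 \<phi>(2) \<psi>(2), of a b] by simp
    show "(\<lambda>k. Lqd q (\<lambda>x. a *\<^sub>R grad (\<phi> k) x + b *\<^sub>R grad (\<psi> k) x) (\<lambda>x. a *\<^sub>R G x + b *\<^sub>R H x)) \<longlonglongrightarrow> 0"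
      by (rule Lqd_lincomb_tendsto[OF t(2,4) Lu(2) Lv(2) q0 \<phi>(3) \<psi>(3)])
  qed
qed

lemma W0_pair_translate:
  assumes u: "W0_pair q \<Omega> u G"
  shows "W0_pair q ((\<lambda>x. x - a) ` \<Omega>) (\<lambda>x. u (x + a)) (\<lambda>x. G (x + a))"
  unfolding W0_pair_def
proof (intro conjI allI impI)
  show "Lqb q (\<lambda>x. u (x + a))" "Lqb q (\<lambda>x. G (x + a))"
    using W0_pair_Lqb[OF u] by (auto intro: Lqb_translate)
  fix e :: real assume "e > 0"
  then obtain \<phi> where \<phi>: "\<phi> \<in> test_functions \<Omega>" "Lqd q \<phi> u < e" "Lqd q (grad \<phi>) G < e"
    using u by (auto simp: W0_pair_def)
  have m: "\<phi> \<in> borel_measurable borel" "grad \<phi> \<in> borel_measurable borel"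
    "u \<in> borel_measurable borel" "G \<in> borel_measurable borel"
    using test_functionsD(3,4)[OF \<phi>(1)] W0_pair_Lqb[OF u]
    by (auto intro: borel_measurable_continuous_onI LqbD)
  show "\<exists>\<phi>\<in>test_functions ((\<lambda>x. x - a) ` \<Omega>). Lqd q \<phi> (\<lambda>x. u (x + a)) < e \<and> Lqd q (grad \<phi>) (\<lambda>x. G (x + a)) < e"
    using \<phi> test_functions_translate[OF \<phi>(1), of a] m
    by (intro bexI[of _ "\<lambda>x. \<phi> (x + a)"]) (simp_all add: Lqd_translate)
qed

section \<open>Smooth approximation of the minimum\<close>

text \<open>Write \<open>c W - d V\<close> as \<open>c (W - V) + (c - d) V\<close>. The first part
  is small because \<open>c\<close> is bounded by 1, the second by dominated convergence with the
  bound \<open>2 * norm (V x)\<close>. The coefficients therefore need only converge almost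
  everywhere.\<close>

lemma Lqd_mult_tendsto:
  fixes W :: "nat \<Rightarrow> 'a::euclidean_space \<Rightarrow> 'b::euclidean_space"
  assumes W: "\<And>k. Lqb q (W k)" and V: "Lqb q V" and lim: "(\<lambda>k. Lqd q (W k) V) \<longlonglongrightarrow> 0" and q: "q > 0"
    and m: "\<And>k. c k \<in> borel_measurable borel" "d \<in> borel_measurable borel"
    and bd: "\<And>k x. \<bar>c k x\<bar> \<le> 1" "\<And>x. \<bar>d x\<bar> \<le> 1"
    and ae: "AE x in lborel. (\<lambda>k. c k x) \<longlonglongrightarrow> d x"
  shows "(\<lambda>k. Lqd q (\<lambda>x. c k x *\<^sub>R W k x) (\<lambda>x. d x *\<^sub>R V x)) \<longlonglongrightarrow> 0"
proof -
  note [measurable] = m LqbD[OF V] LqbD[OF W]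
  have q0: "q \<ge> 0" using q by simp
  have Lc: "Lqb q (\<lambda>x. e x *\<^sub>R U x)" if "e \<in> borel_measurable borel" "\<And>x. \<bar>e x\<bar> \<le> 1" "Lqb q U"
    for e :: "'a \<Rightarrow> real" and U :: "'a \<Rightarrow> 'b"
  proof (rule Lqb_bound[OF that(3) _ q0])
    note [measurable] = that(1) LqbD[OF that(3)]
    show "(\<lambda>x. e x *\<^sub>R U x) \<in> borel_measurable borel" by measurable
    show "norm (e x *\<^sub>R U x) \<le> norm (U x)" for x
      using that(2)[of x] by (simp add: mult_left_le_one_le)
  qed
  have 2: "(\<lambda>k. Lqd q (\<lambda>x. c k x *\<^sub>R V x) (\<lambda>x. d x *\<^sub>R V x)) \<longlonglongrightarrow> 0"
  proof (rule Lqd_dominated[OF _ _ V q, where C=2])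
    show "AE x in lborel. (\<lambda>k. c k x *\<^sub>R V x) \<longlonglongrightarrow> d x *\<^sub>R V x"
      using ae by eventually_elim (intro tendsto_intros)
    show "norm (c k x *\<^sub>R V x - d x *\<^sub>R V x) \<le> 2 * norm (V x)" for k x
    proof -
      have "norm (c k x *\<^sub>R V x - d x *\<^sub>R V x) = \<bar>c k x - d x\<bar> * norm (V x)"
        by (metis norm_scaleR scaleR_left_diff_distrib)
      also have "\<dots> \<le> 2 * norm (V x)"
        using bd(1)[of k x] bd(2)[of x] by (intro mult_right_mono) auto
      finally show ?thesis .
    qed
  qed measurable
  have le: "Lqd q (\<lambda>x. c k x *\<^sub>R W k x) (\<lambda>x. d x *\<^sub>R V x)
      \<le> 2 powr q * (Lqd q (W k) V + Lqd q (\<lambda>x. c k x *\<^sub>R V x) (\<lambda>x. d x *\<^sub>R V x))" for k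
  proof (rule Lqd_le_sum)
    show "norm (c k x *\<^sub>R W k x - d x *\<^sub>R V x) \<le> norm (W k x - V x) + norm (c k x *\<^sub>R V x - d x *\<^sub>R V x)" for x
    proof -
      have "c k x *\<^sub>R W k x - d x *\<^sub>R V x = c k x *\<^sub>R (W k x - V x) + (c k x *\<^sub>R V x - d x *\<^sub>R V x)"
        by (simp add: algebra_simps)
      then have "norm (c k x *\<^sub>R W k x - d x *\<^sub>R V x)
          \<le> norm (c k x *\<^sub>R (W k x - V x)) + norm (c k x *\<^sub>R V x - d x *\<^sub>R V x)"
        by (metis norm_triangle_ineq)
      moreover have "norm (c k x *\<^sub>R (W k x - V x)) \<le> norm (W k x - V x)"
        using bd(1)[of k x] by (simp add: mult_left_le_one_le)
      ultimately show ?thesis by linarith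
    qed
  qed (intro Lc m bd W V q0)+
  show ?thesis
  proof (rule Lqd_tendsto_zeroI[OF le])
    show "(\<lambda>k. 2 powr q * (Lqd q (W k) V + Lqd q (\<lambda>x. c k x *\<^sub>R V x) (\<lambda>x. d x *\<^sub>R V x))) \<longlonglongrightarrow> 0"
      by (rule tendsto_eq_intros refl lim 2)+ simp
  qed
qed

section \<open>Smoothed absolute value and minimum\<close>

definition sabs :: "real \<Rightarrow> real \<Rightarrow> real" where "sabs e t = sqrt (t\<^sup>2 + e)"
definition dsabs :: "real \<Rightarrow> real \<Rightarrow> real" where "dsabs e t = t / sqrt (t\<^sup>2 + e)"

lemma sabs_0: "sabs 0 t = \<bar>t\<bar>" by (simp add: sabs_def)
lemma dsabs_0: "dsabs 0 t = sgn t" by (simp add: dsabs_def sgn_if)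

text \<open>The triangle inequality in the plane for the vectors \<open>(s - t, 0)\<close> and
  \<open>(t, sqrt e)\<close>; hence the constant 1 for every \<open>e\<close>.\<close>

lemma sabs_lipschitz:
  assumes "e \<ge> 0"
  shows "\<bar>sabs e s - sabs e t\<bar> \<le> \<bar>s - t\<bar>"
proof -
  have *: "sabs e s \<le> \<bar>s - t\<bar> + sabs e t" for s t
    using real_sqrt_sum_squares_triangle_ineq[of "s - t" t 0 "sqrt e"] assms by (simp add: sabs_def)
  show ?thesis using *[of s t] *[of t s] by (simp add: abs_minus_commute abs_le_iff)
qed

lemma dsabs_bound: "e \<ge> 0 \<Longrightarrow> \<bar>dsabs e t\<bar> \<le> 1"
proof -
  assume e: "e \<ge> 0"
  have "\<bar>t\<bar> \<le> sqrt (t\<^sup>2 + e)" using e real_le_rsqrt[of "\<bar>t\<bar>" "t\<^sup>2 + e"] by simp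
  then show ?thesis unfolding dsabs_def by (auto simp: abs_divide divide_le_eq_1)
qed

lemma sabs_measurable [measurable]: "sabs e \<in> borel_measurable borel"
  unfolding sabs_def by measurable

lemma dsabs_measurable [measurable]: "dsabs e \<in> borel_measurable borel"
  unfolding dsabs_def by measurable

lemma sabs_pos: "e > 0 \<Longrightarrow> (t::real)\<^sup>2 + e > 0"
  by (simp add: add_nonneg_pos)

lemma sabs_derivative: "e > 0 \<Longrightarrow> (sabs e has_real_derivative dsabs e t) (at t)"
  unfolding sabs_def using sabs_pos[of e t]
  by (auto intro!: derivative_eq_intros simp: dsabs_def field_simps)

lemma continuous_dsabs: "e > 0 \<Longrightarrow> isCont (dsabs e) t"
  unfolding dsabs_def using sabs_pos[of e t] by (auto intro!: continuous_intros)

text \<open>For nonnegative \<open>a\<close> and \<open>b\<close> the minimum is half of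
  \<open>\<bar>a + b\<bar> - \<bar>a - b\<bar>\<close>. Unlike half of
  \<open>a + b - \<bar>a - b\<bar>\<close>, this expression keeps its zeros under smoothing: if one
  argument is 0, the two terms cancel, as \<open>sabs e\<close> is even.\<close>

definition smin :: "real \<Rightarrow> real \<Rightarrow> real \<Rightarrow> real" where
  "smin e a b = (1 / 2) * sabs e (a + b) + (- 1 / 2) * sabs e (a - b)"

text \<open>The chain rule for \<open>smin\<close>, with \<open>G\<close> and \<open>H\<close> the
  gradients of the arguments. It is arranged as a linear combination of two products so that the
  limit rules for linear combinations and for bounded coefficients apply directly.\<close>

definition dsmin :: "real \<Rightarrow> real \<Rightarrow> real \<Rightarrow> 'a::real_vector \<Rightarrow> 'a \<Rightarrow> 'a" where
  "dsmin e a b G H = (1 / 2) *\<^sub>R (dsabs e (a + b) *\<^sub>R (G + H)) + (- 1 / 2) *\<^sub>R (dsabs e (a - b) *\<^sub>R (G - H))"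

lemma smin_lipschitz:
  assumes "e \<ge> 0"
  shows "\<bar>smin e a b - smin e c d\<bar> \<le> \<bar>a - c\<bar> + \<bar>b - d\<bar>"
  using sabs_lipschitz[OF assms, of "a + b" "c + d"] sabs_lipschitz[OF assms, of "a - b" "c - d"]
  unfolding smin_def by argo

lemma smin_zero_left [simp]: "smin e 0 b = 0" and smin_zero_right [simp]: "smin e a 0 = 0"
  by (auto simp: smin_def sabs_def)

lemma smin_bound: "e \<ge> 0 \<Longrightarrow> \<bar>smin e a b\<bar> \<le> \<bar>a\<bar>"
  using smin_lipschitz[of e a b 0 b] by simp

lemma smin_min: "a \<ge> 0 \<Longrightarrow> b \<ge> 0 \<Longrightarrow> smin 0 a b = min a b"
  by (auto simp: smin_def sabs_0 min_def abs_if field_simps)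

lemma smin_abs: "smin 0 a a = \<bar>a\<bar>"
  by (simp add: smin_def sabs_0)

lemma test_functions_smin:
  assumes \<phi>: "\<phi> \<in> test_functions \<Omega>" and \<psi>: "\<psi> \<in> test_functions \<Omega>'" and e: "e > 0"
  shows "(\<lambda>x. smin e (\<phi> x) (\<psi> x)) \<in> test_functions (\<Omega> \<inter> \<Omega>')"
    and "grad (\<lambda>x. smin e (\<phi> x) (\<psi> x)) = (\<lambda>x. dsmin e (\<phi> x) (\<psi> x) (grad \<phi> x) (grad \<psi> x))"
proof -
  obtain K where K: "compact K" "K \<subseteq> \<Omega>" "\<And>x. x \<notin> K \<Longrightarrow> \<phi> x = 0"
    using \<phi> by (auto simp: test_functions_def)
  obtain L where L: "compact L" "L \<subseteq> \<Omega>'" "\<And>x. x \<notin> L \<Longrightarrow> \<psi> x = 0"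
    using \<psi> by (auto simp: test_functions_def)
  have eq: "sabs e t = (t\<^sup>2 + e) powr (1 / 2)" for t
    using sabs_pos[OF e, of t] by (simp add: sabs_def powr_half_sqrt)
  have "C_diff k (\<lambda>x. (1 / 2) * sabs e (\<phi> x + \<psi> x) + (- 1 / 2) * sabs e (\<phi> x + (-1) * \<psi> x))" for k
    unfolding eq using e
    by (intro C_diff_add C_diff_mult C_diff_const C_diff_powr test_functionsD(1)[OF \<phi>] test_functionsD(1)[OF \<psi>])
  then have "C_diff k (\<lambda>x. smin e (\<phi> x) (\<psi> x))" for k by (simp add: smin_def)
  moreover have "compact (K \<inter> L)" "K \<inter> L \<subseteq> \<Omega> \<inter> \<Omega>'" using K L by (auto intro: compact_Int)
  moreover have "x \<notin> K \<inter> L \<Longrightarrow> smin e (\<phi> x) (\<psi> x) = 0" for x using K(3) L(3) by auto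
  ultimately show "(\<lambda>x. smin e (\<phi> x) (\<psi> x)) \<in> test_functions (\<Omega> \<inter> \<Omega>')"
    unfolding test_functions_def by blast
  show "grad (\<lambda>x. smin e (\<phi> x) (\<psi> x)) = (\<lambda>x. dsmin e (\<phi> x) (\<psi> x) (grad \<phi> x) (grad \<psi> x))"
  proof (rule ext, rule grad_eqI)
    fix x
    have d: "(sabs e has_derivative (*) (dsabs e t)) (at t)" for t
      using sabs_derivative[OF e] by (simp add: has_field_derivative_def)
    have g: "(\<phi> has_derivative (\<lambda>h. grad \<phi> x \<bullet> h)) (at x)" "(\<psi> has_derivative (\<lambda>h. grad \<psi> x \<bullet> h)) (at x)"
      by (intro has_derivative_grad test_functionsD(2)[OF \<phi>] test_functionsD(2)[OF \<psi>])+
    have "((\<lambda>x. smin e (\<phi> x) (\<psi> x)) has_derivative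
      (\<lambda>h. (1 / 2) * (dsabs e (\<phi> x + \<psi> x) * (grad \<phi> x \<bullet> h + grad \<psi> x \<bullet> h))
         + (- 1 / 2) * (dsabs e (\<phi> x - \<psi> x) * (grad \<phi> x \<bullet> h - grad \<psi> x \<bullet> h)))) (at x)"
      unfolding smin_def
      by (intro has_derivative_add has_derivative_mult_right
          has_derivative_compose[OF has_derivative_add[OF g] d] has_derivative_compose[OF has_derivative_diff[OF g] d])
    then show "((\<lambda>x. smin e (\<phi> x) (\<psi> x)) has_derivative
        (\<bullet>) (dsmin e (\<phi> x) (\<psi> x) (grad \<phi> x) (grad \<psi> x))) (at x)"
      by (rule has_derivative_eq_rhs) (simp add: dsmin_def inner_add_left inner_diff_left fun_eq_iff)
  qed
qed

lemma smin_measurable [measurable]: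
  assumes [measurable]: "u \<in> borel_measurable M" "v \<in> borel_measurable M"
  shows "(\<lambda>x. smin e (u x) (v x)) \<in> borel_measurable M"
  unfolding smin_def by measurable

lemma Lqb_smin:
  assumes u: "Lqb q u" and v: "Lqb q v" and "e \<ge> 0" "q \<ge> 0"
  shows "Lqb q (\<lambda>x. smin e (u x) (v x))"
proof (rule Lqb_bound[OF u])
  note [measurable] = LqbD[OF u] LqbD[OF v]
  show "(\<lambda>x. smin e (u x) (v x)) \<in> borel_measurable borel" by measurable
qed (use assms smin_bound in auto)

lemma Lqb_dsabs:
  fixes W :: "'a::euclidean_space \<Rightarrow> 'b::euclidean_space"
  assumes [measurable]: "w \<in> borel_measurable borel" and W: "Lqb q W" and "e \<ge> 0" "q \<ge> 0"
  shows "Lqb q (\<lambda>x. dsabs e (w x) *\<^sub>R W x)"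
proof (rule Lqb_bound[OF W _ assms(4)])
  note [measurable] = LqbD[OF W]
  show "(\<lambda>x. dsabs e (w x) *\<^sub>R W x) \<in> borel_measurable borel" by measurable
  show "norm (dsabs e (w x) *\<^sub>R W x) \<le> norm (W x)" for x
    using dsabs_bound[OF assms(3), of "w x"] by (simp add: mult_left_le_one_le)
qed

lemma Lqb_dsmin:
  fixes G H :: "'a::euclidean_space \<Rightarrow> 'b::euclidean_space"
  assumes u: "Lqb q u" and v: "Lqb q v" and G: "Lqb q G" and H: "Lqb q H" and e: "e \<ge> 0" "q \<ge> 0"
  shows "Lqb q (\<lambda>x. dsmin e (u x) (v x) (G x) (H x))"
  unfolding dsmin_def using LqbD[OF u] LqbD[OF v]
  by (intro Lqb_add Lqb_scaleR Lqb_dsabs Lqb_diff G H e) auto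

lemma tendsto_sabs: "(\<lambda>j. sabs (1 / real (Suc j)) t) \<longlonglongrightarrow> sabs 0 t"
  unfolding sabs_def
  by (intro tendsto_real_sqrt tendsto_add tendsto_const LIMSEQ_Suc[OF lim_1_over_n])

lemma tendsto_dsabs: "(\<lambda>j. dsabs (1 / real (Suc j)) t) \<longlonglongrightarrow> dsabs 0 t"
proof (cases "t = 0")
  case False
  then show ?thesis unfolding dsabs_def
    by (intro tendsto_divide tendsto_real_sqrt tendsto_add tendsto_const LIMSEQ_Suc[OF lim_1_over_n]) auto
qed (simp add: dsabs_def)

text \<open>The gradients of the approximants converge in the norm, but the coefficients
  \<open>dsabs e\<close> converge only where the functions converge pointwise. Hence the
  approximants are thinned to almost everywhere convergent ones, the second subsequence being
  extracted along the first.\<close>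

lemma W0_pair_smin_pos:
  assumes u: "W0_pair q \<Omega> u G" and v: "W0_pair q \<Omega>' v H" and q: "q > 0" and e: "e > 0"
  shows "W0_pair q (\<Omega> \<inter> \<Omega>') (\<lambda>x. smin e (u x) (v x)) (\<lambda>x. dsmin e (u x) (v x) (G x) (H x))"
proof -
  have q0: "q \<ge> 0" and e0: "e \<ge> 0" using q e by simp_all
  obtain \<phi>0 where \<phi>0: "\<And>k::nat. \<phi>0 k \<in> test_functions \<Omega>" "(\<lambda>k. Lqd q (\<phi>0 k) u) \<longlonglongrightarrow> 0" "(\<lambda>k. Lqd q (grad (\<phi>0 k)) G) \<longlonglongrightarrow> 0"
    using W0_pairE[OF u] by metis
  obtain \<psi>0 where \<psi>0: "\<And>k::nat. \<psi>0 k \<in> test_functions \<Omega>'" "(\<lambda>k. Lqd q (\<psi>0 k) v) \<longlonglongrightarrow> 0" "(\<lambda>k. Lqd q (grad (\<psi>0 k)) H) \<longlonglongrightarrow> 0"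
    using W0_pairE[OF v] by metis
  note Lu = W0_pair_Lqb[OF u] and Lv = W0_pair_Lqb[OF v]
  obtain r where r: "strict_mono r" "AE x in lborel. (\<lambda>k. \<phi>0 (r k) x) \<longlonglongrightarrow> u x"
    using Lqd_AE_subseq[OF Lqb_test(1)[OF \<phi>0(1) q] Lu(1) q \<phi>0(2)] by metis
  have s0: "(\<lambda>k. Lqd q (\<psi>0 (r k)) v) \<longlonglongrightarrow> 0"
    using LIMSEQ_subseq_LIMSEQ[OF \<psi>0(2) r(1)] by (simp add: o_def)
  obtain s where s: "strict_mono s" "AE x in lborel. (\<lambda>k. \<psi>0 (r (s k)) x) \<longlonglongrightarrow> v x"
    using Lqd_AE_subseq[OF Lqb_test(1)[OF \<psi>0(1) q] Lv(1) q s0] by metis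
  define \<phi> \<psi> where "\<phi> k = \<phi>0 (r (s k))" and "\<psi> k = \<psi>0 (r (s k))" for k
  have mono: "strict_mono (\<lambda>k. r (s k))" using r(1) s(1) by (simp add: strict_mono_def)
  have \<phi>: "\<And>k. \<phi> k \<in> test_functions \<Omega>" "(\<lambda>k. Lqd q (\<phi> k) u) \<longlonglongrightarrow> 0" "(\<lambda>k. Lqd q (grad (\<phi> k)) G) \<longlonglongrightarrow> 0"
    and \<psi>: "\<And>k. \<psi> k \<in> test_functions \<Omega>'" "(\<lambda>k. Lqd q (\<psi> k) v) \<longlonglongrightarrow> 0" "(\<lambda>k. Lqd q (grad (\<psi> k)) H) \<longlonglongrightarrow> 0"
    unfolding \<phi>_def \<psi>_def using \<phi>0 \<psi>0 LIMSEQ_subseq_LIMSEQ[OF _ mono, unfolded o_def] by auto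
  have \<psi>ae: "AE x in lborel. (\<lambda>k. \<psi> k x) \<longlonglongrightarrow> v x" using s(2) by (simp add: \<psi>_def)
  have \<phi>ae: "AE x in lborel. (\<lambda>k. \<phi> k x) \<longlonglongrightarrow> u x"
    using r(2) by eventually_elim
      (use LIMSEQ_subseq_LIMSEQ[OF _ s(1), unfolded o_def] in \<open>simp add: \<phi>_def\<close>)
  note t = Lqb_test[OF \<phi>(1) q] Lqb_test[OF \<psi>(1) q]
  note mt [measurable] = LqbD[OF t(1)] LqbD[OF t(3)] LqbD[OF Lu(1)] LqbD[OF Lv(1)]
  have ae1: "AE x in lborel. (\<lambda>k. dsabs e (\<phi> k x + \<psi> k x)) \<longlonglongrightarrow> dsabs e (u x + v x)"
    using \<phi>ae \<psi>ae by eventually_elim (intro isCont_tendsto_compose[OF continuous_dsabs[OF e]] tendsto_intros)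
  have ae2: "AE x in lborel. (\<lambda>k. dsabs e (\<phi> k x - \<psi> k x)) \<longlonglongrightarrow> dsabs e (u x - v x)"
    using \<phi>ae \<psi>ae by eventually_elim (intro isCont_tendsto_compose[OF continuous_dsabs[OF e]] tendsto_intros)
  have l1: "(\<lambda>k. Lqd q (\<lambda>x. grad (\<phi> k) x + grad (\<psi> k) x) (\<lambda>x. G x + H x)) \<longlonglongrightarrow> 0"
    using Lqd_lincomb_tendsto[OF t(2,4) Lu(2) Lv(2) q0 \<phi>(3) \<psi>(3), of 1 1] by simp
  have l2: "(\<lambda>k. Lqd q (\<lambda>x. grad (\<phi> k) x - grad (\<psi> k) x) (\<lambda>x. G x - H x)) \<longlonglongrightarrow> 0"
    using Lqd_lincomb_tendsto[OF t(2,4) Lu(2) Lv(2) q0 \<phi>(3) \<psi>(3), of 1 "-1"] by simp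
  have m1: "(\<lambda>k. Lqd q (\<lambda>x. dsabs e (\<phi> k x + \<psi> k x) *\<^sub>R (grad (\<phi> k) x + grad (\<psi> k) x))
      (\<lambda>x. dsabs e (u x + v x) *\<^sub>R (G x + H x))) \<longlonglongrightarrow> 0"
    by (rule Lqd_mult_tendsto[OF _ _ l1 q _ _ _ _ ae1]) (auto intro!: Lqb_add t Lu Lv q0 dsabs_bound e0)
  have m2: "(\<lambda>k. Lqd q (\<lambda>x. dsabs e (\<phi> k x - \<psi> k x) *\<^sub>R (grad (\<phi> k) x - grad (\<psi> k) x))
      (\<lambda>x. dsabs e (u x - v x) *\<^sub>R (G x - H x))) \<longlonglongrightarrow> 0"
    by (rule Lqd_mult_tendsto[OF _ _ l2 q _ _ _ _ ae2]) (auto intro!: Lqb_diff t Lu Lv q0 dsabs_bound e0)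
  show ?thesis
  proof (rule W0_pair_limI[OF _ _ _ q])
    show "W0_pair q (\<Omega> \<inter> \<Omega>') (\<lambda>x. smin e (\<phi> k x) (\<psi> k x))
        (\<lambda>x. dsmin e (\<phi> k x) (\<psi> k x) (grad (\<phi> k) x) (grad (\<psi> k) x))" for k
      using W0_pair_test[OF test_functions_smin(1)[OF \<phi>(1) \<psi>(1) e] q]
      by (simp add: test_functions_smin(2)[OF \<phi>(1) \<psi>(1) e])
    show "Lqb q (\<lambda>x. smin e (u x) (v x))" by (intro Lqb_smin Lu Lv e0 q0)
    show "Lqb q (\<lambda>x. dsmin e (u x) (v x) (G x) (H x))" by (intro Lqb_dsmin Lu Lv e0 q0)
    show "(\<lambda>k. Lqd q (\<lambda>x. smin e (\<phi> k x) (\<psi> k x)) (\<lambda>x. smin e (u x) (v x))) \<longlonglongrightarrow> 0"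
    proof (rule Lqd_tendsto_zeroI)
      show "Lqd q (\<lambda>x. smin e (\<phi> k x) (\<psi> k x)) (\<lambda>x. smin e (u x) (v x)) \<le> 2 powr q * (Lqd q (\<phi> k) u + Lqd q (\<psi> k) v)" for k
        by (rule Lqd_le_sum) (auto intro!: Lqb_smin t Lu Lv e0 q0 smin_lipschitz)
      show "(\<lambda>k. 2 powr q * (Lqd q (\<phi> k) u + Lqd q (\<psi> k) v)) \<longlonglongrightarrow> 0"
        by (rule tendsto_eq_intros refl \<phi> \<psi>)+ simp
    qed
    show "(\<lambda>k. Lqd q (\<lambda>x. dsmin e (\<phi> k x) (\<psi> k x) (grad (\<phi> k) x) (grad (\<psi> k) x))
        (\<lambda>x. dsmin e (u x) (v x) (G x) (H x))) \<longlonglongrightarrow> 0"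
      unfolding dsmin_def
      by (rule Lqd_lincomb_tendsto[OF _ _ _ _ q0 m1 m2])
        (auto intro!: Lqb_dsabs Lqb_add Lqb_diff t Lu Lv e0 q0)
  qed
qed

text \<open>The approximants \<open>smin e\<close> vanish wherever one of their arguments does, so the minimum of
  two nonnegative functions lies in the space over the intersection of the two domains. No null set
  needs to be discarded: on \<open>{u = v}\<close> the gradient produced is the mean of the two
  gradients, which is as good as the true one for convex integrands.\<close>

lemma W0_pair_smin:
  assumes u: "W0_pair q \<Omega> u G" and v: "W0_pair q \<Omega>' v H" and q: "q > 0"
  shows "W0_pair q (\<Omega> \<inter> \<Omega>') (\<lambda>x. smin 0 (u x) (v x)) (\<lambda>x. dsmin 0 (u x) (v x) (G x) (H x))"
proof -
  have q0: "q \<ge> 0" using q by simp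
  note Lu = W0_pair_Lqb[OF u] and Lv = W0_pair_Lqb[OF v]
  note mt [measurable] = LqbD[OF Lu(1)] LqbD[OF Lv(1)]
  have LG: "(\<lambda>k::nat. Lqd q W W) \<longlonglongrightarrow> 0" for W :: "'a \<Rightarrow> 'a" by (simp add: Lqd_def)
  have m1: "(\<lambda>k. Lqd q (\<lambda>x. dsabs (1 / real (Suc k)) (u x + v x) *\<^sub>R (G x + H x))
      (\<lambda>x. dsabs 0 (u x + v x) *\<^sub>R (G x + H x))) \<longlonglongrightarrow> 0"
    by (rule Lqd_mult_tendsto[OF _ _ LG q]) (auto intro!: Lqb_add Lu Lv q0 dsabs_bound tendsto_dsabs simp del: of_nat_Suc)
  have m2: "(\<lambda>k. Lqd q (\<lambda>x. dsabs (1 / real (Suc k)) (u x - v x) *\<^sub>R (G x - H x))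
      (\<lambda>x. dsabs 0 (u x - v x) *\<^sub>R (G x - H x))) \<longlonglongrightarrow> 0"
    by (rule Lqd_mult_tendsto[OF _ _ LG q]) (auto intro!: Lqb_diff Lu Lv q0 dsabs_bound tendsto_dsabs simp del: of_nat_Suc)
  show ?thesis
  proof (rule W0_pair_limI[OF _ _ _ q])
    show "W0_pair q (\<Omega> \<inter> \<Omega>') (\<lambda>x. smin (1 / real (Suc k)) (u x) (v x))
        (\<lambda>x. dsmin (1 / real (Suc k)) (u x) (v x) (G x) (H x))" for k
      by (rule W0_pair_smin_pos[OF u v q]) simp
    show "Lqb q (\<lambda>x. smin 0 (u x) (v x))" by (intro Lqb_smin Lu Lv q0) simp
    show "Lqb q (\<lambda>x. dsmin 0 (u x) (v x) (G x) (H x))" by (intro Lqb_dsmin Lu Lv q0) simp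
    show "(\<lambda>k. Lqd q (\<lambda>x. smin (1 / real (Suc k)) (u x) (v x)) (\<lambda>x. smin 0 (u x) (v x))) \<longlonglongrightarrow> 0"
    proof (rule Lqd_dominated[OF _ _ Lu(1) q, where C=2])
      show "AE x in lborel. (\<lambda>k. smin (1 / real (Suc k)) (u x) (v x)) \<longlonglongrightarrow> smin 0 (u x) (v x)"
        unfolding smin_def by (intro AE_I2 tendsto_intros tendsto_sabs)
      show "norm (smin (1 / real (Suc k)) (u x) (v x) - smin 0 (u x) (v x)) \<le> 2 * norm (u x)" for k x
        using smin_bound[of "1 / real (Suc k)" "u x" "v x"] smin_bound[of 0 "u x" "v x"]
        by (simp del: of_nat_Suc)
    qed measurable
    show "(\<lambda>k. Lqd q (\<lambda>x. dsmin (1 / real (Suc k)) (u x) (v x) (G x) (H x))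
        (\<lambda>x. dsmin 0 (u x) (v x) (G x) (H x))) \<longlonglongrightarrow> 0"
      unfolding dsmin_def
      by (rule Lqd_lincomb_tendsto[OF _ _ _ _ q0 m1 m2])
        (auto intro!: Lqb_dsabs Lqb_add Lqb_diff Lu Lv q0)
  qed
qed

section \<open>Weak gradients and their uniqueness\<close>

lemma test_functions_lipschitz:
  assumes \<phi>: "\<phi> \<in> test_functions \<Omega>" and B: "\<And>x. norm (grad \<phi> x) \<le> B"
  shows "\<bar>\<phi> x - \<phi> y\<bar> \<le> B * norm (x - y)"
proof -
  have "norm (\<phi> x - \<phi> y) \<le> B * norm (x - y)"
  proof (rule differentiable_bound[of UNIV \<phi> "\<lambda>x h. grad \<phi> x \<bullet> h"])
    show "onorm ((\<bullet>) (grad \<phi> x)) \<le> B" for x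
    proof (rule onorm_bound)
      show "norm (grad \<phi> x \<bullet> h) \<le> B * norm h" for h
        using order_trans[OF Cauchy_Schwarz_ineq2 mult_right_mono[OF B norm_ge_zero]] by simp
    qed (use order_trans[OF norm_ge_zero B] in simp)
    show "(\<phi> has_derivative (\<bullet>) (grad \<phi> x)) (at x within UNIV)" for x
      using has_derivative_grad[OF test_functionsD(2)[OF \<phi>]] by simp
  qed auto
  then show ?thesis by simp
qed

text \<open>By translation invariance every difference quotient in direction \<open>v\<close> has
  integral 0; dominated convergence passes to the derivative.\<close>

lemma integral_grad_test:
  fixes \<phi> :: "'a::euclidean_space \<Rightarrow> real"
  assumes \<phi>: "\<phi> \<in> test_functions \<Omega>"
  shows "(LBINT x. grad \<phi> x \<bullet> v) = 0"
proof -
  obtain K where K: "compact K" "\<And>x. x \<notin> K \<Longrightarrow> \<phi> x = 0" "\<And>x. x \<notin> K \<Longrightarrow> grad \<phi> x = 0"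
    using test_functions_support[OF \<phi>] by metis
  obtain B where B: "\<And>x. norm (grad \<phi> x) \<le> B" using test_functions_bounded[OF \<phi>] by metis
  obtain R where R: "\<And>x. x \<in> K \<Longrightarrow> norm x \<le> R"
    using compact_imp_bounded[OF K(1)] unfolding bounded_iff by blast
  have m [measurable]: "\<phi> \<in> borel_measurable borel" "grad \<phi> \<in> borel_measurable borel"
    using test_functionsD(3,4)[OF \<phi>] by (auto intro: borel_measurable_continuous_onI)
  have int\<phi>: "integrable lborel \<phi>"
    by (rule continuous_compact_support_integrable[OF test_functionsD(3)[OF \<phi>] K(1,2)])
  define s where "s n x = real (Suc n) * (\<phi> (x + (1 / real (Suc n)) *\<^sub>R v) - \<phi> x)" for n x
  have "(LBINT x. s n x) = 0" for n
    unfolding s_def using lborel_integrable_translate[OF int\<phi>] int\<phi>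
    by (simp add: lborel_integral_translate[OF m(1)] del: of_nat_Suc)
  moreover have "(\<lambda>n. LBINT x. s n x) \<longlonglongrightarrow> (LBINT x. grad \<phi> x \<bullet> v)"
  \<comment> \<open>The increments have length at most \<open>norm v\<close>, so all quotients
    vanish outside the enlarged ball; inside, the Lipschitz bound controls them.\<close>
  proof (rule integral_dominated_convergence[where w="\<lambda>x. (B * norm v) * indicator (cball 0 (R + norm v)) x"])
    show "integrable lborel (\<lambda>x::'a. (B * norm v) * indicator (cball 0 (R + norm v)) x)"
      using emeasure_lborel_cball_finite by (intro integrable_mult_right integrable_real_indicator) auto
    show "AE x in lborel. (\<lambda>i. s i x) \<longlonglongrightarrow> grad \<phi> x \<bullet> v"
    proof (rule AE_I2)
      fix x
      have D: "((\<lambda>t. \<phi> (x + t *\<^sub>R v)) has_derivative (\<lambda>h. grad \<phi> x \<bullet> (h *\<^sub>R v))) (at 0)"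
      proof -
        have "((\<lambda>t. x + t *\<^sub>R v) has_derivative (\<lambda>h. h *\<^sub>R v)) (at 0)"
          by (auto intro!: derivative_eq_intros)
        then show ?thesis
          by (rule has_derivative_compose) (simp add: has_derivative_grad[OF test_functionsD(2)[OF \<phi>]])
      qed
      then have "((\<lambda>t. \<phi> (x + t *\<^sub>R v)) has_real_derivative (grad \<phi> x \<bullet> v)) (at 0)"
        unfolding has_field_derivative_def by (rule has_derivative_eq_rhs) (simp add: fun_eq_iff)
      then have "((\<lambda>h. (\<phi> (x + h *\<^sub>R v) - \<phi> x) / h) \<longlongrightarrow> grad \<phi> x \<bullet> v) (at 0)"
        by (simp add: DERIV_def)
      moreover have "filterlim (\<lambda>n. 1 / real (Suc n)) (at 0) sequentially"
        unfolding filterlim_at using LIMSEQ_Suc[OF lim_1_over_n] by auto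
      ultimately have "(\<lambda>n. (\<phi> (x + (1 / real (Suc n)) *\<^sub>R v) - \<phi> x) / (1 / real (Suc n))) \<longlonglongrightarrow> grad \<phi> x \<bullet> v"
        by (rule filterlim_compose)
      then show "(\<lambda>i. s i x) \<longlonglongrightarrow> grad \<phi> x \<bullet> v" by (simp add: s_def mult.commute del: of_nat_Suc)
    qed
    show "AE x in lborel. norm (s i x) \<le> (B * norm v) * indicator (cball 0 (R + norm v)) x" for i
    proof (rule AE_I2)
      fix x :: 'a
      have n1: "norm ((1 / real (Suc i)) *\<^sub>R v) \<le> norm v"
        by (simp add: divide_le_eq distrib_left)
      show "norm (s i x) \<le> (B * norm v) * indicator (cball 0 (R + norm v)) x"
      proof (cases "x \<in> cball 0 (R + norm v)")
        case True
        have "\<bar>\<phi> (x + (1 / real (Suc i)) *\<^sub>R v) - \<phi> x\<bar> \<le> B * norm ((1 / real (Suc i)) *\<^sub>R v)"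
          using test_functions_lipschitz[OF \<phi> B, of "x + (1 / real (Suc i)) *\<^sub>R v" x] by simp
        then have "real (Suc i) * \<bar>\<phi> (x + (1 / real (Suc i)) *\<^sub>R v) - \<phi> x\<bar>
            \<le> real (Suc i) * (B * norm ((1 / real (Suc i)) *\<^sub>R v))"
          by (rule mult_left_mono) simp
        then show ?thesis using True by (simp add: s_def abs_mult del: of_nat_Suc)
      next
        case False
        then have f: "norm x > R + norm v" by simp
        have "x \<notin> K" using R[of x] f norm_ge_zero[of v] by linarith
        moreover have "x + (1 / real (Suc i)) *\<^sub>R v \<notin> K"
        proof
          assume "x + (1 / real (Suc i)) *\<^sub>R v \<in> K"
          then have "norm (x + (1 / real (Suc i)) *\<^sub>R v) \<le> R" by (rule R)
          moreover have "norm x \<le> norm (x + (1 / real (Suc i)) *\<^sub>R v) + norm ((1 / real (Suc i)) *\<^sub>R v)"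
            using norm_triangle_ineq4[of "x + (1 / real (Suc i)) *\<^sub>R v" "(1 / real (Suc i)) *\<^sub>R v"]
            by (simp only: add_diff_cancel_right')
          ultimately show False using n1 f by linarith
        qed
        ultimately show ?thesis using False K(2) by (simp add: s_def)
      qed
    qed
    show "s i \<in> borel_measurable lborel" for i
      unfolding s_def by measurable
  qed measurable
  ultimately show ?thesis by (simp add: LIMSEQ_const_iff)
qed

text \<open>Stands in for Hoelder's inequality and covers \<open>q = 1\<close> as well: a bounded
  function of compact support is an admissible weight for limits in the
  \<open>q\<close>-norm.\<close>

lemma Lqd_tendsto_integral_inner:
  fixes w :: "nat \<Rightarrow> 'a::euclidean_space \<Rightarrow> 'b::euclidean_space"
  assumes w: "\<And>k. Lqb q (w k)" and v: "Lqb q v" and lim: "(\<lambda>k. Lqd q (w k) v) \<longlonglongrightarrow> 0" and q: "q \<ge> 1"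
    and h: "h \<in> borel_measurable borel" and K: "compact K"
    and bd: "\<And>x. norm (h x) \<le> B" and out: "\<And>x. x \<notin> K \<Longrightarrow> h x = 0"
  shows "(\<lambda>k. LBINT x. w k x \<bullet> h x) \<longlonglongrightarrow> (LBINT x. v x \<bullet> h x)"
    and "integrable lborel (\<lambda>x. v x \<bullet> h x)"
proof -
  have q0: "q \<ge> 0" using q by simp
  have B0: "B \<ge> 0" using bd[of 0] norm_ge_zero[of "h 0"] by linarith
  \<comment> \<open>If \<open>t > e\<close>, then \<open>t = t powr (1 - q) * t powr q\<close>, and
    the first factor is at most \<open>e powr (1 - q)\<close>. The term \<open>e\<close> is
    integrated over \<open>K\<close> only and made small first; the other one tends to 0 for fixed
    \<open>e\<close>.\<close>
  have bound: "t \<le> e + e powr (1 - q) * t powr q" if "e > 0" "t \<ge> 0" for e t :: real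
  proof (cases "t \<le> e")
    case False
    then have "t = t powr (1 - q) * t powr q" using that by (simp flip: powr_add)
    also have "\<dots> \<le> e powr (1 - q) * t powr q"
      using False that q by (intro mult_right_mono powr_mono2') auto
    finally show ?thesis using that by linarith
  qed (simp add: add_increasing2)
  have Ki: "integrable lborel (indicator K :: 'a \<Rightarrow> real)"
    using K emeasure_compact_finite by (intro integrable_real_indicator) (auto simp: compact_imp_closed)
  have le: "\<bar>u x \<bullet> h x\<bar> \<le> B * (e * indicator K x + e powr (1 - q) * norm (u x) powr q)"
    if "e > 0" for u :: "'a \<Rightarrow> 'b" and e x
  proof (cases "x \<in> K")
    case True
    have "\<bar>u x \<bullet> h x\<bar> \<le> norm (u x) * norm (h x)" by (rule Cauchy_Schwarz_ineq2)
    also have "\<dots> \<le> norm (u x) * B" by (intro mult_left_mono bd) auto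
    also have "\<dots> \<le> (e + e powr (1 - q) * norm (u x) powr q) * B"
      using bound[OF that norm_ge_zero] B0 by (intro mult_right_mono)
    finally show ?thesis using True by (simp add: mult.commute)
  qed (use out B0 in auto)
  have int: "integrable lborel (\<lambda>x. B * (e * indicator K x + e powr (1 - q) * norm (u x) powr q))"
    if "Lqb q u" for u :: "'a \<Rightarrow> 'b" and e
    using Lqb_integrable[OF that] Ki by (intro integrable_mult_right integrable_add) auto
  have int_h: "integrable lborel (\<lambda>x. u x \<bullet> h x)" if "Lqb q u" for u :: "'a \<Rightarrow> 'b"
  proof (rule Bochner_Integration.integrable_bound[OF int[OF that, of 1]])
    show "AE x in lborel. norm (u x \<bullet> h x) \<le> norm (B * (1 * indicator K x + 1 powr (1 - q) * norm (u x) powr q))"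
      using le[of 1 u] by (auto intro!: AE_I2 order_trans[OF _ abs_ge_self])
  qed (use LqbD[OF that] h in measurable)
  show "integrable lborel (\<lambda>x. v x \<bullet> h x)" by (rule int_h[OF v])
  have est: "\<bar>(LBINT x. w k x \<bullet> h x) - (LBINT x. v x \<bullet> h x)\<bar>
      \<le> B * (e * measure lborel K + e powr (1 - q) * Lqd q (w k) v)" if "e > 0" for k e
  proof -
    have d: "Lqb q (\<lambda>x. w k x - v x)" by (intro Lqb_diff w v q0)
    have "(LBINT x. w k x \<bullet> h x) - (LBINT x. v x \<bullet> h x) = (LBINT x. (w k x - v x) \<bullet> h x)"
      using int_h[OF w] int_h[OF v] by (simp add: inner_diff_left)
    then have "\<bar>(LBINT x. w k x \<bullet> h x) - (LBINT x. v x \<bullet> h x)\<bar> \<le> (LBINT x. \<bar>(w k x - v x) \<bullet> h x\<bar>)"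
      using integral_norm_bound[of lborel "\<lambda>x. (w k x - v x) \<bullet> h x"] by simp
    also have "\<dots> \<le> (LBINT x. B * (e * indicator K x + e powr (1 - q) * norm (w k x - v x) powr q))"
      using le[OF that, of "\<lambda>x. w k x - v x"] int_h[OF d] int[OF d] by (intro integral_mono) auto
    also have "\<dots> = B * (e * measure lborel K + e powr (1 - q) * Lqd q (w k) v)"
      using Lqb_integrable[OF d] Ki by (simp add: Lqd_def)
    finally show ?thesis .
  qed
  show "(\<lambda>k. LBINT x. w k x \<bullet> h x) \<longlonglongrightarrow> (LBINT x. v x \<bullet> h x)"
  proof (rule LIMSEQ_I)
    fix r :: real assume r: "r > 0"
    \<comment> \<open>The summand 1 keeps \<open>M\<close> positive when \<open>B\<close> or the
      measure of \<open>K\<close> is 0.\<close>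
    define M where "M = B * measure lborel K + 1"
    have M: "M > 0" using B0 by (simp add: M_def add_nonneg_pos)
    define e where "e = r / (2 * M)"
    have e: "e > 0" using r M by (simp add: e_def)
    have "(\<lambda>k. B * (e powr (1 - q) * Lqd q (w k) v)) \<longlonglongrightarrow> 0"
      by (rule tendsto_eq_intros refl lim)+ simp
    then have "\<forall>\<^sub>F k in sequentially. B * (e powr (1 - q) * Lqd q (w k) v) < r / 2"
      using r by (intro order_tendstoD(2)) auto
    then obtain N where N: "\<And>k. k \<ge> N \<Longrightarrow> B * (e powr (1 - q) * Lqd q (w k) v) < r / 2"
      unfolding eventually_sequentially by blast
    have "norm ((LBINT x. w k x \<bullet> h x) - (LBINT x. v x \<bullet> h x)) < r" if "k \<ge> N" for k
    proof -
      have "B * (e * measure lborel K) \<le> e * M" using e by (simp add: M_def algebra_simps)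
      also have "\<dots> = r / 2" using M by (simp add: e_def)
      finally show ?thesis using est[OF e, of k] N[OF that] by (simp add: algebra_simps)
    qed
    then show "\<exists>no. \<forall>k\<ge>no. norm ((LBINT x. w k x \<bullet> h x) - (LBINT x. v x \<bullet> h x)) < r" by blast
  qed
qed

text \<open>For approximants \<open>\<phi>\<close> of \<open>u\<close> the product of
  \<open>\<phi>\<close> and \<open>\<psi>\<close> is a test function, whose derivative integrates to
  0 over the whole space. The domain of \<open>\<psi>\<close> is arbitrary, so \<open>G\<close> is
  the gradient of \<open>u\<close> across the boundary of \<open>\<Omega>\<close> too.\<close>

lemma W0_pair_integration_by_parts:
  assumes u: "W0_pair q \<Omega> u G" and q: "q \<ge> 1" and \<psi>: "\<psi> \<in> test_functions \<Omega>'"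
  shows "(LBINT x. u x * (grad \<psi> x \<bullet> v)) = - (LBINT x. (G x \<bullet> v) * \<psi> x)"
proof -
  have q0: "q > 0" using q by simp
  obtain \<phi> where \<phi>: "\<And>k::nat. \<phi> k \<in> test_functions \<Omega>" "(\<lambda>k. Lqd q (\<phi> k) u) \<longlonglongrightarrow> 0" "(\<lambda>k. Lqd q (grad (\<phi> k)) G) \<longlonglongrightarrow> 0"
    using W0_pairE[OF u] by metis
  obtain K where K: "compact K" "\<And>x. x \<notin> K \<Longrightarrow> \<psi> x = 0" "\<And>x. x \<notin> K \<Longrightarrow> grad \<psi> x = 0"
    using test_functions_support[OF \<psi>] by metis
  obtain B where B: "\<And>x. \<bar>\<psi> x\<bar> \<le> B" "\<And>x. norm (grad \<psi> x) \<le> B"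
    using test_functions_bounded[OF \<psi>] by metis
  have m [measurable]: "\<psi> \<in> borel_measurable borel" "grad \<psi> \<in> borel_measurable borel"
    using test_functionsD(3,4)[OF \<psi>] by (auto intro: borel_measurable_continuous_onI)
  have B1: "norm (grad \<psi> x \<bullet> v) \<le> B * norm v" for x
    using order_trans[OF Cauchy_Schwarz_ineq2 mult_right_mono[OF B(2)]] by simp
  have B2: "norm (\<psi> x *\<^sub>R v) \<le> B * norm v" for x
    using mult_right_mono[OF B(1)] by simp
  have h1: "(\<lambda>x. grad \<psi> x \<bullet> v) \<in> borel_measurable borel" by measurable
  have h2: "(\<lambda>x. \<psi> x *\<^sub>R v) \<in> borel_measurable borel" by measurable
  have z1: "grad \<psi> x \<bullet> v = 0" if "x \<notin> K" for x using K(3)[OF that] by simp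
  have z2: "\<psi> x *\<^sub>R v = 0" if "x \<notin> K" for x using K(2)[OF that] by simp
  note t = Lqb_test[OF \<phi>(1) q0]
  note l1 = Lqd_tendsto_integral_inner[OF t(1) W0_pair_Lqb(1)[OF u] \<phi>(2) q h1 K(1) B1 z1]
  note l2 = Lqd_tendsto_integral_inner[OF t(2) W0_pair_Lqb(2)[OF u] \<phi>(3) q h2 K(1) B2 z2]
  have "(LBINT x. \<phi> k x \<bullet> (grad \<psi> x \<bullet> v)) = - (LBINT x. grad (\<phi> k) x \<bullet> (\<psi> x *\<^sub>R v))" for k
  proof -
    have z0: "(\<lambda>i::nat. Lqd q w w) \<longlonglongrightarrow> 0" for w :: "'a \<Rightarrow> 'b::euclidean_space" by (simp add: Lqd_def)
    have i1: "integrable lborel (\<lambda>x. \<phi> k x \<bullet> (grad \<psi> x \<bullet> v))"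
      by (rule Lqd_tendsto_integral_inner(2)[OF t(1) t(1) z0 q h1 K(1) B1 z1])
    have i2: "integrable lborel (\<lambda>x. grad (\<phi> k) x \<bullet> (\<psi> x *\<^sub>R v))"
      by (rule Lqd_tendsto_integral_inner(2)[OF t(2) t(2) z0 q h2 K(1) B2 z2])
    have "0 = (LBINT x. grad (\<lambda>x. \<phi> k x * \<psi> x) x \<bullet> v)"
      by (rule integral_grad_test[symmetric, OF test_functions_mult(1)[OF \<phi>(1) \<psi>]])
    also have "\<dots> = (LBINT x. grad (\<phi> k) x \<bullet> (\<psi> x *\<^sub>R v) + \<phi> k x \<bullet> (grad \<psi> x \<bullet> v))"
      by (simp add: test_functions_mult(2)[OF \<phi>(1) \<psi>] inner_add_left)
    also have "\<dots> = (LBINT x. grad (\<phi> k) x \<bullet> (\<psi> x *\<^sub>R v)) + (LBINT x. \<phi> k x \<bullet> (grad \<psi> x \<bullet> v))"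
      by (rule Bochner_Integration.integral_add[OF i2 i1])
    finally show ?thesis by linarith
  qed
  then have "(\<lambda>k. - (LBINT x. grad (\<phi> k) x \<bullet> (\<psi> x *\<^sub>R v))) \<longlonglongrightarrow> (LBINT x. u x \<bullet> (grad \<psi> x \<bullet> v))"
    using l1(1) by simp
  from LIMSEQ_unique[OF this tendsto_minus[OF l2(1)]] show ?thesis
    by (simp add: mult.commute)
qed

section \<open>The fundamental lemma of the calculus of variations\<close>

lemma AE_zero_if_box_integrals_zero:
  fixes h :: "'a::euclidean_space \<Rightarrow> real"
  assumes h: "integrable lborel h" and z: "\<And>a b. (LBINT x. indicator (box a b) x * h x) = 0"
  shows "AE x in lborel. h x = 0"
proof (rule density_unique_real[OF h integrable_zero])
  let ?I = "\<lambda>A. LBINT x. indicator A x * h x"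
  have [measurable]: "h \<in> borel_measurable borel" using h by simp
  have ih: "integrable lborel (\<lambda>x. indicator A x * h x)" if "A \<in> sets borel" for A
    using integrable_mult_indicator[OF _ h, of A] that by simp
  let ?box = "\<lambda>n::nat. box (- (real n *\<^sub>R One)) (real n *\<^sub>R One) :: 'a set"
  have "(\<lambda>n. ?I (?box n)) \<longlonglongrightarrow> (LBINT x. h x)"
  proof (rule integral_dominated_convergence[where w="\<lambda>x. norm (h x)"])
    show "AE x in lborel. (\<lambda>n. indicator (?box n) x * h x) \<longlonglongrightarrow> h x"
    proof (rule AE_I2)
      fix x :: 'a
      obtain N where N: "x \<in> ?box N" using UN_box_eq_UNIV[where 'a='a] by blast
      have "x \<in> ?box n" if "n \<ge> N" for n
        using N that by (force simp: box_def)
      then have "\<forall>\<^sub>F n in sequentially. indicator (?box n) x * h x = h x"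
        unfolding eventually_sequentially by (intro exI[of _ N]) simp
      then show "(\<lambda>n. indicator (?box n) x * h x) \<longlonglongrightarrow> h x" by (rule tendsto_eventually)
    qed
  qed (use h in \<open>auto simp: indicator_def\<close>)
  \<comment> \<open>The complement step of the induction below subtracts from the total integral,
    which therefore has to vanish first.\<close>
  then have tot: "(LBINT x. h x) = 0" using z LIMSEQ_unique[OF _ tendsto_const] by simp
  fix A :: "'a set" assume "A \<in> sets lborel"
  then have A: "A \<in> sigma_sets UNIV (range (\<lambda>(a, b). box a b :: 'a set))"
    by (simp add: borel_eq_box)
  have "?I A = 0"
  \<comment> \<open>Open boxes generate the Borel sets and are stable under intersection, so
    Dynkin's argument extends the vanishing to every Borel set.\<close>
  proof (rule sigma_sets_induct_disjoint[OF _ _ A, where P="\<lambda>A. ?I A = 0"])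
    have "\<exists>p r. box a b \<inter> box c d = box p r" for a b c d :: 'a
      using box_Int_box by blast
    then show "Int_stable (range (\<lambda>(a, b). box a b :: 'a set))"
      unfolding Int_stable_def image_def by (simp add: split_beta) metis
  next
    fix X assume "X \<in> sigma_sets UNIV (range (\<lambda>(a, b). box a b :: 'a set))" and X: "?I X = 0"
    then have Xb: "X \<in> sets borel" by (simp add: borel_eq_box)
    have "?I (UNIV - X) = (LBINT x. h x - indicator X x * h x)"
      by (rule Bochner_Integration.integral_cong) (auto simp: indicator_def)
    also have "\<dots> = 0" using h ih[OF Xb] X tot by simp
    finally show "?I (UNIV - X) = 0" .
  next
    fix X :: "nat \<Rightarrow> 'a set"
    assume d: "disjoint_family X" and "range X \<subseteq> sigma_sets UNIV (range (\<lambda>(a, b). box a b))"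
      and X: "\<And>i. ?I (X i) = 0"
    then have Xb: "X i \<in> sets borel" for i by (auto simp: borel_eq_box)
    have "(LINT x:(\<Union>i. X i)|lborel. h x) = (\<Sum>i. (LINT x:(X i)|lborel. h x))"
    proof (rule lebesgue_integral_countable_add)
      show "set_integrable lborel (\<Union>i. X i) h"
        unfolding set_integrable_def using Xb by (intro integrable_mult_indicator h) auto
    qed (use Xb d in \<open>auto simp: disjoint_family_on_def\<close>)
    then show "?I (\<Union>i. X i) = 0" using X by (simp add: set_lebesgue_integral_def)
  qed (use z in auto)
  then show "(LINT x:A|lborel. h x) = (LINT x:A|lborel. 0)" by (simp add: set_lebesgue_integral_def)
qed


lemma integrable_lebesgue_on_iff:
  fixes g :: "'a::euclidean_space \<Rightarrow> 'b::{banach, second_countable_topology}"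
  assumes "S \<in> sets lebesgue"
  shows "integrable (lebesgue_on S) g \<longleftrightarrow> integrable lebesgue (\<lambda>x. indicator S x *\<^sub>R g x)"
  using assms by (intro integrable_restrict_space) auto

lemma integral_lebesgue_on_eq:
  fixes g :: "'a::euclidean_space \<Rightarrow> 'b::{banach, second_countable_topology}"
  assumes "S \<in> sets lebesgue"
  shows "integral\<^sup>L (lebesgue_on S) g = integral\<^sup>L lebesgue (\<lambda>x. indicator S x *\<^sub>R g x)"
  using assms by (intro integral_restrict_space) auto

lemma AE_lebesgue_on_iff:
  assumes "S \<in> sets lebesgue"
  shows "(AE x in lebesgue_on S. P x) \<longleftrightarrow> (AE x in lborel. x \<in> S \<longrightarrow> P x)"
  using assms by (subst AE_restrict_space_iff) (auto simp: AE_completion_iff)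

text \<open>On a closed box \<open>g\<close> is integrable and has a Borel representative
  \<open>h\<close>. The cutoffs of subboxes are test functions, so in the limit the integrals of
  \<open>h\<close> over all subboxes vanish; the boundary of the box is a null set.\<close>

lemma fundamental_lemma_box:
  fixes g :: "'a::euclidean_space \<Rightarrow> real"
  assumes sub: "cbox a c \<subseteq> \<Omega>" and \<Omega>: "open \<Omega>"
    and L: "integrable (lebesgue_on (cbox a c)) g"
    and z: "\<And>\<psi>. \<psi> \<in> test_functions \<Omega> \<Longrightarrow> (\<integral>x. g x * \<psi> x \<partial>lebesgue_on \<Omega>) = 0"
  shows "AE x in lborel. x \<in> cbox a c \<longrightarrow> g x = 0"
proof -
  have ig: "integrable lebesgue (\<lambda>x. indicator (cbox a c) x *\<^sub>R g x)"
    using L by (simp add: integrable_lebesgue_on_iff)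
  then obtain h where h [measurable]: "h \<in> borel_measurable lborel"
    and hg: "AE x in lborel. indicator (cbox a c) x *\<^sub>R g x = h x"
    using completion_ex_borel_measurable_real[OF borel_measurable_integrable[OF ig]] by auto
  have hg': "AE x in lebesgue. indicator (cbox a c) x *\<^sub>R g x = h x"
    using hg by (rule AE_completion)
  have mh: "h \<in> borel_measurable lebesgue" using h by (rule measurable_completion)
  have ih: "integrable lborel h"
    using ig integrable_cong_AE[OF borel_measurable_integrable[OF ig] mh hg'] integrable_completion[OF h] by blast
  have box0: "(LBINT x. indicator (box p r) x * h x) = 0" if pr: "box p r \<subseteq> box a c" "box p r \<noteq> {}" for p r
  proof -
    \<comment> \<open>A degenerate closed box can be nonempty although the open one is empty;
      nonemptiness is what lets the inclusion pass to closed boxes.\<close>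
    have "closure (box p r) \<subseteq> closure (box a c)" using pr(1) by (rule closure_mono)
    then have sub': "cbox p r \<subseteq> cbox a c" using pr by (metis closure_box subset_empty)
    have "(\<lambda>n. LBINT x. box_cutoff p r n x * h x) \<longlonglongrightarrow> (LBINT x. indicator (box p r) x * h x)"
    proof (rule integral_dominated_convergence[where w="\<lambda>x. norm (h x)"])
      show "AE x in lborel. (\<lambda>n. box_cutoff p r n x * h x) \<longlonglongrightarrow> indicator (box p r) x * h x"
        by (intro AE_I2 tendsto_intros box_cutoff_lim)
      show "AE x in lborel. norm (box_cutoff p r n x * h x) \<le> norm (h x)" for n
        using box_cutoff_bounds[of p r n] by (auto simp: abs_mult intro!: mult_left_le_one_le)
      show "(\<lambda>x. box_cutoff p r n x * h x) \<in> borel_measurable lborel" for n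
        using C_diff_continuous[OF C_diff_box_cutoff, of p r n] h
        by (intro borel_measurable_times) (auto intro: borel_measurable_continuous_onI)
    qed (use ih in auto)
    moreover have "(LBINT x. box_cutoff p r n x * h x) = 0" for n
    proof -
      have t: "box_cutoff p r n \<in> test_functions \<Omega>"
        using sub sub' by (intro box_cutoff_test) auto
      have out: "box_cutoff p r n x = 0" if "x \<notin> cbox a c" for x
        using test_functionsD(5)[OF box_cutoff_test[OF sub'] that] .
      have mc [measurable]: "box_cutoff p r n \<in> borel_measurable lborel"
        using test_functionsD(3)[OF t] by (auto intro: borel_measurable_continuous_onI)
      have "(LBINT x. box_cutoff p r n x * h x) = (\<integral>x. box_cutoff p r n x * h x \<partial>lebesgue)"
        by (intro integral_completion[symmetric]) measurable
      also have "\<dots> = (\<integral>x. box_cutoff p r n x * (indicator (cbox a c) x *\<^sub>R g x) \<partial>lebesgue)"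
      proof (rule integral_cong_AE)
        show "AE x in lebesgue. box_cutoff p r n x * h x = box_cutoff p r n x * (indicator (cbox a c) x *\<^sub>R g x)"
          using hg' by eventually_elim simp
      qed (use mh measurable_completion[OF mc] borel_measurable_integrable[OF ig] in \<open>auto intro: borel_measurable_times\<close>)
      also have "\<dots> = (\<integral>x. indicator \<Omega> x *\<^sub>R (g x * box_cutoff p r n x) \<partial>lebesgue)"
        by (rule Bochner_Integration.integral_cong) (use out sub in \<open>auto simp: indicator_def\<close>)
      also have "\<dots> = 0" using z[OF t] \<Omega> by (simp add: integral_lebesgue_on_eq)
      finally show ?thesis .
    qed
    ultimately show ?thesis using LIMSEQ_unique[OF _ tendsto_const] by simp
  qed
  have "AE x in lborel. indicator (box a c) x * h x = 0"
  proof (rule AE_zero_if_box_integrals_zero)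
    show "integrable lborel (\<lambda>x. indicator (box a c) x * h x)"
      using integrable_mult_indicator[OF _ ih, of "box a c"] by simp
    show "(LBINT x. indicator (box p r) x * (indicator (box a c) x * h x)) = 0" for p r
    proof -
      obtain p' r' where pr: "box p r \<inter> box a c = box p' r'" using box_Int_box by blast
      have "(LBINT x. indicator (box p r) x * (indicator (box a c) x * h x))
          = (LBINT x. indicator (box p' r') x * h x)"
        unfolding pr[symmetric] by (simp add: indicator_inter_arith mult.assoc)
      also have "\<dots> = 0"
      proof (cases "box p' r' = {}")
        case True
        show ?thesis unfolding True by simp
      next
        case False
        then show ?thesis using pr by (intro box0) auto
      qed
      finally show ?thesis .
    qed
  qed
  moreover have "AE x in lborel. x \<notin> cbox a c - box a c"
    using null_sets_cbox_Diff_box by (rule AE_not_in)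
  ultimately show ?thesis using hg by eventually_elim (auto simp: indicator_def)
qed

lemma fundamental_lemma:
  fixes g :: "'a::euclidean_space \<Rightarrow> real"
  assumes \<Omega>: "open \<Omega>"
    and L: "\<And>K. compact K \<Longrightarrow> K \<subseteq> \<Omega> \<Longrightarrow> integrable (lebesgue_on K) g"
    and z: "\<And>\<psi>. \<psi> \<in> test_functions \<Omega> \<Longrightarrow> (\<integral>x. g x * \<psi> x \<partial>lebesgue_on \<Omega>) = 0"
  shows "AE x in lborel. x \<in> \<Omega> \<longrightarrow> g x = 0"
proof -
  obtain D where D: "countable D" "D \<subseteq> Pow \<Omega>" "\<And>X. X \<in> D \<Longrightarrow> \<exists>a b. X = cbox a b" "\<Union>D = \<Omega>"
    using open_countable_Union_open_cbox[OF \<Omega>] by metis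
  have "AE x in lborel. \<forall>X\<in>D. x \<in> X \<longrightarrow> g x = 0"
  proof (subst AE_ball_countable[OF D(1)], rule ballI)
    fix X assume X: "X \<in> D"
    obtain a b where ab: "X = cbox a b" using D(3)[OF X] by blast
    show "AE x in lborel. x \<in> X \<longrightarrow> g x = 0"
      unfolding ab using D(2) X ab by (intro fundamental_lemma_box[OF _ \<Omega> L z]) auto
  qed
  then show ?thesis by eventually_elim (use D(4) in auto)
qed

section \<open>Uniqueness of weak gradients\<close>

lemma L1_loc_mult_integrable:
  fixes G :: "'a::euclidean_space \<Rightarrow> 'b::euclidean_space"
  assumes G: "G \<in> L1_loc \<Omega>" and \<Omega>: "open \<Omega>" and K: "compact K" "K \<subseteq> \<Omega>" "\<And>x. x \<notin> K \<Longrightarrow> c x = 0"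
    and c: "c \<in> borel_measurable borel" and B: "\<And>x. \<bar>c x\<bar> \<le> B"
  shows "integrable (lebesgue_on \<Omega>) (\<lambda>x. (G x \<bullet> v) * c x)"
proof -
  have KL: "K \<in> sets lebesgue" using K(1) by (simp add: compact_imp_closed borel_closed)
  have i: "integrable lebesgue (\<lambda>x. indicator K x *\<^sub>R G x)"
    using G K KL by (auto simp: L1_loc_def integrable_lebesgue_on_iff)
  have m: "c \<in> borel_measurable lebesgue" using c by (auto intro!: measurable_completion)
  have "integrable lebesgue (\<lambda>x. ((indicator K x *\<^sub>R G x) \<bullet> v) * c x)"
  proof (rule Bochner_Integration.integrable_bound)
    show "integrable lebesgue (\<lambda>x. norm ((indicator K x *\<^sub>R G x) \<bullet> v) * B)"
      by (intro integrable_mult_left integrable_norm integrable_inner_left i)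
    show "(\<lambda>x. ((indicator K x *\<^sub>R G x) \<bullet> v) * c x) \<in> borel_measurable lebesgue"
      using borel_measurable_integrable[OF i] m by (intro borel_measurable_times borel_measurable_inner) auto
    show "AE x in lebesgue. norm (((indicator K x *\<^sub>R G x) \<bullet> v) * c x) \<le> norm (norm ((indicator K x *\<^sub>R G x) \<bullet> v) * B)"
      unfolding norm_mult using B order_trans[OF B abs_ge_self] by (auto intro!: mult_left_mono)
  qed
  moreover have "(\<lambda>x. ((indicator K x *\<^sub>R G x) \<bullet> v) * c x) = (\<lambda>x. indicator \<Omega> x *\<^sub>R ((G x \<bullet> v) * c x))"
    using K by (auto simp: indicator_def fun_eq_iff)
  ultimately show ?thesis using \<Omega> by (simp add: integrable_lebesgue_on_iff)
qed

lemma L1_loc_mult_test_integrable: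
  fixes G :: "'a::euclidean_space \<Rightarrow> 'b::euclidean_space" and u :: "'a \<Rightarrow> real"
  assumes \<Omega>: "open \<Omega>" and \<psi>: "\<psi> \<in> test_functions \<Omega>"
  shows "G \<in> L1_loc \<Omega> \<Longrightarrow> integrable (lebesgue_on \<Omega>) (\<lambda>x. (G x \<bullet> v) * \<psi> x)"
    and "u \<in> L1_loc \<Omega> \<Longrightarrow> b \<in> Basis \<Longrightarrow> integrable (lebesgue_on \<Omega>) (\<lambda>x. u x * frechet_derivative \<psi> (at x) b)"
proof -
  obtain K where K: "compact K" "K \<subseteq> \<Omega>" "\<And>x. x \<notin> K \<Longrightarrow> \<psi> x = 0" "\<And>x. x \<notin> K \<Longrightarrow> grad \<psi> x = 0"
    using test_functions_support[OF \<psi>] by metis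
  obtain B where B: "\<And>x. \<bar>\<psi> x\<bar> \<le> B" "\<And>x. norm (grad \<psi> x) \<le> B" using test_functions_bounded[OF \<psi>] by metis
  have m [measurable]: "\<psi> \<in> borel_measurable borel" "grad \<psi> \<in> borel_measurable borel"
    using test_functionsD(3,4)[OF \<psi>] by (auto intro: borel_measurable_continuous_onI)
  show "integrable (lebesgue_on \<Omega>) (\<lambda>x. (G x \<bullet> v) * \<psi> x)" if "G \<in> L1_loc \<Omega>"
    by (rule L1_loc_mult_integrable[OF that \<Omega> K(1,2,3) m(1) B(1)])
  assume u: "u \<in> L1_loc \<Omega>" and b: "b \<in> Basis"
  have "integrable (lebesgue_on \<Omega>) (\<lambda>x. (u x \<bullet> 1) * (grad \<psi> x \<bullet> b))"
  proof (rule L1_loc_mult_integrable[OF u \<Omega> K(1,2)])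
    show "\<bar>grad \<psi> x \<bullet> b\<bar> \<le> B" for x using Basis_le_norm[OF b] B(2) by (rule order_trans)
  qed (simp_all add: K(4))
  then show "integrable (lebesgue_on \<Omega>) (\<lambda>x. u x * frechet_derivative \<psi> (at x) b)"
    by (simp add: grad_inner_Basis[OF b])
qed

text \<open>The fundamental lemma for each component of \<open>G - H\<close>. Agreement almost
  everywhere is allowed so that a function and its absolute value can be compared when the function
  is nonnegative only almost everywhere.\<close>

lemma has_weak_gradient_unique:
  assumes \<Omega>: "open \<Omega>" and G: "has_weak_gradient \<Omega> u G" and H: "has_weak_gradient \<Omega> v H"
    and uv: "AE x in lborel. x \<in> \<Omega> \<longrightarrow> u x = v x"
  shows "AE x in lborel. x \<in> \<Omega> \<longrightarrow> G x = H x"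
proof -
  have "AE x in lborel. \<forall>b\<in>Basis. x \<in> \<Omega> \<longrightarrow> (G x - H x) \<bullet> b = 0"
  proof (subst AE_ball_countable[OF countable_finite[OF finite_Basis]], rule ballI)
    fix b :: 'a assume b: "b \<in> Basis"
    show "AE x in lborel. x \<in> \<Omega> \<longrightarrow> (G x - H x) \<bullet> b = 0"
    proof (rule fundamental_lemma[OF \<Omega>])
      fix K assume "compact K" "K \<subseteq> \<Omega>"
      then show "integrable (lebesgue_on K) (\<lambda>x. (G x - H x) \<bullet> b)"
        using G H by (auto simp: has_weak_gradient_def L1_loc_def)
    next
      fix \<psi> assume \<psi>: "\<psi> \<in> test_functions \<Omega>"
      have i: "integrable (lebesgue_on \<Omega>) (\<lambda>x. (G x \<bullet> b) * \<psi> x)" "integrable (lebesgue_on \<Omega>) (\<lambda>x. (H x \<bullet> b) * \<psi> x)"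
        using G H by (auto intro!: L1_loc_mult_test_integrable(1) \<Omega> \<psi> simp: has_weak_gradient_def)
      have "(\<integral>x. u x * frechet_derivative \<psi> (at x) b \<partial>lebesgue_on \<Omega>)
          = (\<integral>x. v x * frechet_derivative \<psi> (at x) b \<partial>lebesgue_on \<Omega>)"
      proof (rule Bochner_Integration.integral_cong_AE)
        show "(\<lambda>x. u x * frechet_derivative \<psi> (at x) b) \<in> borel_measurable (lebesgue_on \<Omega>)"
          "(\<lambda>x. v x * frechet_derivative \<psi> (at x) b) \<in> borel_measurable (lebesgue_on \<Omega>)"
          using G H by (auto intro!: borel_measurable_integrable L1_loc_mult_test_integrable(2) \<Omega> \<psi> b
            simp: has_weak_gradient_def)
        show "AE x in lebesgue_on \<Omega>. u x * frechet_derivative \<psi> (at x) b = v x * frechet_derivative \<psi> (at x) b"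
          using uv \<Omega> by (subst AE_lebesgue_on_iff) (auto elim: eventually_mono)
      qed
      then have "(\<integral>x. (G x \<bullet> b) * \<psi> x \<partial>lebesgue_on \<Omega>) = (\<integral>x. (H x \<bullet> b) * \<psi> x \<partial>lebesgue_on \<Omega>)"
        using G H \<psi> b by (simp add: has_weak_gradient_def)
      then show "(\<integral>x. ((G x - H x) \<bullet> b) * \<psi> x \<partial>lebesgue_on \<Omega>) = 0"
        using i by (simp add: inner_diff_left left_diff_distrib)
    qed
  qed
  then show ?thesis by eventually_elim (metis euclidean_eq_iff inner_diff_left right_minus_eq)
qed

lemma Lqb_locally_integrable:
  assumes u: "Lqb q u" and q: "q \<ge> 1" and K: "compact K"
  shows "integrable lborel (\<lambda>x. indicator K x *\<^sub>R u x)"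
proof (rule Bochner_Integration.integrable_bound)
  have KB: "K \<in> sets borel" using K by (simp add: compact_imp_closed)
  show "integrable lborel (\<lambda>x. indicator K x + norm (u x) powr q)"
    using K emeasure_compact_finite Lqb_integrable[OF u]
    by (intro Bochner_Integration.integrable_add integrable_real_indicator) (auto simp: compact_imp_closed)
  show "(\<lambda>x. indicator K x *\<^sub>R u x) \<in> borel_measurable lborel"
    using LqbD[OF u] KB by measurable
  have "t \<le> 1 + t powr q" if "t \<ge> 0" for t :: real
  proof (cases "t \<le> 1")
    case False
    then have "t powr 1 \<le> t powr q" using q by (intro powr_mono) auto
    then show ?thesis using False by simp
  qed (simp add: add_increasing2)
  then show "AE x in lborel. norm (indicator K x *\<^sub>R u x) \<le> norm (indicator K x + norm (u x) powr q)"
    by (auto simp: indicator_def)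
qed

lemma W0_pair_has_weak_gradient:
  assumes W: "W0_pair q \<Omega>' u G" and q: "q \<ge> 1" and \<Omega>: "open \<Omega>"
  shows "has_weak_gradient \<Omega> u G"
  unfolding has_weak_gradient_def
proof (intro conjI ballI)
  have L1: "w \<in> L1_loc \<Omega>" if "Lqb q w" for w :: "'a \<Rightarrow> 'b::euclidean_space"
    unfolding L1_loc_def
  proof (intro CollectI allI impI)
    fix K :: "'a set" assume K: "compact K \<and> K \<subseteq> \<Omega>"
    then have KB: "K \<in> sets borel" by (simp add: compact_imp_closed)
    note i = Lqb_locally_integrable[OF that q, of K]
    have "integrable lebesgue (\<lambda>x. indicator K x *\<^sub>R w x)"
      using i K integrable_completion[OF borel_measurable_integrable[OF i]] by auto
    then show "integrable (lebesgue_on K) w"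
      using KB by (subst integrable_lebesgue_on_iff) auto
  qed
  show "u \<in> L1_loc \<Omega>" "G \<in> L1_loc \<Omega>" using W0_pair_Lqb[OF W] by (auto intro: L1)
  fix \<phi> b assume \<phi>: "\<phi> \<in> test_functions \<Omega>" and b: "b \<in> (Basis :: 'a set)"
  obtain K where K: "compact K" "K \<subseteq> \<Omega>" "\<And>x. x \<notin> K \<Longrightarrow> \<phi> x = 0" "\<And>x. x \<notin> K \<Longrightarrow> grad \<phi> x = 0"
    using test_functions_support[OF \<phi>] by metis
  have z: "\<phi> x = 0" "grad \<phi> x = 0" if "x \<notin> \<Omega>" for x using that K by auto
  have S: "\<Omega> \<in> sets lebesgue" using \<Omega> by simp
  have m [measurable]: "\<phi> \<in> borel_measurable borel" "grad \<phi> \<in> borel_measurable borel"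
    using test_functionsD(3,4)[OF \<phi>] by (auto intro: borel_measurable_continuous_onI)
  note m' [measurable] = W0_pair_Lqb[OF W, THEN LqbD]
  have "(\<integral>x. u x * frechet_derivative \<phi> (at x) b \<partial>lebesgue_on \<Omega>)
      = (\<integral>x. u x * (grad \<phi> x \<bullet> b) \<partial>lebesgue)"
    unfolding integral_lebesgue_on_eq[OF S] using z
    by (intro Bochner_Integration.integral_cong) (auto simp: grad_inner_Basis[OF b, symmetric] indicator_def)
  also have "\<dots> = (LBINT x. u x * (grad \<phi> x \<bullet> b))"
    by (intro integral_completion) measurable
  also have "\<dots> = - (LBINT x. (G x \<bullet> b) * \<phi> x)"
    by (rule W0_pair_integration_by_parts[OF W q \<phi>])
  also have "(LBINT x. (G x \<bullet> b) * \<phi> x) = (\<integral>x. (G x \<bullet> b) * \<phi> x \<partial>lebesgue)"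
    by (intro integral_completion[symmetric]) measurable
  also have "\<dots> = (\<integral>x. (G x \<bullet> b) * \<phi> x \<partial>lebesgue_on \<Omega>)"
    unfolding integral_lebesgue_on_eq[OF S] using z
    by (intro Bochner_Integration.integral_cong) (auto simp: indicator_def)
  finally show "(\<integral>x. u x * frechet_derivative \<phi> (at x) b \<partial>lebesgue_on \<Omega>)
      = - (\<integral>x. (G x \<bullet> b) * \<phi> x \<partial>lebesgue_on \<Omega>)" .
qed

lemma W0_pair_gradient_unique:
  assumes "W0_pair q \<Omega> u G" "W0_pair q \<Omega>' v H" "q \<ge> 1" "AE x in lborel. u x = v x"
  shows "AE x in lborel. G x = H x"
  using has_weak_gradient_unique[OF open_UNIV W0_pair_has_weak_gradient[OF assms(1,3) open_UNIV]
      W0_pair_has_weak_gradient[OF assms(2,3) open_UNIV]] assms(4) by simp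

text \<open>Since \<open>u\<close> agrees almost everywhere with \<open>smin 0 (u x) (u x)\<close>,
  the absolute value, the gradients agree as well; the one constructed for the latter is 0 wherever
  \<open>u\<close> is, because \<open>dsabs 0 0 = 0\<close>.\<close>

lemma W0_pair_gradient_zero:
  assumes u: "W0_pair q \<Omega> u G" and q: "q \<ge> 1" and nn: "AE x in lborel. u x \<ge> 0"
  shows "AE x in lborel. u x = 0 \<longrightarrow> G x = 0"
proof -
  have "AE x in lborel. G x = dsmin 0 (u x) (u x) (G x) (G x)"
    using nn q by (intro W0_pair_gradient_unique[OF u W0_pair_smin[OF u u]]) (auto simp: smin_abs)
  then show ?thesis by eventually_elim (auto simp: dsmin_def dsabs_0)
qed

section \<open>The Poincare inequality\<close>

text \<open>Young's inequality for \<open>x / m\<close> and 1. Integrating this tangent inequality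
  takes the place of Jensen's inequality below.\<close>

lemma powr_above_tangent:
  fixes x m :: real
  assumes "x \<ge> 0" "m > 0" "q > 1"
  shows "m powr q + q * m powr (q - 1) * (x - m) \<le> x powr q"
proof -
  define y where "y = x / m"
  have y: "y \<ge> 0" using assms by (simp add: y_def)
  define q' where "q' = q / (q - 1)"
  have "y * 1 \<le> y powr q / q + 1 powr q' / q'"
    using assms y by (intro Youngs_inequality) (auto simp: q'_def field_simps)
  then have "q * y \<le> y powr q + q / q'" using assms by (simp add: field_simps)
  also have "q / q' = q - 1" using assms by (simp add: q'_def)
  finally have *: "1 + q * (y - 1) \<le> y powr q" by (simp add: algebra_simps)
  have "m powr q + q * m powr (q - 1) * (x - m) = m powr q * (1 + q * (y - 1))"
    using assms by (simp add: y_def powr_diff field_simps)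
  also have "\<dots> \<le> m powr q * y powr q" using * by (intro mult_left_mono) auto
  also have "\<dots> = x powr q" using assms by (simp add: y_def powr_divide)
  finally show ?thesis .
qed

lemma continuous_grad_line:
  assumes \<phi>: "\<phi> \<in> test_functions \<Omega>"
  shows "continuous_on S (\<lambda>t. grad \<phi> (x + t *\<^sub>R b))"
    and "q > 0 \<Longrightarrow> continuous_on S (\<lambda>t. norm (grad \<phi> (x + t *\<^sub>R b)) powr q)"
proof -
  have "continuous_on S (\<lambda>t. x + t *\<^sub>R b)" by (intro continuous_intros)
  then show 1: "continuous_on S (\<lambda>t. grad \<phi> (x + t *\<^sub>R b))"
    by (rule continuous_on_compose2[OF test_functionsD(4)[OF \<phi>]]) simp
  assume "q > 0"
  then show "continuous_on S (\<lambda>t. norm (grad \<phi> (x + t *\<^sub>R b)) powr q)"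
    by (intro continuous_on_powr' continuous_on_norm 1 continuous_on_const) simp
qed

lemma poincare_test_pointwise:
  assumes \<phi>: "\<phi> \<in> test_functions \<Omega>" and b: "norm b = 1" and D: "\<And>x. x \<in> \<Omega> \<Longrightarrow> \<bar>x \<bullet> b\<bar> \<le> D" "D \<ge> 0"
    and q: "q > 1"
  shows "norm (\<phi> x) powr q \<le> (2 * D + 1) powr (q - 1) *
    (LBINT t. indicator {0..2 * D + 1} t * norm (grad \<phi> (x + t *\<^sub>R b)) powr q)"
proof -
  \<comment> \<open>In a slab of half-width \<open>D\<close> a step of length
    \<open>2 * D + 1\<close> along \<open>b\<close> ends outside, where \<open>\<phi>\<close>
    vanishes. The surplus 1 makes the exit strict and keeps \<open>T\<close> positive for
    \<open>D = 0\<close>.\<close>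
  define T where "T = 2 * D + 1"
  have T: "T > 0" using D(2) by (simp add: T_def)
  let ?a = "\<lambda>t. norm (grad \<phi> (x + t *\<^sub>R b))"
  have ia: "integrable lborel (\<lambda>t. indicator {0..T} t *\<^sub>R ?a t)" "integrable lborel (\<lambda>t. indicator {0..T} t *\<^sub>R (?a t powr q))"
    using q by (intro borel_integrable_compact continuous_on_norm continuous_grad_line[OF \<phi>] compact_Icc; simp)+
  show ?thesis
  proof (cases "\<phi> x = 0")
    case True
    then show ?thesis using q by (auto intro!: mult_nonneg_nonneg Bochner_Integration.integral_nonneg)
  next
    case False
    then have x: "x \<in> \<Omega>" using test_functionsD(5)[OF \<phi>] by blast
    have "b \<bullet> b = 1" using b by (simp add: dot_square_norm)
    then have "(x + T *\<^sub>R b) \<bullet> b = x \<bullet> b + T" by (simp add: inner_add_left)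
    then have "\<bar>(x + T *\<^sub>R b) \<bullet> b\<bar> > D" using D(1)[OF x] D(2) by (simp add: T_def)
    then have "x + T *\<^sub>R b \<notin> \<Omega>" using D(1)[of "x + T *\<^sub>R b"] by auto
    then have xT: "\<phi> (x + T *\<^sub>R b) = 0" by (rule test_functionsD(5)[OF \<phi>])
    have "(LBINT t. indicator {0..T} t *\<^sub>R (grad \<phi> (x + t *\<^sub>R b) \<bullet> b)) = \<phi> (x + T *\<^sub>R b) - \<phi> (x + 0 *\<^sub>R b)"
    proof (rule integral_FTC_Icc)
      fix t
      have "((\<lambda>t. x + t *\<^sub>R b) has_derivative (\<lambda>h. h *\<^sub>R b)) (at t)"
        by (auto intro!: derivative_eq_intros)
      then have "((\<lambda>t. \<phi> (x + t *\<^sub>R b)) has_derivative (\<lambda>h. grad \<phi> (x + t *\<^sub>R b) \<bullet> (h *\<^sub>R b))) (at t)"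
        by (rule has_derivative_compose) (rule has_derivative_grad[OF test_functionsD(2)[OF \<phi>]])
      then have "((\<lambda>t. \<phi> (x + t *\<^sub>R b)) has_vector_derivative (grad \<phi> (x + t *\<^sub>R b) \<bullet> b)) (at t)"
        unfolding has_vector_derivative_def by (rule has_derivative_eq_rhs) (simp add: fun_eq_iff)
      then show "((\<lambda>t. \<phi> (x + t *\<^sub>R b)) has_vector_derivative (grad \<phi> (x + t *\<^sub>R b) \<bullet> b)) (at t within {0..T})"
        by (rule has_vector_derivative_at_within)
    next
      show "continuous_on {0..T} (\<lambda>t. grad \<phi> (x + t *\<^sub>R b) \<bullet> b)"
        by (intro continuous_on_inner continuous_grad_line[OF \<phi>] continuous_on_const)
    qed (use T in simp)
    then have "\<bar>\<phi> x\<bar> = \<bar>LBINT t. indicator {0..T} t *\<^sub>R (grad \<phi> (x + t *\<^sub>R b) \<bullet> b)\<bar>" using xT by simp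
    also have "\<dots> \<le> (LBINT t. norm (indicator {0..T} t *\<^sub>R (grad \<phi> (x + t *\<^sub>R b) \<bullet> b)))"
      unfolding real_norm_def[symmetric] by (rule integral_norm_bound)
    also have "\<dots> \<le> (LBINT t. indicator {0..T} t *\<^sub>R ?a t)"
    proof (rule integral_mono_AE')
      show "AE t in lborel. norm (indicator {0..T} t *\<^sub>R (grad \<phi> (x + t *\<^sub>R b) \<bullet> b)) \<le> indicator {0..T} t *\<^sub>R ?a t"
        using Cauchy_Schwarz_ineq2[of _ b] b by (auto simp: indicator_def)
    qed (use ia in auto)
    finally have le: "\<bar>\<phi> x\<bar> \<le> (LBINT t. indicator {0..T} t *\<^sub>R ?a t)" .
    \<comment> \<open>The tangent is taken at \<open>m\<close>. By \<open>le\<close> the integral of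
      the gradient norm is at least \<open>T * m\<close>, so the linear term is nonnegative after
      integration.\<close>
    define m where "m = \<bar>\<phi> x\<bar> / T"
    have m: "m > 0" using False T by (simp add: m_def)
    define c where "c = q * m powr (q - 1)"
    have c: "c \<ge> 0" using q by (simp add: c_def)
    have it: "integrable lborel (indicator {0..T} :: real \<Rightarrow> real)"
      using T by (intro integrable_real_indicator) simp_all
    have "T * m powr q \<le> T * m powr q + c * ((LBINT t. indicator {0..T} t *\<^sub>R ?a t) - T * m)"
      using le c T by (simp add: m_def)
    also have "\<dots> = (LBINT t. (m powr q - c * m) * indicator {0..T} t + c * (indicator {0..T} t *\<^sub>R ?a t))"
      using ia(1) it T by (simp add: algebra_simps)
    also have "\<dots> \<le> (LBINT t. indicator {0..T} t *\<^sub>R (?a t powr q))"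
    proof (rule integral_mono)
      show "(m powr q - c * m) * indicator {0..T} t + c * (indicator {0..T} t *\<^sub>R ?a t) \<le> indicator {0..T} t *\<^sub>R (?a t powr q)" for t
        using powr_above_tangent[OF norm_ge_zero m q, of "grad \<phi> (x + t *\<^sub>R b)"]
        by (simp add: indicator_def c_def algebra_simps)
    qed (use ia it in auto)
    finally have "T powr (q - 1) * (T * m powr q) \<le> T powr (q - 1) * (LBINT t. indicator {0..T} t *\<^sub>R (?a t powr q))"
      by (rule mult_left_mono) simp
    moreover have "T powr (q - 1) * (T * m powr q) = \<bar>\<phi> x\<bar> powr q"
      using T by (simp add: m_def powr_divide powr_diff)
    ultimately show ?thesis by (simp add: T_def)
  qed
qed

text \<open>The pointwise bound is integrated over \<open>x\<close> and the integrals are exchanged.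
  Each translate of the gradient has the same integral, so the segment contributes a factor
  \<open>T\<close> and \<open>T powr (q - 1)\<close> becomes \<open>T powr q\<close>.\<close>

lemma poincare_test:
  assumes \<phi>: "\<phi> \<in> test_functions \<Omega>" and b: "norm b = 1" and D: "\<And>x. x \<in> \<Omega> \<Longrightarrow> \<bar>x \<bullet> b\<bar> \<le> D" "D \<ge> 0"
    and q: "q > 1"
  shows "Lqd q \<phi> (\<lambda>_. 0) \<le> (2 * D + 1) powr q * Lqd q (grad \<phi>) (\<lambda>_. 0)"
proof -
  define T where "T = 2 * D + 1"
  have T: "T > 0" using D(2) by (simp add: T_def)
  have q0: "q > 0" using q by simp
  note t = Lqb_test[OF \<phi> q0]
  note [measurable] = t[THEN LqbD]
  let ?N = "\<lambda>x. norm (grad \<phi> x) powr q"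
  have "ennreal (Lqd q \<phi> (\<lambda>_. 0)) = (\<integral>\<^sup>+x. ennreal (norm (\<phi> x) powr q) \<partial>lborel)"
    unfolding Lqd_def using Lqb_integrable[OF t(1)] by (simp add: nn_integral_eq_integral)
  also have "\<dots> \<le> (\<integral>\<^sup>+x. ennreal (T powr (q - 1)) * (\<integral>\<^sup>+t. indicator {0..T} t * ennreal (?N (x + t *\<^sub>R b)) \<partial>lborel) \<partial>lborel)"
  proof (rule nn_integral_mono)
    fix x
    have "ennreal (norm (\<phi> x) powr q) \<le> ennreal (T powr (q - 1) * (LBINT t. indicator {0..T} t * ?N (x + t *\<^sub>R b)))"
      using poincare_test_pointwise[OF \<phi> b D q, of x] by (intro ennreal_leI) (simp add: T_def)
    also have "\<dots> = ennreal (T powr (q - 1)) * ennreal (LBINT t. indicator {0..T} t * ?N (x + t *\<^sub>R b))"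
      by (rule ennreal_mult') simp
    also have "ennreal (LBINT t. indicator {0..T} t * ?N (x + t *\<^sub>R b))
        = (\<integral>\<^sup>+t. ennreal (indicator {0..T} t * ?N (x + t *\<^sub>R b)) \<partial>lborel)"
    proof (rule nn_integral_eq_integral[symmetric])
      have "integrable lborel (\<lambda>t. indicator {0..T} t *\<^sub>R ?N (x + t *\<^sub>R b))"
        using q0 by (intro borel_integrable_compact continuous_grad_line(2)[OF \<phi>] compact_Icc) simp
      then show "integrable lborel (\<lambda>t. indicator {0..T} t * ?N (x + t *\<^sub>R b))" by simp
    qed simp
    finally show "ennreal (norm (\<phi> x) powr q) \<le> ennreal (T powr (q - 1)) * (\<integral>\<^sup>+t. indicator {0..T} t * ennreal (?N (x + t *\<^sub>R b)) \<partial>lborel)"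
      by (simp add: ennreal_mult' ennreal_indicator)
  qed
  also have "\<dots> = ennreal (T powr (q - 1)) * (\<integral>\<^sup>+x. (\<integral>\<^sup>+t. indicator {0..T} t * ennreal (?N (x + t *\<^sub>R b)) \<partial>lborel) \<partial>lborel)"
    by (rule nn_integral_cmult) measurable
  also have "(\<integral>\<^sup>+x. (\<integral>\<^sup>+t. indicator {0..T} t * ennreal (?N (x + t *\<^sub>R b)) \<partial>lborel) \<partial>lborel)
      = (\<integral>\<^sup>+t. (\<integral>\<^sup>+x. indicator {0..T} t * ennreal (?N (x + t *\<^sub>R b)) \<partial>lborel) \<partial>lborel)"
    by (rule lborel_pair.Fubini'[symmetric]) measurable
  also have "\<dots> = (\<integral>\<^sup>+t. indicator {0..T} t * (\<integral>\<^sup>+x. ennreal (?N x) \<partial>lborel) \<partial>lborel)"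
    by (rule nn_integral_cong)
      (simp add: nn_integral_cmult lborel_nn_integral_translate[of "\<lambda>x. ennreal (?N x)"])
  also have "\<dots> = ennreal T * ennreal (Lqd q (grad \<phi>) (\<lambda>_. 0))"
    using Lqb_integrable[OF t(2)] T by (simp add: nn_integral_multc nn_integral_eq_integral Lqd_def)
  also have "ennreal (T powr (q - 1)) * (ennreal T * ennreal (Lqd q (grad \<phi>) (\<lambda>_. 0)))
      = ennreal (T powr q * Lqd q (grad \<phi>) (\<lambda>_. 0))"
    using T by (simp add: ennreal_mult'[symmetric] Lqd_nonneg powr_diff flip: mult.assoc)
  finally show ?thesis using Lqd_nonneg by (subst (asm) ennreal_le_iff) (auto simp: T_def intro!: mult_nonneg_nonneg)
qed

text \<open>Passage to the limit from test functions. The factor 4 = 2 * 2 pays for two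
  quasi-triangle inequalities, one for the functions and one for the gradients; \<open>d\<close> is
  chosen so that the approximation errors add up to \<open>e\<close>.\<close>

lemma poincare:
  assumes W: "W0_pair q \<Omega> u G" and b: "norm b = 1" and D: "\<And>x. x \<in> \<Omega> \<Longrightarrow> \<bar>x \<bullet> b\<bar> \<le> D" "D \<ge> 0"
    and q: "q > 1"
  shows "Lqd q u (\<lambda>_. 0) \<le> (4 * (2 * D + 1)) powr q * Lqd q G (\<lambda>_. 0)"
proof (rule field_le_epsilon)
  fix e :: real assume e: "e > 0"
  have q0: "q > 0" "q \<ge> 0" using q by auto
  define T where "T = (2 * D + 1) powr q"
  have T: "T \<ge> 0" by (simp add: T_def)
  define S where "S = (2::real) powr q"
  have S: "S > 0" by (simp add: S_def)
  define d where "d = e / (S + S * T * S)"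
  have P: "S + S * T * S > 0" using S T by (simp add: add_pos_nonneg)
  have d: "d > 0" using e P by (simp add: d_def)
  obtain \<phi> where \<phi>: "\<phi> \<in> test_functions \<Omega>" "Lqd q \<phi> u < d" "Lqd q (grad \<phi>) G < d"
    using W d unfolding W0_pair_def by blast
  note t = Lqb_test[OF \<phi>(1) q0(1)] and L = W0_pair_Lqb[OF W]
  have "Lqd q u (\<lambda>_. 0) \<le> S * (Lqd q u \<phi> + Lqd q \<phi> (\<lambda>_. 0))"
    unfolding S_def by (intro Lqd_triangle L t Lqb_zero q0)
  also have "\<dots> \<le> S * (d + T * Lqd q (grad \<phi>) (\<lambda>_. 0))"
    using \<phi>(2) S poincare_test[OF \<phi>(1) b D q] by (intro mult_left_mono add_mono) (auto simp: T_def Lqd_commute)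
  also have "\<dots> \<le> S * (d + T * (S * (Lqd q (grad \<phi>) G + Lqd q G (\<lambda>_. 0))))"
    using S T unfolding S_def by (intro mult_left_mono add_left_mono Lqd_triangle L t Lqb_zero q0) auto
  also have "\<dots> \<le> S * (d + T * (S * (d + Lqd q G (\<lambda>_. 0))))"
    using S T \<phi>(3) by (intro mult_left_mono add_left_mono add_right_mono) auto
  also have "\<dots> = S * S * T * Lqd q G (\<lambda>_. 0) + (S + S * T * S) * d" by (simp add: algebra_simps)
  also have "(S + S * T * S) * d = e" using P by (simp add: d_def)
  also have "S * S * T = (4 * (2 * D + 1)) powr q"
    by (simp add: S_def T_def flip: powr_mult)
  finally show "Lqd q u (\<lambda>_. 0) \<le> (4 * (2 * D + 1)) powr q * Lqd q G (\<lambda>_. 0) + e" .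
qed

section \<open>Vanishing outside the domain\<close>

lemma Lqd_limit_zero_outside:
  fixes u :: "'a::euclidean_space \<Rightarrow> 'b::euclidean_space"
  assumes L: "Lqb q u" and q: "q > 0" and \<Omega>: "\<Omega> \<in> sets borel"
    and approx: "\<And>e. e > 0 \<Longrightarrow> \<exists>\<phi>. Lqb q \<phi> \<and> (\<forall>x. x \<notin> \<Omega> \<longrightarrow> \<phi> x = 0) \<and> Lqd q \<phi> u < e"
  shows "AE x in lborel. x \<notin> \<Omega> \<longrightarrow> u x = 0"
proof -
  have m [measurable]: "u \<in> borel_measurable borel" by (rule LqbD[OF L])
  note \<Omega> [measurable]
  define v where "v x = indicator \<Omega> x *\<^sub>R u x" for x
  have Lv: "Lqb q v"
    unfolding v_def using q by (intro Lqb_bound[OF L]) (auto simp: indicator_def)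
  have "Lqd q u v \<le> e" if e: "e > 0" for e
  proof -
    obtain \<phi> where \<phi>: "Lqb q \<phi>" "\<And>x. x \<notin> \<Omega> \<Longrightarrow> \<phi> x = 0" "Lqd q \<phi> u < e"
      using approx[OF e] by blast
    \<comment> \<open>Inside \<open>\<Omega>\<close> the difference \<open>u - v\<close> is 0;
      outside, \<open>\<phi>\<close> is 0 and \<open>u - v\<close> has the same norm as
      \<open>\<phi> - u\<close>.\<close>
    have "Lqd q u v \<le> Lqd q \<phi> u"
      unfolding Lqd_def
    proof (rule integral_mono)
      show "norm (u x - v x) powr q \<le> norm (\<phi> x - u x) powr q" for x
        using \<phi>(2)[of x] q by (auto simp: v_def indicator_def)
    qed (intro Lqb_integrable Lqb_diff L Lv \<phi>(1) less_imp_le[OF q])+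
    then show ?thesis using \<phi>(3) by simp
  qed
  then have "Lqd q u v \<le> 0" using field_le_epsilon[of "Lqd q u v" 0] by simp
  from Lqd_zero_AE[OF L Lv q this] show ?thesis
    by eventually_elim (auto simp: v_def)
qed

lemma W0_pair_zero_outside:
  assumes W: "W0_pair q \<Omega> u G" and q: "q > 0" and \<Omega>: "\<Omega> \<in> sets borel"
  shows "AE x in lborel. x \<notin> \<Omega> \<longrightarrow> u x = 0" "AE x in lborel. x \<notin> \<Omega> \<longrightarrow> G x = 0"
proof -
  have *: "\<exists>\<phi>. \<phi> \<in> test_functions \<Omega> \<and> Lqd q \<phi> u < e \<and> Lqd q (grad \<phi>) G < e" if "e > 0" for e
    using W that unfolding W0_pair_def by blast
  show "AE x in lborel. x \<notin> \<Omega> \<longrightarrow> u x = 0"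
    using * Lqb_test(1)[OF _ q] test_functionsD(5)
    by (intro Lqd_limit_zero_outside[OF W0_pair_Lqb(1)[OF W] q \<Omega>]) blast
  show "AE x in lborel. x \<notin> \<Omega> \<longrightarrow> G x = 0"
    using * Lqb_test(2)[OF _ q] test_functions_grad_outside
    by (intro Lqd_limit_zero_outside[OF W0_pair_Lqb(2)[OF W] q \<Omega>]) blast
qed

section \<open>Comparison of minimizers\<close>

locale integrand =
  fixes F :: "'a::euclidean_space \<Rightarrow> real" and q \<alpha> lam Lam :: real
  assumes q: "q > 1" and \<alpha>: "\<alpha> > 0" and lam: "lam > 0"
    and uniformly_convex: "2 * F ((1 / 2) *\<^sub>R (\<xi> + \<eta>)) + \<alpha> * norm (\<xi> - \<eta>) powr q \<le> F \<xi> + F \<eta>"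
    and growth: "lam * norm \<xi> powr q \<le> F \<xi>" "F \<xi> \<le> Lam * norm \<xi> powr q"
begin

lemma F_nonneg: "F \<xi> \<ge> 0"
  using growth(1)[of \<xi>] lam by (smt (verit) mult_nonneg_nonneg powr_ge_zero)

lemma F_zero [simp]: "F 0 = 0"
  using growth[of 0] q by simp

lemma F_midpoint: "2 * F ((1 / 2) *\<^sub>R (\<xi> + \<eta>)) \<le> F \<xi> + F \<eta>"
proof -
  have "0 \<le> \<alpha> * norm (\<xi> - \<eta>) powr q" using \<alpha> by simp
  then show ?thesis using uniformly_convex[of \<xi> \<eta>] by linarith
qed

text \<open>Repeated halving towards \<open>x\<close> turns midpoint convexity into the chord
  inequality at the weights \<open>1 / 2 ^ n\<close>, which is all that continuity takes.\<close>

lemma F_dyadic: "F (x + (1 / 2 ^ n) *\<^sub>R h) \<le> F x + (1 / 2 ^ n) * (F (x + h) - F x)"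
proof (induction n)
  case (Suc n)
  have "x + (1 / 2 ^ Suc n) *\<^sub>R h = (1 / 2) *\<^sub>R (x + (x + (1 / 2 ^ n) *\<^sub>R h))"
    by (simp add: algebra_simps scaleR_half_double flip: scaleR_left_distrib)
  then have "F (x + (1 / 2 ^ Suc n) *\<^sub>R h) \<le> (F x + F (x + (1 / 2 ^ n) *\<^sub>R h)) / 2"
    using F_midpoint[of x "x + (1 / 2 ^ n) *\<^sub>R h"] by simp
  also have "\<dots> \<le> (F x + (F x + (1 / 2 ^ n) * (F (x + h) - F x))) / 2"
    by (intro divide_right_mono add_left_mono Suc) simp
  also have "\<dots> = F x + (1 / 2 ^ Suc n) * (F (x + h) - F x)"
    by (simp add: field_simps)
  finally show ?case .
qed simp

text \<open>Midpoint convexity yields continuity because \<open>F\<close> is locally bounded.\<close>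

lemma F_continuous: "continuous_on UNIV F"
proof (rule continuous_at_imp_continuous_on, rule ballI)
  fix x :: 'a
  define M where "M = \<bar>Lam\<bar> * (norm x + 1) powr q + 1"
  have M: "M > 0" by (simp add: M_def add_nonneg_pos)
  have loc: "F (x + h) - F x \<le> M" if "norm h \<le> 1" for h
  proof -
    have "F (x + h) \<le> Lam * norm (x + h) powr q" by (rule growth)
    also have "\<dots> \<le> \<bar>Lam\<bar> * norm (x + h) powr q" by (intro mult_right_mono) auto
    also have "\<dots> \<le> \<bar>Lam\<bar> * (norm x + 1) powr q"
      using that q norm_triangle_ineq[of x h] by (intro mult_left_mono powr_mono2) auto
    finally show ?thesis using F_nonneg[of x] by (simp add: M_def)
  qed
  have up: "F (x + h) \<le> F x + M / 2 ^ n" if "norm h \<le> 1 / 2 ^ n" for h n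
  proof -
    have "F (x + (1 / 2 ^ n) *\<^sub>R (2 ^ n *\<^sub>R h)) \<le> F x + (1 / 2 ^ n) * (F (x + 2 ^ n *\<^sub>R h) - F x)"
      by (rule F_dyadic)
    moreover have "(1 / 2 ^ n) * (F (x + 2 ^ n *\<^sub>R h) - F x) \<le> (1 / 2 ^ n) * M"
      using that by (intro mult_left_mono loc) (auto simp: field_simps)
    ultimately show ?thesis by simp
  qed
  \<comment> \<open>\<open>x\<close> is the midpoint of \<open>x + h\<close> and
    \<open>x - h\<close>, so the upper bound at \<open>- h\<close> becomes a lower bound at
    \<open>h\<close>.\<close>
  have dn: "F (x + h) \<ge> F x - M / 2 ^ n" if "norm h \<le> 1 / 2 ^ n" for h n
  proof -
    have "(1 / 2) *\<^sub>R ((x + h) + (x + - h)) = x" by (simp flip: scaleR_2)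
    then have "2 * F x \<le> F (x + h) + F (x + - h)" using F_midpoint[of "x + h" "x + - h"] by simp
    then show ?thesis using up[of "- h" n] that by simp
  qed
  show "isCont F x"
    unfolding continuous_at_eps_delta
  proof (intro allI impI)
    fix e :: real assume "e > 0"
    then obtain n where n: "M / e < 2 ^ n" using real_arch_pow[of 2 "M / e"] by auto
    then have Me: "M / 2 ^ n < e" using \<open>e > 0\<close> by (simp add: field_simps)
    have "dist (F y) (F x) < e" if "dist y x < 1 / 2 ^ n" for y
      using up[of "y - x" n] dn[of "y - x" n] that Me by (auto simp: dist_norm dist_real_def)
    then show "\<exists>d>0. \<forall>x'. dist x' x < d \<longrightarrow> dist (F x') (F x) < e"
      by (intro exI[of _ "1 / 2 ^ n"]) auto
  qed
qed

lemma F_measurable [measurable]: "F \<in> borel_measurable borel"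
  by (rule borel_measurable_continuous_onI[OF F_continuous])

lemma F_integrable:
  assumes G: "Lqb q (G :: 'b::euclidean_space \<Rightarrow> 'a)"
  shows "integrable lborel (\<lambda>x. F (G x))"
proof (rule Bochner_Integration.integrable_bound)
  show "integrable lborel (\<lambda>x. Lam * norm (G x) powr q)" using Lqb_integrable[OF G] by simp
  show "AE x in lborel. norm (F (G x)) \<le> norm (Lam * norm (G x) powr q)"
    using growth(2) F_nonneg by (auto intro: order_trans[OF _ abs_ge_self])
qed (use LqbD[OF G] in measurable)

end

text \<open>Integrability in \<open>f_loc\<close> is local: in the application \<open>f\<close> is
  constant in the first variable, so its power need not be integrable over the whole space.\<close>

locale variational = integrand F q \<alpha> lam Lam
  for F :: "'a::euclidean_space \<Rightarrow> real" and q \<alpha> lam Lam +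
  fixes f :: "'a \<Rightarrow> real" and q' :: real
  assumes conj: "1 / q + 1 / q' = 1"
    and f_measurable [measurable]: "f \<in> borel_measurable borel" and f_nonneg: "\<And>x. f x \<ge> 0"
    and f_loc: "\<And>\<Omega>. open \<Omega> \<Longrightarrow> bounded \<Omega> \<Longrightarrow> integrable lborel (\<lambda>x. indicator \<Omega> x * f x powr q')"
begin

definition E :: "('a \<Rightarrow> real) \<Rightarrow> ('a \<Rightarrow> 'a) \<Rightarrow> real" where
  "E u G = (LBINT x. F (G x) - f x * u x)"

definition minimizes :: "'a set \<Rightarrow> ('a \<Rightarrow> real) \<Rightarrow> ('a \<Rightarrow> 'a) \<Rightarrow> bool" where
  "minimizes \<Omega> u G \<longleftrightarrow> W0_pair q \<Omega> u G \<and> (\<forall>v H. W0_pair q \<Omega> v H \<longrightarrow> E u G \<le> E v H)"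

lemma q0: "q > 0" "q \<ge> 0" "q \<ge> 1" using q by auto

lemma q': "q' > 1"
proof -
  have "1 / q < 1" "1 / q > 0" using q by auto
  then have *: "1 / q' > 0" "1 / q' < 1" using conj by linarith+
  then have "q' > 0" by (simp add: zero_less_divide_iff)
  then show ?thesis using *(2) by (simp add: divide_less_eq)
qed

text \<open>Young's inequality for \<open>a / d\<close> and \<open>d * b\<close> with
  \<open>d = e powr (1 / q)\<close>: the coefficient of \<open>b powr q\<close> becomes
  \<open>e\<close> once the divisors \<open>q\<close> and \<open>q'\<close>, both above 1, are
  dropped.\<close>

lemma young_epsilon:
  assumes e: "e > 0"
  obtains K where "K \<ge> 0" "\<And>a b :: real. a \<ge> 0 \<Longrightarrow> b \<ge> 0 \<Longrightarrow> a * b \<le> K * a powr q' + e * b powr q"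
proof
  define d where "d = e powr (1 / q)"
  have d: "d > 0" "d powr q = e" using e q by (auto simp: d_def powr_powr)
  show "(1 / d) powr q' \<ge> 0" by simp
  fix a b :: real assume ab: "a \<ge> 0" "b \<ge> 0"
  have "a * b = (a / d) * (d * b)" using d by simp
  also have "\<dots> \<le> (a / d) powr q' / q' + (d * b) powr q / q"
    using ab d q q' conj by (intro Youngs_inequality) auto
  also have "\<dots> \<le> (a / d) powr q' + (d * b) powr q"
    using q q' by (intro add_mono) (simp_all add: divide_le_eq mult_le_cancel_left1 not_less)
  also have "(a / d) powr q' = (1 / d) powr q' * a powr q'" by (simp flip: powr_mult)
  also have "(d * b) powr q = e * b powr q" by (simp add: powr_mult d(2))
  finally show "a * b \<le> (1 / d) powr q' * a powr q' + e * b powr q" .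
qed

lemma fu_integrable:
  assumes W: "W0_pair q \<Omega> u G" and \<Omega>: "open \<Omega>" "bounded \<Omega>"
  shows "integrable lborel (\<lambda>x. f x * u x)"
proof -
  note [measurable] = LqbD[OF W0_pair_Lqb(1)[OF W]]
  obtain K where K: "K \<ge> 0" "\<And>a b :: real. a \<ge> 0 \<Longrightarrow> b \<ge> 0 \<Longrightarrow> a * b \<le> K * a powr q' + 1 * b powr q"
    using young_epsilon[of 1] by auto
  show ?thesis
  proof (rule Bochner_Integration.integrable_bound)
    show "integrable lborel (\<lambda>x. K * (indicator \<Omega> x * f x powr q') + norm (u x) powr q)"
      using f_loc[OF \<Omega>] Lqb_integrable[OF W0_pair_Lqb(1)[OF W]] by auto
    show "AE x in lborel. norm (f x * u x) \<le> norm (K * (indicator \<Omega> x * f x powr q') + norm (u x) powr q)"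
      using W0_pair_zero_outside(1)[OF W q0(1) borel_open[OF \<Omega>(1)]]
    proof eventually_elim
      case (elim x)
      show ?case
      proof (cases "x \<in> \<Omega>")
        case True
        have "norm (f x * u x) = f x * norm (u x)" using f_nonneg by (simp add: abs_mult)
        also have "\<dots> \<le> K * f x powr q' + norm (u x) powr q" using K(2)[OF f_nonneg[of x] norm_ge_zero[of "u x"]] by simp
        finally show ?thesis using True K(1) by simp
      qed (use elim in simp)
    qed
  qed measurable
qed

lemma E_eq:
  assumes W: "W0_pair q \<Omega> u G" and \<Omega>: "open \<Omega>" "bounded \<Omega>"
  shows "E u G = (LBINT x. F (G x)) - (LBINT x. f x * u x)"
  unfolding E_def using F_integrable[OF W0_pair_Lqb(2)[OF W]] fu_integrable[OF W \<Omega>] by simp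

lemma poincare_bounded:
  fixes \<Omega> :: "'a set"
  assumes \<Omega>: "bounded \<Omega>"
  obtains C where "\<And>u G. W0_pair q \<Omega> u G \<Longrightarrow> Lqd q u (\<lambda>_. 0) \<le> C * Lqd q G (\<lambda>_. 0)"
proof -
  obtain b :: 'a where b: "b \<in> Basis" using nonempty_Basis by blast
  obtain D where D: "D > 0" "\<And>x. x \<in> \<Omega> \<Longrightarrow> norm x \<le> D" using \<Omega> unfolding bounded_pos by blast
  have *: "\<bar>x \<bullet> b\<bar> \<le> D" if "x \<in> \<Omega>" for x using Basis_le_norm[OF b, of x] D(2)[OF that] by linarith
  show ?thesis
    by (rule that) (rule poincare[OF _ norm_Basis[OF b] * less_imp_le[OF D(1)] q])
qed

text \<open>Comparison with the midpoint of \<open>u\<close> and \<open>v\<close> leaves only the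
  uniform convexity term, so the gradients agree, and the Poincare inequality makes the functions
  agree. It is enough for \<open>v\<close> to be no worse than \<open>u\<close>, so the statement
  applies to positive parts and minima.\<close>

lemma minimizer_unique:
  assumes u: "minimizes \<Omega> u G" and v: "W0_pair q \<Omega> v H" and le: "E v H \<le> E u G"
    and \<Omega>: "open \<Omega>" "bounded \<Omega>"
  shows "AE x in lborel. u x = v x"
proof -
  have U: "W0_pair q \<Omega> u G" using u by (simp add: minimizes_def)
  define w where "w = (\<lambda>x. (1 / 2) * u x + (1 / 2) * v x)"
  define W where "W = (\<lambda>x. (1 / 2) *\<^sub>R G x + (1 / 2) *\<^sub>R H x)"
  have w: "W0_pair q \<Omega> w W" unfolding w_def W_def by (rule W0_pair_lincomb[OF U v q0(1)])
  note L = W0_pair_Lqb[OF U] W0_pair_Lqb[OF v] W0_pair_Lqb[OF w]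
  note i = F_integrable[OF L(2)] F_integrable[OF L(4)] F_integrable[OF L(6)]
  note fi = fu_integrable[OF U \<Omega>] fu_integrable[OF v \<Omega>]
  have iGH: "integrable lborel (\<lambda>x. norm (G x - H x) powr q)"
    by (intro Lqb_integrable Lqb_diff L q0)
  have "(LBINT x. 2 * F (W x) + \<alpha> * norm (G x - H x) powr q) \<le> (LBINT x. F (G x) + F (H x))"
  proof (rule integral_mono)
    show "2 * F (W x) + \<alpha> * norm (G x - H x) powr q \<le> F (G x) + F (H x)" for x
      using uniformly_convex[of "G x" "H x"] by (simp add: W_def scaleR_right_distrib)
  qed (use i iGH in auto)
  then have 1: "2 * (LBINT x. F (W x)) + \<alpha> * Lqd q G H \<le> (LBINT x. F (G x)) + (LBINT x. F (H x))"
    using i iGH by (simp add: Lqd_def)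
  have "(LBINT x. f x * w x) = (LBINT x. (1 / 2) * (f x * u x) + (1 / 2) * (f x * v x))"
    by (simp add: w_def algebra_simps)
  then have 2: "2 * (LBINT x. f x * w x) = (LBINT x. f x * u x) + (LBINT x. f x * v x)"
    using fi by simp
  have "E u G \<le> E w W" using u w by (simp add: minimizes_def)
  then have "\<alpha> * Lqd q G H \<le> 0"
    using 1 2 le by (simp add: E_eq[OF U \<Omega>] E_eq[OF v \<Omega>] E_eq[OF w \<Omega>])
  then have GH: "Lqd q G H = 0" using \<alpha> Lqd_nonneg[of q G H] by (simp add: mult_le_0_iff)
  obtain C where C: "\<And>u G. W0_pair q \<Omega> u G \<Longrightarrow> Lqd q u (\<lambda>_. 0) \<le> C * Lqd q G (\<lambda>_. 0)"
    using poincare_bounded[OF \<Omega>(2)] by blast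
  have "Lqd q (\<lambda>x. 1 * u x + (-1) * v x) (\<lambda>_. 0) \<le> C * Lqd q (\<lambda>x. 1 *\<^sub>R G x + (-1) *\<^sub>R H x) (\<lambda>_. 0)"
    by (rule C[OF W0_pair_lincomb[OF U v q0(1)]])
  then have "Lqd q u v \<le> 0" using GH by (simp add: Lqd_def)
  then show ?thesis by (rule Lqd_zero_AE[OF L(1,3) q0(1)])
qed

lemma dsmin_same: "dsmin 0 a a G G = sgn a *\<^sub>R G"
proof -
  have "sgn (a + a) = sgn a" by (simp add: sgn_if)
  then show ?thesis by (simp add: dsmin_def dsabs_0 flip: scaleR_2)
qed

text \<open>The competitor is the positive part, half of \<open>u + \<bar>u\<bar>\<close>, where
  \<open>\<bar>u\<bar>\<close> arises as the smoothed minimum of \<open>u\<close> with itself at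
  \<open>e = 0\<close>. It does not lower \<open>f u\<close>, as \<open>f\<close> is nonnegative,
  and does not raise \<open>F\<close>.\<close>

lemma minimizer_nonneg:
  assumes u: "minimizes \<Omega> u G" and \<Omega>: "open \<Omega>" "bounded \<Omega>"
  shows "AE x in lborel. u x \<ge> 0"
proof -
  have U: "W0_pair q \<Omega> u G" using u by (simp add: minimizes_def)
  have "W0_pair q \<Omega> (\<lambda>x. smin 0 (u x) (u x)) (\<lambda>x. dsmin 0 (u x) (u x) (G x) (G x))"
    using W0_pair_smin[OF U U q0(1)] by simp
  then have A: "W0_pair q \<Omega> (\<lambda>x. \<bar>u x\<bar>) (\<lambda>x. sgn (u x) *\<^sub>R G x)"
    by (simp add: smin_abs dsmin_same)
  define v where "v = (\<lambda>x. (1 / 2) * u x + (1 / 2) * \<bar>u x\<bar>)"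
  define H where "H = (\<lambda>x. (1 / 2) *\<^sub>R G x + (1 / 2) *\<^sub>R (sgn (u x) *\<^sub>R G x))"
  have v: "W0_pair q \<Omega> v H" unfolding v_def H_def by (rule W0_pair_lincomb[OF U A q0(1)])
  have "E v H \<le> E u G"
    unfolding E_def
  proof (rule integral_mono)
    show "integrable lborel (\<lambda>x. F (H x) - f x * v x)"
      using F_integrable[OF W0_pair_Lqb(2)[OF v]] fu_integrable[OF v \<Omega>] by simp
    show "integrable lborel (\<lambda>x. F (G x) - f x * u x)"
      using F_integrable[OF W0_pair_Lqb(2)[OF U]] fu_integrable[OF U \<Omega>] by simp
    fix x
    have "F (H x) \<le> F (G x)"
    proof -
      \<comment> \<open>On the zero set of \<open>u\<close> the constructed gradient is half of
        \<open>G\<close>; elsewhere it is \<open>G\<close> or 0. Midpoint convexity with 0 covers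
        the first case.\<close>
      have h: "F ((1 / 2) *\<^sub>R G x) \<le> F (G x)"
        using F_midpoint[of "G x" 0] F_nonneg[of "G x"] by simp
      consider "u x > 0" | "u x = 0" | "u x < 0" by linarith
      then show ?thesis
        by cases (use h F_nonneg[of "G x"] in \<open>simp_all add: H_def flip: scaleR_left_distrib\<close>)
    qed
    moreover have "f x * u x \<le> f x * v x" using f_nonneg[of x] by (intro mult_left_mono) (auto simp: v_def)
    ultimately show "F (H x) - f x * v x \<le> F (G x) - f x * u x" by linarith
  qed
  from minimizer_unique[OF u v this \<Omega>] show ?thesis
    by eventually_elim (auto simp: v_def abs_if split: if_splits)
qed

text \<open>The maximum is taken as \<open>u + v - m\<close>, so membership follows from linearity
  and the terms with \<open>f\<close> balance exactly. Minimality of \<open>v\<close> against it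
  makes \<open>m\<close> no worse than \<open>u\<close>, and uniqueness then identifies
  \<open>u\<close> with the minimum.\<close>

lemma minimizer_mono:
  assumes u: "minimizes \<Omega> u G" and v: "minimizes \<Omega>' v H"
    and \<Omega>: "open \<Omega>" "bounded \<Omega>" and \<Omega>': "open \<Omega>'" "bounded \<Omega>'" and sub: "\<Omega> \<subseteq> \<Omega>'"
  shows "AE x in lborel. u x \<le> v x"
proof -
  have U: "W0_pair q \<Omega> u G" and V: "W0_pair q \<Omega>' v H" using u v by (simp_all add: minimizes_def)
  define m where "m = (\<lambda>x. smin 0 (u x) (v x))"
  define K where "K = (\<lambda>x. dsmin 0 (u x) (v x) (G x) (H x))"
  have M: "W0_pair q \<Omega> m K"
    unfolding m_def K_def using W0_pair_smin[OF U V q0(1)] sub by (simp add: Int_absorb2)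
  define M' where "M' = (\<lambda>x. 1 * (1 * u x + 1 * v x) + (-1) * m x)"
  define K' where "K' = (\<lambda>x. 1 *\<^sub>R (1 *\<^sub>R G x + 1 *\<^sub>R H x) + (-1) *\<^sub>R K x)"
  have M': "W0_pair q \<Omega>' M' K'"
    unfolding M'_def K'_def
    by (intro W0_pair_lincomb V W0_pair_mono[OF U sub] W0_pair_mono[OF M sub] q0)
  note un = minimizer_nonneg[OF u \<Omega>] and vn = minimizer_nonneg[OF v \<Omega>']
  note uz = W0_pair_gradient_zero[OF U q0(3) un] and vz = W0_pair_gradient_zero[OF V q0(3) vn]
  note i = F_integrable[OF W0_pair_Lqb(2)[OF U]] F_integrable[OF W0_pair_Lqb(2)[OF V]]
    F_integrable[OF W0_pair_Lqb(2)[OF M]] F_integrable[OF W0_pair_Lqb(2)[OF M']]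
  note fi = fu_integrable[OF U \<Omega>] fu_integrable[OF V \<Omega>'] fu_integrable[OF M \<Omega>] fu_integrable[OF M' \<Omega>']
  have "(LBINT x. F (K x) + F (K' x)) \<le> (LBINT x. F (G x) + F (H x))"
  proof (rule integral_mono_AE)
    show "AE x in lborel. F (K x) + F (K' x) \<le> F (G x) + F (H x)"
      using un vn uz vz
    proof eventually_elim
      case (elim x)
      consider "u x > v x" | "u x < v x" | "u x = v x" "u x > 0" | "u x = 0" "v x = 0" using elim by linarith
      then show ?case
      proof cases
        case 1
        then have "K x = H x" using elim
          by (simp add: K_def dsmin_def dsabs_0 algebra_simps flip: scaleR_left_distrib)
        then show ?thesis by (simp add: K'_def)
      next
        case 2
        then have "K x = G x" using elim
          by (simp add: K_def dsmin_def dsabs_0 algebra_simps flip: scaleR_left_distrib)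
        then show ?thesis by (simp add: K'_def)
      next
        case 3
        then have "K x = (1 / 2) *\<^sub>R (G x + H x)" by (simp add: K_def dsmin_def dsabs_0)
        moreover have "y - (1 / 2) *\<^sub>R y = (1 / 2) *\<^sub>R y" for y :: 'a
          by (simp add: algebra_simps flip: scaleR_left_distrib)
        ultimately have "K' x = (1 / 2) *\<^sub>R (G x + H x)" by (simp add: K'_def)
        with \<open>K x = _\<close> show ?thesis using F_midpoint[of "G x" "H x"] by simp
      next
        case 4
        \<comment> \<open>Here \<open>K x\<close> is 0 and \<open>K' x\<close> is
          \<open>G x + H x\<close>, which convexity does not control; only the vanishing of both
          gradients on the zero sets settles this case.\<close>
        then have "G x = 0" "H x = 0" using elim by auto
        then show ?thesis using 4 by (simp add: K_def K'_def dsmin_def dsabs_0)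
      qed
    qed
  qed (use i in auto)
  then have 1: "(LBINT x. F (K x)) + (LBINT x. F (K' x)) \<le> (LBINT x. F (G x)) + (LBINT x. F (H x))"
    using i by simp
  have "(LBINT x. f x * M' x) = (LBINT x. f x * u x + f x * v x - f x * m x)"
    by (simp add: M'_def algebra_simps)
  then have 2: "(LBINT x. f x * M' x) = (LBINT x. f x * u x) + (LBINT x. f x * v x) - (LBINT x. f x * m x)"
    using fi by simp
  have "E v H \<le> E M' K'" using v M' by (simp add: minimizes_def)
  then have "E m K \<le> E u G"
    using 1 2 by (simp add: E_eq[OF U \<Omega>] E_eq[OF V \<Omega>'] E_eq[OF M \<Omega>] E_eq[OF M' \<Omega>'])
  from minimizer_unique[OF u M this \<Omega>] un vn show ?thesis
    by eventually_elim (simp add: m_def smin_min min_def split: if_splits)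
qed

lemma E_translate:
  assumes W: "W0_pair q \<Omega> u G" and f: "\<And>x. f (x + a) = f x"
  shows "E (\<lambda>x. u (x + a)) (\<lambda>x. G (x + a)) = E u G"
proof -
  note [measurable] = W0_pair_Lqb[OF W, THEN LqbD]
  have "(LBINT x. F (G (x + a)) - f (x + a) * u (x + a)) = (LBINT x. F (G x) - f x * u x)"
    by (intro lborel_integral_translate[where f="\<lambda>x. F (G x) - f x * u x"]) measurable
  then show ?thesis by (simp add: E_def f)
qed

text \<open>Competitors on the shifted domain are pulled back by \<open>- a\<close>, and the energy
  does not change because \<open>f\<close> is invariant under the shift.\<close>

lemma minimizes_translate:
  assumes u: "minimizes \<Omega> u G" and f: "\<And>x. f (x + a) = f x"
  shows "minimizes ((\<lambda>x. x - a) ` \<Omega>) (\<lambda>x. u (x + a)) (\<lambda>x. G (x + a))"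
  unfolding minimizes_def
proof (intro conjI allI impI)
  have U: "W0_pair q \<Omega> u G" using u by (simp add: minimizes_def)
  show "W0_pair q ((\<lambda>x. x - a) ` \<Omega>) (\<lambda>x. u (x + a)) (\<lambda>x. G (x + a))" by (rule W0_pair_translate[OF U])
  fix v H assume V: "W0_pair q ((\<lambda>x. x - a) ` \<Omega>) v H"
  have "W0_pair q \<Omega> (\<lambda>x. v (x + - a)) (\<lambda>x. H (x + - a))"
    using W0_pair_translate[OF V, of "- a"] by (simp add: image_image)
  then have "E u G \<le> E (\<lambda>x. v (x + - a)) (\<lambda>x. H (x + - a))" using u unfolding minimizes_def by blast
  also have "\<dots> = E v H"
  proof (rule E_translate[OF V])
    show "f (x + - a) = f x" for x using f[of "x - a"] by simp
  qed
  finally show "E (\<lambda>x. u (x + a)) (\<lambda>x. G (x + a)) \<le> E v H"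
    by (simp add: E_translate[OF U f])
qed

lemma W0_pair_zero:
  fixes \<Omega> :: "'a set"
  shows "W0_pair q \<Omega> (\<lambda>x. 0) (\<lambda>x. 0)"
proof -
  have "(\<lambda>x. 0) \<in> test_functions \<Omega>"
    by (auto simp: test_functions_def C_diff_const intro!: exI[of _ "{}"])
  moreover have "grad (\<lambda>x::'a. 0) = (\<lambda>x. 0)" by (rule ext, rule grad_eqI) simp
  ultimately show ?thesis using W0_pair_test[of "\<lambda>x. 0" \<Omega> q] q0(1) by simp
qed

text \<open>The constant depends on the domain only through its half-width \<open>D\<close> in
  direction \<open>b\<close>; this makes the bound proportional to the mass of
  \<open>f powr q'\<close> on arbitrarily long cylinders.\<close>

lemma minimizer_bound:
  fixes b :: 'a
  assumes b: "norm b = 1" and D: "D \<ge> 0"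
  obtains C where "C \<ge> 0" "\<And>\<Omega> u G. minimizes \<Omega> u G \<Longrightarrow> open \<Omega> \<Longrightarrow> bounded \<Omega> \<Longrightarrow>
    (\<And>x. x \<in> \<Omega> \<Longrightarrow> \<bar>x \<bullet> b\<bar> \<le> D) \<Longrightarrow>
    Lqd q u (\<lambda>_. 0) \<le> C * (LBINT x. indicator \<Omega> x * f x powr q')"
proof -
  define P where "P = (4 * (2 * D + 1)) powr q"
  have P: "P > 0" using D by (simp add: P_def)
  \<comment> \<open>With this \<open>e\<close>, multiplying by the Poincare constant
    \<open>P\<close> turns the Young term into half of \<open>lam * A\<close>, which is absorbed on
    the left.\<close>
  define e where "e = lam / (2 * P)"
  have e: "e > 0" using lam P by (simp add: e_def)
  obtain K where K: "K \<ge> 0" "\<And>a b :: real. a \<ge> 0 \<Longrightarrow> b \<ge> 0 \<Longrightarrow> a * b \<le> K * a powr q' + e * b powr q"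
    using young_epsilon[OF e] by blast
  show ?thesis
  proof (rule that[of "2 * P * K / lam"])
    show "2 * P * K / lam \<ge> 0" using P K lam by simp
    fix \<Omega> u G assume u: "minimizes \<Omega> u G" and \<Omega>: "open \<Omega>" "bounded \<Omega>" and sub: "\<And>x. x \<in> \<Omega> \<Longrightarrow> \<bar>x \<bullet> b\<bar> \<le> D"
    have U: "W0_pair q \<Omega> u G" using u by (simp add: minimizes_def)
    note L = W0_pair_Lqb[OF U]
    define A where "A = Lqd q u (\<lambda>_. 0)"
    define \<Phi> where "\<Phi> = (LBINT x. indicator \<Omega> x * f x powr q')"
    have "E u G \<le> E (\<lambda>x. 0) (\<lambda>x. 0)" using u W0_pair_zero unfolding minimizes_def by blast
    then have 1: "(LBINT x. F (G x)) \<le> (LBINT x. f x * u x)"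
      by (simp add: E_eq[OF U \<Omega>]) (simp add: E_def)
    have "lam * Lqd q G (\<lambda>_. 0) = (LBINT x. lam * norm (G x) powr q)" by (simp add: Lqd_def)
    also have "\<dots> \<le> (LBINT x. F (G x))"
      using Lqb_integrable[OF L(2)] F_integrable[OF L(2)] growth(1) by (intro integral_mono) auto
    also have "\<dots> \<le> (LBINT x. f x * u x)" by (rule 1)
    also have "\<dots> \<le> (LBINT x. K * (indicator \<Omega> x * f x powr q') + e * norm (u x) powr q)"
    proof (rule integral_mono_AE)
      show "integrable lborel (\<lambda>x. f x * u x)" by (rule fu_integrable[OF U \<Omega>])
      show "integrable lborel (\<lambda>x. K * (indicator \<Omega> x * f x powr q') + e * norm (u x) powr q)"
        using f_loc[OF \<Omega>] Lqb_integrable[OF L(1)] by auto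
      show "AE x in lborel. f x * u x \<le> K * (indicator \<Omega> x * f x powr q') + e * norm (u x) powr q"
        using W0_pair_zero_outside(1)[OF U q0(1) borel_open[OF \<Omega>(1)]]
      proof eventually_elim
        case (elim x)
        show ?case
        proof (cases "x \<in> \<Omega>")
          case True
          have "f x * u x \<le> f x * norm (u x)" using f_nonneg by (intro mult_left_mono) auto
          also have "\<dots> \<le> K * f x powr q' + e * norm (u x) powr q" by (rule K(2)[OF f_nonneg norm_ge_zero])
          finally show ?thesis using True by simp
        qed (use elim e in simp)
      qed
    qed
    also have "\<dots> = K * \<Phi> + e * A"
      using f_loc[OF \<Omega>] Lqb_integrable[OF L(1)] by (simp add: \<Phi>_def A_def Lqd_def)
    finally have 2: "lam * Lqd q G (\<lambda>_. 0) \<le> K * \<Phi> + e * A" .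
    have "lam * A \<le> lam * (P * Lqd q G (\<lambda>_. 0))"
      unfolding A_def P_def using lam poincare[OF U b sub D q] by (intro mult_left_mono) auto
    also have "\<dots> = P * (lam * Lqd q G (\<lambda>_. 0))" by simp
    also have "\<dots> \<le> P * (K * \<Phi> + e * A)" using 2 P by (intro mult_left_mono) auto
    also have "\<dots> = P * K * \<Phi> + lam * A / 2" using P by (simp add: e_def algebra_simps)
    finally have "lam * A \<le> 2 * P * K * \<Phi>" by simp
    then show "Lqd q u (\<lambda>_. 0) \<le> 2 * P * K / lam * (LBINT x. indicator \<Omega> x * f x powr q')"
      using lam by (simp add: A_def \<Phi>_def field_simps)
  qed
qed

end

section \<open>Limits of families that increase under translation\<close>

lemma fst_snd_borel [measurable]:
  "(fst :: 'a::euclidean_space \<times> 'b::euclidean_space \<Rightarrow> 'a) \<in> borel_measurable borel"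
  "(snd :: 'a::euclidean_space \<times> 'b::euclidean_space \<Rightarrow> 'b) \<in> borel_measurable borel"
  by (auto intro!: borel_measurable_continuous_onI continuous_intros)

lemma lborel_prod_translate_integral:
  fixes h :: "'a::euclidean_space \<times> 'b::euclidean_space \<Rightarrow> ennreal"
  assumes [measurable]: "h \<in> borel_measurable borel" "Q \<in> sets borel"
  shows "(\<integral>\<^sup>+X. indicator Q (fst X) * h (X - (a, 0)) \<partial>lborel) = (\<integral>\<^sup>+X. indicator Q (fst X + a) * h X \<partial>lborel)"
proof -
  have "(\<lambda>X. indicator Q (fst X) * h (X - (a, 0))) \<in> borel_measurable borel" by measurable
  from lborel_nn_integral_translate[OF this, of "(a, 0)"] show ?thesis by simp
qed

text \<open>For each point the shifts in \<open>A\<close> that bring it over \<open>Q\<close> have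
  measure at most that of \<open>Q\<close>. Integrating over all shifts in \<open>A\<close> and
  exchanging the integrals therefore localizes a global bound, and the measure of \<open>A\<close>
  cancels.\<close>

lemma local_bound_from_translates:
  fixes h h' :: "'a::euclidean_space \<times> 'b::euclidean_space \<Rightarrow> ennreal"
  assumes [measurable]: "h \<in> borel_measurable borel" "h' \<in> borel_measurable borel" "Q \<in> sets borel" "A \<in> sets borel"
    and A: "emeasure lborel A \<noteq> 0" "emeasure lborel A \<noteq> \<infinity>"
    and le: "\<And>a. a \<in> A \<Longrightarrow> AE X in lborel. h X \<le> h' (X - (a, 0))"
    and bd: "(\<integral>\<^sup>+X. h' X \<partial>lborel) \<le> C * emeasure lborel A"
  shows "(\<integral>\<^sup>+X. indicator Q (fst X) * h X \<partial>lborel) \<le> emeasure lborel Q * C"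
proof -
  let ?I = "\<integral>\<^sup>+X. indicator Q (fst X) * h X \<partial>lborel"
  have ind: "(\<integral>\<^sup>+a. indicator A a * indicator Q (x + a) \<partial>lborel) \<le> emeasure lborel Q" for x :: 'a
  proof -
    have "(\<integral>\<^sup>+a. indicator A a * indicator Q (x + a) \<partial>lborel) \<le> (\<integral>\<^sup>+a. indicator Q (a + x) \<partial>lborel)"
      by (rule nn_integral_mono) (auto simp: indicator_def add.commute)
    also have "\<dots> = (\<integral>\<^sup>+a. indicator Q a \<partial>lborel)" by (rule lborel_nn_integral_translate) measurable
    finally show ?thesis by simp
  qed
  have "emeasure lborel A * ?I = (\<integral>\<^sup>+a. indicator A a * ?I \<partial>lborel)"
    by (simp add: nn_integral_multc)
  also have "\<dots> \<le> (\<integral>\<^sup>+a. (\<integral>\<^sup>+X. indicator A a * indicator Q (fst X + a) * h' X \<partial>lborel) \<partial>lborel)"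
  proof (rule nn_integral_mono)
    fix a
    show "indicator A a * ?I \<le> (\<integral>\<^sup>+X. indicator A a * indicator Q (fst X + a) * h' X \<partial>lborel)"
    proof (cases "a \<in> A")
      case True
      have "?I \<le> (\<integral>\<^sup>+X. indicator Q (fst X) * h' (X - (a, 0)) \<partial>lborel)"
        using le[OF True] by (intro nn_integral_mono_AE) (auto elim!: eventually_mono intro: mult_left_mono)
      also have "\<dots> = (\<integral>\<^sup>+X. indicator Q (fst X + a) * h' X \<partial>lborel)"
        by (rule lborel_prod_translate_integral) measurable
      finally show ?thesis using True by simp
    qed simp
  qed
  also have "\<dots> = (\<integral>\<^sup>+X. (\<integral>\<^sup>+a. indicator A a * indicator Q (fst X + a) * h' X \<partial>lborel) \<partial>lborel)"
    by (rule lborel_pair.Fubini') measurable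
  also have "\<dots> \<le> (\<integral>\<^sup>+X. emeasure lborel Q * h' X \<partial>lborel)"
  proof (rule nn_integral_mono)
    fix X :: "'a \<times> 'b"
    have "(\<integral>\<^sup>+a. indicator A a * indicator Q (fst X + a) * h' X \<partial>lborel)
        = (\<integral>\<^sup>+a. indicator A a * indicator Q (fst X + a) \<partial>lborel) * h' X"
      by (rule nn_integral_multc) measurable
    also have "\<dots> \<le> emeasure lborel Q * h' X" by (rule mult_right_mono[OF ind]) simp
    finally show "(\<integral>\<^sup>+a. indicator A a * indicator Q (fst X + a) * h' X \<partial>lborel) \<le> emeasure lborel Q * h' X" .
  qed
  also have "\<dots> = emeasure lborel Q * (\<integral>\<^sup>+X. h' X \<partial>lborel)" by (rule nn_integral_cmult) measurable
  also have "\<dots> \<le> emeasure lborel Q * (C * emeasure lborel A)" by (rule mult_left_mono[OF bd]) simp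
  finally have "emeasure lborel A * ?I \<le> emeasure lborel A * (emeasure lborel Q * C)" by (simp add: ac_simps)
  then show ?thesis using A by (subst (asm) ennreal_mult_le_mult_iff) auto
qed

lemma AE_lborel_ex:
  assumes "AE x in (lborel :: 'a::euclidean_space measure). P x"
  shows "\<exists>x. P x"
proof -
  have "ae_filter (lborel :: 'a measure) \<noteq> bot" by (simp add: ae_filter_eq_bot_iff)
  from eventually_happens'[OF this assms] show ?thesis .
qed

text \<open>By Fubini, almost every slice \<open>x\<^sub>0\<close> can serve as the representative.\<close>

lemma AE_translation_invariant_imp_snd:
  fixes L :: "'a::euclidean_space \<times> 'b::euclidean_space \<Rightarrow> real"
  assumes m [measurable]: "L \<in> borel_measurable borel"
    and inv: "\<And>a. AE X in lborel. L (X + (a, 0)) = L X"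
  obtains w where "AE X in lborel. L X = w (snd X)"
proof -
  have [measurable]: "L \<in> borel_measurable (borel \<Otimes>\<^sub>M borel)" using m by (simp add: borel_prod)
  have "AE a in (lborel :: 'a measure). AE X in lborel. L (X + (a, 0)) = L X" using inv by simp
  \<comment> \<open>The exceptional set of points depends on the shift; after the exchange almost
    every point is good for almost all shifts.\<close>
  then have "AE X in lborel. AE a in (lborel :: 'a measure). L (X + (a, 0)) = L X"
    by (subst (asm) lborel_pair.AE_commute) measurable
  then have "AE X in lborel \<Otimes>\<^sub>M lborel. AE a in (lborel :: 'a measure). L (X + (a, 0)) = L X"
    unfolding lborel_prod .
  then have "AE x in lborel. AE y in lborel. AE a in lborel. L ((x, y) + (a, 0)) = L (x, y)"
    by (rule lborel_pair.AE_pair)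
  then obtain x0 where x0: "AE y in lborel. AE a in lborel. L ((x0, y) + (a, 0)) = L (x0, y)"
    using AE_lborel_ex by blast
  have "AE y in lborel. AE x in lborel. L (x, y) = L (x0, y)"
    using x0
  proof eventually_elim
    case (elim y)
    \<comment> \<open>From the first coordinate \<open>x0\<close> the shift \<open>x - x0\<close>
      reaches the first coordinate \<open>x\<close>, so the statement about shifts becomes one about
      points.\<close>
    from AE_lborel_translate[OF elim, of "- x0"] show ?case by simp
  qed
  then have "AE x in lborel. AE y in lborel. L (x, y) = L (x0, y)"
    by (subst lborel_pair.AE_commute) measurable
  then have "AE x in lborel. AE y in lborel. L (x, y) = L (x0, snd (x, y))" by simp
  moreover have "{X \<in> space (lborel \<Otimes>\<^sub>M lborel). L X = L (x0, snd X)} \<in> sets (lborel \<Otimes>\<^sub>M lborel)"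
    by measurable
  ultimately have "AE X in lborel \<Otimes>\<^sub>M lborel. L X = L (x0, snd X)"
    by (intro lborel_pair.AE_pair_measure)
  then show ?thesis using that[of "\<lambda>y. L (x0, y)"] unfolding lborel_prod by blast
qed

lemma emeasure_cube:
  assumes "a \<le> c"
  shows "emeasure lborel (box (\<chi> i. a) (\<chi> i. c) :: (real ^ 'p) set) = ennreal ((c - a) ^ CARD('p))"
proof -
  have *: "((\<chi> i. c) - (\<chi> i. a)) \<bullet> b = c - a" if "b \<in> Basis" for b :: "real ^ 'p"
    using that by (auto simp: Basis_vec_def inner_axis)
  have "emeasure lborel (box (\<chi> i. a) (\<chi> i. c) :: (real ^ 'p) set)
      = ennreal (\<Prod>b\<in>Basis. ((\<chi> i. c) - (\<chi> i. a)) \<bullet> (b :: real ^ 'p))"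
    by (rule emeasure_lborel_box) (use * assms in \<open>force simp: inner_diff_left\<close>)
  also have "(\<Prod>b\<in>Basis. ((\<chi> i. c) - (\<chi> i. a)) \<bullet> (b :: real ^ 'p)) = (c - a) ^ CARD('p)"
    using * by simp
  finally show ?thesis .
qed

lemma monotone_translates_limit:
  fixes U :: "real \<Rightarrow> (real ^ 'p) \<times> 'b::euclidean_space \<Rightarrow> real"
  assumes m: "\<And>l. l > 0 \<Longrightarrow> U l \<in> borel_measurable borel"
    and mono: "\<And>l l' a. l > 0 \<Longrightarrow> l' > 0 \<Longrightarrow> (\<And>i. \<bar>a $ i\<bar> \<le> l' - l) \<Longrightarrow> AE X in lborel. U l (X + (a, 0)) \<le> U l' X"
    and nonneg: "\<And>l. l > 0 \<Longrightarrow> AE X in lborel. U l X \<ge> 0"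
    and q: "q > 0" and C: "C < \<infinity>"
    and bound: "\<And>l. l > 0 \<Longrightarrow> (\<integral>\<^sup>+X. ennreal (U l X powr q) \<partial>lborel) \<le> C * ennreal (l ^ CARD('p))"
  obtains w :: "'b \<Rightarrow> real" where
    "\<And>s :: nat \<Rightarrow> real. filterlim s at_top sequentially \<Longrightarrow> AE X in lborel. (\<lambda>k. U (s k) X) \<longlonglongrightarrow> w (snd X)"
proof -
  \<comment> \<open>Integer sizes keep the family of exceptional null sets countable;
    \<open>Suc\<close> keeps the sizes positive.\<close>
  define V where "V n = U (real (Suc n))" for n
  have V [measurable]: "V n \<in> borel_measurable borel" for n by (simp add: V_def m)
  have V0: "AE X in lborel. \<forall>n. V n X \<ge> 0"
    unfolding AE_all_countable V_def using nonneg by simp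
  have mono0: "AE X in lborel. U l X \<le> U l' X" if "0 < l" "l \<le> l'" for l l'
    using mono[of l l' 0] that by (simp add: zero_prod_def[symmetric])
  have Vmono: "AE X in lborel. \<forall>n. V n X \<le> V (Suc n) X"
    unfolding AE_all_countable V_def using mono0 by simp
  \<comment> \<open>Doubling the size admits all shifts with components below \<open>l\<close>. They
    fill a cube of volume \<open>(2 * l) ^ CARD('p)\<close>, exactly the growth of
    \<open>bound\<close> at size \<open>2 * l\<close>.\<close>
  have loc: "(\<integral>\<^sup>+X. indicator Q (fst X) * ennreal (U l X powr q) \<partial>lborel) \<le> emeasure lborel Q * C"
    if l: "l > 0" and Q: "Q \<in> sets borel" for l and Q :: "(real ^ 'p) set"
  proof (rule local_bound_from_translates[where h'="\<lambda>X. ennreal (U (2 * l) X powr q)"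
        and A="box (\<chi> i. - l) (\<chi> i. l)"])
    let ?A = "box (\<chi> i. - l) (\<chi> i. l) :: (real ^ 'p) set"
    have l2: "2 * l > 0" using l by simp
    note [measurable] = m[OF l] m[OF l2]
    show "(\<lambda>X. ennreal (U l X powr q)) \<in> borel_measurable borel" by measurable
    show "(\<lambda>X. ennreal (U (2 * l) X powr q)) \<in> borel_measurable borel" by measurable
    have A: "emeasure lborel ?A = ennreal ((2 * l) ^ CARD('p))"
      using emeasure_cube[of "- l" l] l by simp
    show "emeasure lborel ?A \<noteq> 0"
      "emeasure lborel ?A \<noteq> \<infinity>"
      unfolding A using zero_less_power[of "2 * l" "CARD('p)"] l by (simp_all add: ennreal_eq_0_iff not_le)
    show "(\<integral>\<^sup>+X. ennreal (U (2 * l) X powr q) \<partial>lborel) \<le> C * emeasure lborel ?A"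
      unfolding A using bound[of "2 * l"] l by simp
    fix a :: "real ^ 'p" assume a: "a \<in> box (\<chi> i. - l) (\<chi> i. l)"
    then have "\<bar>a $ i\<bar> \<le> 2 * l - l" for i
      unfolding mem_box_cart by (auto simp: abs_le_iff less_imp_le) (metis less_eq_real_def minus_less_iff)
    then have "AE X in lborel. U l (X + (a, 0)) \<le> U (2 * l) X" using l by (intro mono) auto
    moreover have eq: "X - (a, 0) = X + (- a, 0)" for X :: "(real ^ 'p) \<times> 'b" by (cases X) simp
    ultimately have "AE X in lborel. U l X \<le> U (2 * l) (X - (a, 0))"
      using AE_lborel_translate[of "\<lambda>X. U l (X + (a, 0)) \<le> U (2 * l) X" "(- a, 0)"]
      unfolding eq by (simp add: add.assoc zero_prod_def[symmetric])
    then show "AE X in lborel. ennreal (U l X powr q) \<le> ennreal (U (2 * l) (X - (a, 0)) powr q)"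
      using nonneg[OF l] by eventually_elim (use q in \<open>auto intro!: ennreal_leI powr_mono2\<close>)
  qed (use Q in auto)
  have bdd: "AE X in lborel. \<exists>B. \<forall>n. V n X \<le> B"
  proof -
    \<comment> \<open>Over each ball the supremum of the increasing sequence has a finite integral,
      hence is finite almost everywhere; balls of integer radius exhaust the space.\<close>
    have "AE X in lborel. fst X \<in> cball 0 (real R) \<longrightarrow> (\<exists>B. \<forall>n. V n X \<le> B)" for R :: nat
    proof -
      define Q where "Q = (cball 0 (real R) :: (real ^ 'p) set)"
      let ?f = "\<lambda>n X. indicator Q (fst X) * ennreal (V n X powr q)"
      have Qm [measurable]: "Q \<in> sets borel" by (simp add: Q_def)
      have fm: "?f n \<in> borel_measurable lborel" for n
        by measurable
      have "(\<integral>\<^sup>+X. (SUP n. ?f n X) \<partial>lborel) = (SUP n. integral\<^sup>N lborel (?f n))"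
      proof (rule nn_integral_monotone_convergence_SUP_AE)
        show "AE X in lborel. ?f n X \<le> ?f (Suc n) X" for n
          using Vmono V0 by eventually_elim (use q in \<open>auto intro!: mult_left_mono ennreal_leI powr_mono2\<close>)
      qed (rule fm)
      also have "\<dots> \<le> emeasure lborel Q * C"
        unfolding V_def by (rule SUP_least, rule loc) (auto simp: Qm)
      also have "\<dots> < \<infinity>"
        using C emeasure_lborel_cball_finite[of "0 :: real ^ 'p" "real R"] by (simp add: Q_def ennreal_mult_less_top)
      finally have "(\<integral>\<^sup>+X. (SUP n. ?f n X) \<partial>lborel) \<noteq> \<infinity>" by simp
      then have "AE X in lborel. (SUP n. ?f n X) \<noteq> \<infinity>"
        by (rule nn_integral_PInf_AE[rotated]) (use fm in measurable)
      then show ?thesis unfolding Q_def[symmetric] using V0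
      proof eventually_elim
        case (elim X)
        show ?case
        proof
          assume Q: "fst X \<in> Q"
          then have "(SUP n. ennreal (V n X powr q)) \<noteq> \<infinity>" using elim by simp
          then obtain M where M: "M \<ge> 0" "(SUP n. ennreal (V n X powr q)) = ennreal M"
            by (metis ennreal_cases infinity_ennreal_def)
          have "V n X \<le> M powr (1 / q)" for n
          proof -
            have "ennreal (V n X powr q) \<le> ennreal M" unfolding M(2)[symmetric] by (rule SUP_upper) simp
            then have "V n X powr q \<le> M" using M(1) by simp
            then have "(V n X powr q) powr (1 / q) \<le> M powr (1 / q)" using q by (intro powr_mono2) auto
            then show ?thesis using q elim by (simp add: powr_powr)
          qed
          then show "\<exists>B. \<forall>n. V n X \<le> B" by blast
        qed
      qed
    qed
    then have "AE X in lborel. \<forall>R::nat. fst X \<in> cball 0 (real R) \<longrightarrow> (\<exists>B. \<forall>n. V n X \<le> B)"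
      unfolding AE_all_countable by blast
    then show ?thesis
    proof eventually_elim
      case (elim X)
      obtain R :: nat where "norm (fst X) \<le> real R" using real_arch_simple by blast
      then show ?case using elim by auto
    qed
  qed
  \<comment> \<open>\<open>lim\<close> yields a measurable function on the whole space; its default
    value where the sequence diverges is confined to a null set by \<open>conv\<close>.\<close>
  define L where "L X = lim (\<lambda>n. V n X)" for X
  have Lm [measurable]: "L \<in> borel_measurable borel" unfolding L_def by measurable
  have conv: "AE X in lborel. (\<lambda>n. V n X) \<longlonglongrightarrow> L X \<and> (\<forall>n. V n X \<le> L X)"
    using bdd Vmono
  proof eventually_elim
    case (elim X)
    then obtain B where B: "\<And>n. V n X \<le> B" by blast
    have inc: "incseq (\<lambda>n. V n X)" using elim by (auto intro: incseq_SucI)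
    obtain l where l: "(\<lambda>n. V n X) \<longlonglongrightarrow> l" "\<forall>n. V n X \<le> l"
      using incseq_convergent[OF inc, of B] B by blast
    then show ?case unfolding L_def using limI[OF l(1)] by simp
  qed
  \<comment> \<open>A shift by \<open>a\<close> costs \<open>N\<close> further integer sizes, which
    the limit does not see. Applied to \<open>- a\<close> as well, this gives equality.\<close>
  have le1: "AE X in lborel. L (X + (a, 0)) \<le> L X" for a
  proof -
    obtain N where N: "norm a \<le> real N" using real_arch_simple by blast
    have "AE X in lborel. V n (X + (a, 0)) \<le> V (n + N) X" for n
      unfolding V_def
    proof (rule mono)
      show "\<bar>a $ i\<bar> \<le> real (Suc (n + N)) - real (Suc n)" for i
        using component_le_norm_cart[of a i] N by simp
    qed auto
    then have "AE X in lborel. \<forall>n. V n (X + (a, 0)) \<le> V (n + N) X" by (simp add: AE_all_countable)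
    then show ?thesis using conv AE_lborel_translate[OF conv, of "(a, 0)"]
    proof eventually_elim
      case (elim X)
      have "V n (X + (a, 0)) \<le> L X" for n using elim(1,2) order_trans by blast
      then show ?case by (intro LIMSEQ_le_const2[OF conjunct1[OF elim(3)]]) simp
    qed
  qed
  have inv: "AE X in lborel. L (X + (a, 0)) = L X" for a
    using le1[of a] AE_lborel_translate[OF le1[of "- a"], of "(a, 0)"]
    by eventually_elim (simp add: add.assoc zero_prod_def[symmetric])
  obtain w where w: "AE X in lborel. L X = w (snd X)"
    using AE_translation_invariant_imp_snd[OF Lm inv] by blast
  show ?thesis
  proof (rule that[of w])
    fix s :: "nat \<Rightarrow> real" assume s: "filterlim s at_top sequentially"
    \<comment> \<open>Only the sizes \<open>s k\<close> are compared with the integers, countably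
      many pairs, so the squeeze can run pointwise outside one null set.\<close>
    have "AE X in lborel. \<forall>k n. (0 < s k \<and> s k \<le> real (Suc n) \<longrightarrow> U (s k) X \<le> V n X)
        \<and> (real (Suc n) \<le> s k \<longrightarrow> V n X \<le> U (s k) X)"
      unfolding AE_all_countable V_def
    proof (intro allI)
      fix k n
      show "AE X in lborel. (0 < s k \<and> s k \<le> real (Suc n) \<longrightarrow> U (s k) X \<le> U (real (Suc n)) X)
        \<and> (real (Suc n) \<le> s k \<longrightarrow> U (real (Suc n)) X \<le> U (s k) X)"
        using mono0[of "s k" "real (Suc n)"] mono0[of "real (Suc n)" "s k"]
        by (cases "0 < s k \<and> s k \<le> real (Suc n)"; cases "real (Suc n) \<le> s k") (auto elim!: eventually_mono simp del: of_nat_Suc)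
    qed
    then show "AE X in lborel. (\<lambda>k. U (s k) X) \<longlonglongrightarrow> w (snd X)"
      using conv w
    proof eventually_elim
      case (elim X)
      have up: "U (s k) X \<le> L X" if k: "0 < s k" for k
      proof -
        obtain n :: nat where "s k \<le> real n" using real_arch_simple by blast
        then have "U (s k) X \<le> V n X" using elim(1) k by (auto simp: field_simps)
        then show ?thesis using elim(2) order_trans by blast
      qed
      have "(\<lambda>k. U (s k) X) \<longlonglongrightarrow> L X"
      proof (rule order_tendstoI)
        fix a assume "a < L X"
        then obtain n where n: "a < V n X"
          using elim(2) by (metis eventually_sequentially order_refl order_tendstoD(1))
        have "\<forall>\<^sub>F k in sequentially. real (Suc n) \<le> s k" using s by (simp add: filterlim_at_top)
        then show "\<forall>\<^sub>F k in sequentially. a < U (s k) X"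
          by eventually_elim (use elim(1) n in \<open>force\<close>)
      next
        fix a assume a: "L X < a"
        have "\<forall>\<^sub>F k in sequentially. 1 \<le> s k" using s by (simp add: filterlim_at_top)
        then show "\<forall>\<^sub>F k in sequentially. U (s k) X < a"
          by eventually_elim (rule le_less_trans[OF up a], simp)
      qed
      then show ?case using elim(3) by simp
    qed
  qed
qed

section \<open>Passage to Borel representatives and conclusion\<close>

text \<open>Extension by 0 leads from Lebesgue measurability on the domain to Borel functions on the
  whole space, the setting of the Fubini and translation arguments. The representative is assembled
  from real-valued components.\<close>

lemma borel_version:
  fixes g :: "'a::euclidean_space \<Rightarrow> 'b::euclidean_space"
  assumes g: "g \<in> borel_measurable (lebesgue_on \<Omega>)" and \<Omega>: "\<Omega> \<in> sets borel"
  obtains h where "h \<in> borel_measurable borel" "\<And>x. x \<notin> \<Omega> \<Longrightarrow> h x = 0" "AE x in lborel. x \<in> \<Omega> \<longrightarrow> g x = h x"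
proof -
  have g0: "(\<lambda>x. if x \<in> \<Omega> then g x else 0) \<in> borel_measurable lebesgue"
    using g \<Omega> by (subst borel_measurable_if) auto
  have "\<exists>h. h \<in> borel_measurable borel \<and> (AE x in lborel. (if x \<in> \<Omega> then g x else 0) \<bullet> b = h x)" for b
  proof -
    have "(\<lambda>x. (if x \<in> \<Omega> then g x else 0) \<bullet> b) \<in> borel_measurable lebesgue"
      using g0 by (intro borel_measurable_inner) auto
    from completion_ex_borel_measurable_real[OF this] show ?thesis by auto
  qed
  then obtain h where h [measurable]: "\<And>b. h b \<in> borel_measurable borel"
    and hg: "\<And>b. AE x in lborel. (if x \<in> \<Omega> then g x else 0) \<bullet> b = h b x" by metis
  note \<Omega> [measurable]
  have "AE x in lborel. \<forall>b\<in>Basis. (if x \<in> \<Omega> then g x else 0) \<bullet> b = h b x"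
    using hg by (subst AE_ball_countable) (auto intro: countable_finite)
  then have "AE x in lborel. x \<in> \<Omega> \<longrightarrow> g x = indicator \<Omega> x *\<^sub>R (\<Sum>b\<in>Basis. h b x *\<^sub>R b)"
  proof eventually_elim
    case (elim x)
    have "(\<Sum>b\<in>Basis. h b x *\<^sub>R b) = (\<Sum>b\<in>Basis. (g x \<bullet> b) *\<^sub>R b)" if "x \<in> \<Omega>"
      using elim that by (intro sum.cong) auto
    then show ?case by (simp add: euclidean_representation)
  qed
  then show ?thesis
    by (rule that[rotated 2]) simp_all
qed

lemma borel_version_integral:
  fixes k k' :: "'a::euclidean_space \<Rightarrow> real"
  assumes \<Omega>: "\<Omega> \<in> sets borel" and k': "k' \<in> borel_measurable borel"
    and eq: "AE x in lborel. x \<in> \<Omega> \<longrightarrow> k x = k' x" and zero: "AE x in lborel. x \<notin> \<Omega> \<longrightarrow> k' x = 0"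
  shows "(\<integral>x. k x \<partial>lebesgue_on \<Omega>) = (LBINT x. k' x)"
    and "integrable (lebesgue_on \<Omega>) k \<longleftrightarrow> integrable lborel k'"
proof -
  have S: "\<Omega> \<in> sets lebesgue" using \<Omega> by simp
  have k'L: "k' \<in> borel_measurable lebesgue" "k' \<in> borel_measurable lborel"
    using k' by (auto intro!: measurable_completion)
  have "AE x in lborel. k' x = indicator \<Omega> x *\<^sub>R k x"
    using eq zero by eventually_elim (auto simp: indicator_def)
  then have ae: "AE x in lebesgue. k' x = indicator \<Omega> x *\<^sub>R k x" by (rule AE_completion)
  have mk: "(\<lambda>x. indicator \<Omega> x *\<^sub>R k x) \<in> borel_measurable lebesgue"
    by (rule borel_measurable_AE[OF k'L(1) ae])
  show "(\<integral>x. k x \<partial>lebesgue_on \<Omega>) = (LBINT x. k' x)"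
    unfolding integral_lebesgue_on_eq[OF S] integral_completion[OF k'L(2), symmetric]
    by (rule Bochner_Integration.integral_cong_AE[OF mk k'L(1)]) (use ae in \<open>auto elim: eventually_mono\<close>)
  show "integrable (lebesgue_on \<Omega>) k \<longleftrightarrow> integrable lborel k'"
    unfolding integrable_lebesgue_on_iff[OF S] integrable_completion[OF k'L(2), symmetric]
    by (rule integrable_cong_AE[OF mk k'L(1)]) (use ae in \<open>auto elim: eventually_mono\<close>)
qed

lemma borel_version_Lqb:
  fixes g h :: "'a::euclidean_space \<Rightarrow> 'b::euclidean_space"
  assumes \<Omega>: "\<Omega> \<in> sets borel" and h: "h \<in> borel_measurable borel" and g: "g \<in> Lq q \<Omega>"
    and eq: "AE x in lborel. x \<in> \<Omega> \<longrightarrow> g x = h x" and zero: "AE x in lborel. x \<notin> \<Omega> \<longrightarrow> h x = 0"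
  shows "Lqb q h"
proof -
  have "integrable (lebesgue_on \<Omega>) (\<lambda>x. norm (g x) powr q) \<longleftrightarrow> integrable lborel (\<lambda>x. norm (h x) powr q)"
    by (rule borel_version_integral(2)[OF \<Omega>]) (use h eq zero in \<open>auto elim: eventually_mono\<close>)
  then show ?thesis using g h by (simp add: Lq_def Lqb_def)
qed

lemma borel_version_Lqd:
  fixes \<psi> u U :: "'a::euclidean_space \<Rightarrow> 'b::euclidean_space"
  assumes \<Omega>: "\<Omega> \<in> sets borel" and [measurable]: "\<psi> \<in> borel_measurable borel" "U \<in> borel_measurable borel"
    and \<psi>: "\<And>x. x \<notin> \<Omega> \<Longrightarrow> \<psi> x = 0"
    and eq: "AE x in lborel. x \<in> \<Omega> \<longrightarrow> u x = U x" and zero: "AE x in lborel. x \<notin> \<Omega> \<longrightarrow> U x = 0"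
  shows "(\<integral>x. norm (\<psi> x - u x) powr q \<partial>lebesgue_on \<Omega>) = Lqd q \<psi> U"
  unfolding Lqd_def
proof (rule borel_version_integral(1)[OF \<Omega>])
  show "AE x in lborel. x \<in> \<Omega> \<longrightarrow> norm (\<psi> x - u x) powr q = norm (\<psi> x - U x) powr q"
    using eq by eventually_elim simp
  show "AE x in lborel. x \<notin> \<Omega> \<longrightarrow> norm (\<psi> x - U x) powr q = 0"
    using zero by eventually_elim (simp add: \<psi>)
qed measurable

lemma W1_0_imp_W0_pair:
  fixes u :: "'a::euclidean_space \<Rightarrow> real"
  assumes \<Omega>: "open \<Omega>" and q: "q > 1" and u: "u \<in> W1_0 q \<Omega>"
  obtains U G where "W0_pair q \<Omega> U G" "AE x in lborel. x \<in> \<Omega> \<longrightarrow> u x = U x"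
    "AE x in lborel. x \<in> \<Omega> \<longrightarrow> weak_grad \<Omega> u x = G x"
proof -
  have q0: "q > 0" using q by simp
  have B: "\<Omega> \<in> sets borel" using \<Omega> by simp
  obtain G0 where uL: "u \<in> Lq q \<Omega>" and G0: "G0 \<in> Lq q \<Omega>" "has_weak_gradient \<Omega> u G0"
    using u by (auto simp: W1_0_def W1_def)
  obtain \<phi> where \<phi>: "\<And>k::nat. \<phi> k \<in> test_functions \<Omega>"
    "(\<lambda>k. \<integral>x. norm (\<phi> k x - u x) powr q \<partial>(lebesgue_on \<Omega>)) \<longlonglongrightarrow> 0"
    "(\<lambda>k. \<integral>x. norm (grad (\<phi> k) x - weak_grad \<Omega> u x) powr q \<partial>(lebesgue_on \<Omega>)) \<longlonglongrightarrow> 0"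
    using u by (auto simp: W1_0_def)
  have wg: "has_weak_gradient \<Omega> u (weak_grad \<Omega> u)"
    unfolding weak_grad_def by (rule someI[of "has_weak_gradient \<Omega> u", OF G0(2)])
  \<comment> \<open>Only some weak gradient \<open>G0\<close> is known to lie in \<open>Lq\<close>;
    uniqueness transfers this to the chosen \<open>weak_grad\<close>.\<close>
  have wG0: "AE x in lborel. x \<in> \<Omega> \<longrightarrow> weak_grad \<Omega> u x = G0 x"
    by (rule has_weak_gradient_unique[OF \<Omega> wg G0(2)]) simp
  have uM: "u \<in> borel_measurable (lebesgue_on \<Omega>)" and GM: "G0 \<in> borel_measurable (lebesgue_on \<Omega>)"
    using uL G0(1) by (simp_all add: Lq_def)
  obtain U where U: "U \<in> borel_measurable borel" "\<And>x. x \<notin> \<Omega> \<Longrightarrow> U x = 0" "AE x in lborel. x \<in> \<Omega> \<longrightarrow> u x = U x"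
    by (rule borel_version[OF uM B]) blast
  obtain G where G: "G \<in> borel_measurable borel" "\<And>x. x \<notin> \<Omega> \<Longrightarrow> G x = 0" "AE x in lborel. x \<in> \<Omega> \<longrightarrow> G0 x = G x"
    by (rule borel_version[OF GM B]) blast
  have wG: "AE x in lborel. x \<in> \<Omega> \<longrightarrow> weak_grad \<Omega> u x = G x"
    using wG0 G(3) by eventually_elim simp
  have LU: "Lqb q U" by (rule borel_version_Lqb[OF B U(1) uL U(3)]) (simp add: U(2))
  have LG: "Lqb q G" by (rule borel_version_Lqb[OF B G(1) G0(1) G(3)]) (simp add: G(2))
  note t = Lqb_test[OF \<phi>(1) q0, THEN LqbD]
  have e1: "(\<integral>x. norm (\<phi> k x - u x) powr q \<partial>(lebesgue_on \<Omega>)) = Lqd q (\<phi> k) U" for k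
    by (rule borel_version_Lqd[OF B t(1) U(1) test_functionsD(5)[OF \<phi>(1)] U(3)]) (simp_all add: U(2))
  have e2: "(\<integral>x. norm (grad (\<phi> k) x - weak_grad \<Omega> u x) powr q \<partial>(lebesgue_on \<Omega>)) = Lqd q (grad (\<phi> k)) G" for k
    by (rule borel_version_Lqd[OF B t(2) G(1) test_functions_grad_outside[OF \<phi>(1)] wG]) (simp_all add: G(2))
  have "W0_pair q \<Omega> U G"
    by (rule W0_pair_limI[OF W0_pair_test[OF \<phi>(1) q0] LU LG q0 \<phi>(2)[unfolded e1] \<phi>(3)[unfolded e2]])
  then show ?thesis using U(3) wG by (rule that)
qed

text \<open>Makes every competitor in the formulation with pairs admissible for
  \<open>is_energy_minimizer\<close>, with the same gradient up to a null set.\<close>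

lemma W0_pair_imp_W1_0:
  fixes V :: "'a::euclidean_space \<Rightarrow> real"
  assumes \<Omega>: "open \<Omega>" and q: "q > 1" and V: "W0_pair q \<Omega> V H"
  shows "V \<in> W1_0 q \<Omega>" "AE x in lborel. x \<in> \<Omega> \<longrightarrow> weak_grad \<Omega> V x = H x"
proof -
  have q0: "q > 0" and q1: "q \<ge> 1" using q by simp_all
  have B: "\<Omega> \<in> sets borel" using \<Omega> by simp
  note L = W0_pair_Lqb[OF V] and z = W0_pair_zero_outside[OF V q0 B]
  note m [measurable] = L[THEN LqbD]
  have Lq: "w \<in> Lq q \<Omega>" if w: "Lqb q w" "AE x in lborel. x \<notin> \<Omega> \<longrightarrow> w x = 0" for w :: "'a \<Rightarrow> 'b::euclidean_space"
  proof -
    note [measurable] = LqbD[OF w(1)]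
    have "integrable (lebesgue_on \<Omega>) (\<lambda>x. norm (w x) powr q) \<longleftrightarrow> integrable lborel (\<lambda>x. norm (w x) powr q)"
      by (rule borel_version_integral(2)[OF B]) (use w(2) in \<open>auto elim: eventually_mono\<close>)
    moreover have "w \<in> borel_measurable (lebesgue_on \<Omega>)"
      using LqbD[OF w(1)] by (auto intro!: measurable_restrict_space1 measurable_completion)
    ultimately show ?thesis using Lqb_integrable[OF w(1)] by (simp add: Lq_def)
  qed
  have hw: "has_weak_gradient \<Omega> V H" by (rule W0_pair_has_weak_gradient[OF V q1 \<Omega>])
  have W1: "V \<in> W1 q \<Omega>" unfolding W1_def using Lq[OF L(1) z(1)] Lq[OF L(2) z(2)] hw by blast
  have wg: "has_weak_gradient \<Omega> V (weak_grad \<Omega> V)"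
    unfolding weak_grad_def by (rule someI[of "has_weak_gradient \<Omega> V", OF hw])
  show wH: "AE x in lborel. x \<in> \<Omega> \<longrightarrow> weak_grad \<Omega> V x = H x"
    by (rule has_weak_gradient_unique[OF \<Omega> wg hw]) simp
  obtain \<phi> where \<phi>: "\<And>k::nat. \<phi> k \<in> test_functions \<Omega>" "(\<lambda>k. Lqd q (\<phi> k) V) \<longlonglongrightarrow> 0" "(\<lambda>k. Lqd q (grad (\<phi> k)) H) \<longlonglongrightarrow> 0"
    using W0_pairE[OF V] by metis
  note t = Lqb_test[OF \<phi>(1) q0, THEN LqbD]
  have e1: "(\<integral>x. norm (\<phi> k x - V x) powr q \<partial>(lebesgue_on \<Omega>)) = Lqd q (\<phi> k) V" for k
    by (rule borel_version_Lqd[OF B t(1) L(1)[THEN LqbD] test_functionsD(5)[OF \<phi>(1)] _ z(1)]) simp_all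
  have e2: "(\<integral>x. norm (grad (\<phi> k) x - weak_grad \<Omega> V x) powr q \<partial>(lebesgue_on \<Omega>)) = Lqd q (grad (\<phi> k)) H" for k
    by (rule borel_version_Lqd[OF B t(2) L(2)[THEN LqbD] test_functions_grad_outside[OF \<phi>(1)] wH z(2)])
  show "V \<in> W1_0 q \<Omega>"
    unfolding W1_0_def using W1 \<phi>(1) \<phi>(2)[folded e1] \<phi>(3)[folded e2] by blast
qed

context variational
begin

lemma energy_eq_E:
  assumes \<Omega>: "open \<Omega>" and V: "W0_pair q \<Omega> V H"
    and vV: "AE x in lborel. x \<in> \<Omega> \<longrightarrow> v x = V x"
    and vH: "AE x in lborel. x \<in> \<Omega> \<longrightarrow> weak_grad \<Omega> v x = H x"
    and f0: "AE x in lborel. x \<in> \<Omega> \<longrightarrow> f0 x = f x"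
  shows "energy F f0 \<Omega> v = E V H"
  unfolding energy_def E_def
proof (rule borel_version_integral(1))
  note [measurable] = W0_pair_Lqb[OF V, THEN LqbD]
  show "\<Omega> \<in> sets borel" using \<Omega> by simp
  show "(\<lambda>x. F (H x) - f x * V x) \<in> borel_measurable borel" by measurable
  show "AE x in lborel. x \<in> \<Omega> \<longrightarrow> F (weak_grad \<Omega> v x) - f0 x * v x = F (H x) - f x * V x"
    using vV vH f0 by eventually_elim simp
  show "AE x in lborel. x \<notin> \<Omega> \<longrightarrow> F (H x) - f x * V x = 0"
    using W0_pair_zero_outside[OF V q0(1) borel_open[OF \<Omega>]] by eventually_elim simp
qed

lemma energy_minimizer_minimizes:
  assumes \<Omega>: "open \<Omega>" and u: "is_energy_minimizer q F f0 \<Omega> u"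
    and f0: "AE x in lborel. x \<in> \<Omega> \<longrightarrow> f0 x = f x" and u0: "\<And>x. x \<notin> \<Omega> \<Longrightarrow> u x = 0"
  obtains U G where "minimizes \<Omega> U G" "AE x in lborel. u x = U x"
proof -
  have uW: "u \<in> W1_0 q \<Omega>" and umin: "\<And>v. v \<in> W1_0 q \<Omega> \<Longrightarrow> energy F f0 \<Omega> u \<le> energy F f0 \<Omega> v"
    using u by (auto simp: is_energy_minimizer_def)
  obtain U G where U: "W0_pair q \<Omega> U G" "AE x in lborel. x \<in> \<Omega> \<longrightarrow> u x = U x"
    "AE x in lborel. x \<in> \<Omega> \<longrightarrow> weak_grad \<Omega> u x = G x"
    using W1_0_imp_W0_pair[OF \<Omega> q uW] by metis
  have "E U G \<le> E V H" if V: "W0_pair q \<Omega> V H" for V H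
    using umin[OF W0_pair_imp_W1_0(1)[OF \<Omega> q V]]
      energy_eq_E[OF \<Omega> U f0] energy_eq_E[OF \<Omega> V _ W0_pair_imp_W1_0(2)[OF \<Omega> q V] f0] by simp
  then have "minimizes \<Omega> U G" using U(1) by (simp add: minimizes_def)
  moreover have "AE x in lborel. u x = U x"
    using U(2) W0_pair_zero_outside(1)[OF U(1) q0(1) borel_open[OF \<Omega>]]
    by eventually_elim (use u0 in auto)
  ultimately show ?thesis by (rule that)
qed

end

section \<open>Integrals over cylinders and the conclusion\<close>

lemma nn_integral_indicator_fst_times_snd:
  fixes h :: "'b::euclidean_space \<Rightarrow> ennreal"
  assumes [measurable]: "A \<in> sets borel" "h \<in> borel_measurable borel"
  shows "(\<integral>\<^sup>+X. indicator A (fst X :: 'a::euclidean_space) * h (snd X) \<partial>lborel) = emeasure lborel A * (\<integral>\<^sup>+y. h y \<partial>lborel)"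
proof -
  have "(\<integral>\<^sup>+X. indicator A (fst X :: 'a) * h (snd X) \<partial>lborel)
      = (\<integral>\<^sup>+X. indicator A (fst X :: 'a) * h (snd X) \<partial>(lborel \<Otimes>\<^sub>M lborel))"
    by (simp add: lborel_prod)
  also have "\<dots> = (\<integral>\<^sup>+x. \<integral>\<^sup>+y. indicator A (x :: 'a) * h y \<partial>lborel \<partial>lborel)"
    by (subst lborel.nn_integral_fst[symmetric]) simp_all
  also have "\<dots> = (\<integral>\<^sup>+x. indicator A (x :: 'a) * (\<integral>\<^sup>+y. h y \<partial>lborel) \<partial>lborel)"
    by (simp add: nn_integral_cmult)
  also have "\<dots> = emeasure lborel A * (\<integral>\<^sup>+y. h y \<partial>lborel)"
    by (simp add: nn_integral_multc)
  finally show ?thesis .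
qed

lemma integral_indicator_fst_times_snd:
  fixes h :: "'b::euclidean_space \<Rightarrow> real"
  assumes A: "A \<in> sets borel" "emeasure lborel (A :: 'a::euclidean_space set) < \<infinity>" and h: "integrable lborel h" "\<And>y. h y \<ge> 0"
  shows "integrable lborel (\<lambda>X. indicator A (fst X) * h (snd X))"
    and "(LBINT X. indicator A (fst X) * h (snd X)) = measure lborel A * (LBINT y. h y)"
proof -
  have hm [measurable]: "h \<in> borel_measurable borel" using h(1) by simp
  note A(1) [measurable]
  have "(\<integral>\<^sup>+X. ennreal (indicator A (fst X) * h (snd X)) \<partial>lborel)
      = (\<integral>\<^sup>+X. indicator A (fst X) * ennreal (h (snd X)) \<partial>lborel)"
    by (rule nn_integral_cong) (simp add: indicator_def)
  also have "\<dots> = emeasure lborel A * (\<integral>\<^sup>+y. ennreal (h y) \<partial>lborel)"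
    by (rule nn_integral_indicator_fst_times_snd) measurable
  also have "\<dots> = ennreal (measure lborel A) * ennreal (LBINT y. h y)"
    using A(2) h by (simp add: emeasure_eq_ennreal_measure nn_integral_eq_integral less_top)
  also have "\<dots> = ennreal (measure lborel A * (LBINT y. h y))"
    by (rule ennreal_mult'[symmetric]) simp
  finally have *: "(\<integral>\<^sup>+X. ennreal (indicator A (fst X) * h (snd X)) \<partial>lborel)
      = ennreal (measure lborel A * (LBINT y. h y))" .
  have mm: "(\<lambda>X. indicator A (fst X) * h (snd X)) \<in> borel_measurable lborel" by measurable
  have nn: "AE X in lborel. 0 \<le> indicator A (fst X) * h (snd X)" using h(2) by simp
  show "integrable lborel (\<lambda>X. indicator A (fst X) * h (snd X))"
    by (rule integrableI_nn_integral_finite[OF mm nn *])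
  show "(LBINT X. indicator A (fst X) * h (snd X)) = measure lborel A * (LBINT y. h y)"
    unfolding integral_eq_nn_integral[OF mm nn] * using h by (simp add: integral_nonneg)
qed

lemma cylinder_eq: "cylinder l \<omega> = box (\<chi> i. - l) (\<chi> i. l) \<times> \<omega>"
  by (auto simp: cylinder_def mem_box_cart)

theorem theorem4p1:
  fixes \<omega>\<^sub>2 :: "(real ^ 'm) set"
    and F :: "(real ^ 'p) \<times> (real ^ 'm) \<Rightarrow> real"
    and f :: "real ^ 'm \<Rightarrow> real"
    and q q' \<alpha> lam Lam :: real
    and u :: "real \<Rightarrow> (real ^ 'p) \<times> (real ^ 'm) \<Rightarrow> real"
  assumes "open \<omega>\<^sub>2" and "bounded \<omega>\<^sub>2"
    and "q > 1" and "1 / q + 1 / q' = 1"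
    and "\<alpha> > 0" and "lam > 0" and "Lam > 0"
    and "\<And>\<xi> \<eta>. 2 * F ((1 / 2) *\<^sub>R (\<xi> + \<eta>)) + \<alpha> * norm (\<xi> - \<eta>) powr q \<le> F \<xi> + F \<eta>"
    and "\<And>\<xi>. lam * norm \<xi> powr q \<le> F \<xi> \<and> F \<xi> \<le> Lam * norm \<xi> powr q"
    and "f \<in> Lq q' \<omega>\<^sub>2" and "AE y in lebesgue_on \<omega>\<^sub>2. f y \<ge> 0"
    and "\<And>l. l > 0 \<Longrightarrow> is_energy_minimizer q F (\<lambda>X. f (snd X)) (cylinder l \<omega>\<^sub>2) (u l)"
    and "\<And>l X. l > 0 \<Longrightarrow> X \<notin> cylinder l \<omega>\<^sub>2 \<Longrightarrow> u l X = 0"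
  shows "\<exists>uinf :: real ^ 'm \<Rightarrow> real. \<forall>s :: nat \<Rightarrow> real.
    filterlim s at_top sequentially \<longrightarrow>
    (AE X in lebesgue_on (UNIV \<times> \<omega>\<^sub>2). (\<lambda>k. u (s k) X) \<longlonglongrightarrow> uinf (snd X))"
proof -
  let ?C = "\<lambda>l. cylinder l \<omega>\<^sub>2 :: ((real ^ 'p) \<times> (real ^ 'm)) set"
  have \<omega>B: "\<omega>\<^sub>2 \<in> sets borel" and \<omega>L: "\<omega>\<^sub>2 \<in> sets lebesgue" using assms(1) by simp_all
  have fM: "f \<in> borel_measurable (lebesgue_on \<omega>\<^sub>2)" using assms(10) by (simp add: Lq_def)
  obtain g0 where g0: "g0 \<in> borel_measurable borel" "\<And>y. y \<notin> \<omega>\<^sub>2 \<Longrightarrow> g0 y = 0"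
    "AE y in lborel. y \<in> \<omega>\<^sub>2 \<longrightarrow> f y = g0 y"
    by (rule borel_version[OF fM \<omega>B]) blast
  \<comment> \<open>The locale asks for a sign at every point, while \<open>f\<close> is nonnegative
    only almost everywhere on its domain; the positive part of a Borel representative repairs this
    and stays 0 outside \<open>\<omega>\<^sub>2\<close>.\<close>
  define g where "g y = max 0 (g0 y)" for y
  have gm [measurable]: "g \<in> borel_measurable borel" unfolding g_def using g0(1) by measurable
  have g_nonneg: "g y \<ge> 0" and g_out: "y \<notin> \<omega>\<^sub>2 \<Longrightarrow> g y = 0" for y by (auto simp: g_def g0(2))
  have fg: "AE y in lborel. y \<in> \<omega>\<^sub>2 \<longrightarrow> f y = g y"
    using g0(3) assms(11)[unfolded AE_lebesgue_on_iff[OF \<omega>L]] by eventually_elim (auto simp: g_def)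
  have "Lqb q' g" by (rule borel_version_Lqb[OF \<omega>B gm assms(10) fg]) (simp add: g_out)
  then have gq: "integrable lborel (\<lambda>y. g y powr q')" using g_nonneg by (auto dest: Lqb_integrable)
  interpret variational F q \<alpha> lam Lam "\<lambda>X. g (snd X)" q'
  proof
    fix \<Omega> :: "((real ^ 'p) \<times> (real ^ 'm)) set" assume \<Omega>: "open \<Omega>" "bounded \<Omega>"
    obtain R where R: "\<And>X. X \<in> \<Omega> \<Longrightarrow> norm X \<le> R" using \<Omega>(2) unfolding bounded_iff by blast
    have sub: "fst X \<in> cball 0 R" if "X \<in> \<Omega>" for X
      using R[OF that] norm_fst_le[of "fst X" "snd X"] by simp
    have i: "integrable lborel (\<lambda>X. indicator (cball (0 :: real ^ 'p) R) (fst X) * g (snd X) powr q')"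
      by (rule integral_indicator_fst_times_snd(1)[OF _ _ gq]) (use emeasure_lborel_cball_finite in auto)
    have [measurable]: "\<Omega> \<in> sets borel" using \<Omega>(1) by simp
    show "integrable lborel (\<lambda>X. indicator \<Omega> X * g (snd X) powr q')"
      by (rule Bochner_Integration.integrable_bound[OF i]) (use sub in \<open>auto simp: indicator_def\<close>)
  qed (use assms g_nonneg in auto)
  have op: "open (?C l)"
    and bd: "bounded (?C l)" for l
    unfolding cylinder_eq using assms(1,2) by (auto intro: open_Times bounded_Times)
  \<comment> \<open>The points whose second coordinate lies in a null set form a null set of the
    product, by Fubini.\<close>
  have fg': "AE X in (lborel :: ((real ^ 'p) \<times> (real ^ 'm)) measure). X \<in> ?C l \<longrightarrow> f (snd X) = g (snd X)" for l
  proof -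
    obtain N where N: "N \<in> null_sets lborel" "{y. \<not> (y \<in> \<omega>\<^sub>2 \<longrightarrow> f y = g y)} \<subseteq> N"
      using fg by (auto elim!: AE_E simp: null_sets_def)
    have "AE x in (lborel :: (real ^ 'p) measure). AE y in lborel. snd (x, y) \<notin> N"
      using AE_not_in[OF N(1)] by simp
    moreover have "{X \<in> space ((lborel :: (real ^ 'p) measure) \<Otimes>\<^sub>M lborel). snd X \<notin> N} \<in> sets (lborel \<Otimes>\<^sub>M lborel)"
      using null_setsD2[OF N(1)] by measurable
    ultimately have "AE X in (lborel :: (real ^ 'p) measure) \<Otimes>\<^sub>M lborel. snd X \<notin> N"
      by (intro lborel_pair.AE_pair_measure)
    then have "AE X in (lborel :: ((real ^ 'p) \<times> (real ^ 'm)) measure). snd X \<notin> N"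
      unfolding lborel_prod .
    then show ?thesis
      by eventually_elim (use N(2) in \<open>auto simp: cylinder_def\<close>)
  qed
  have "\<exists>UG. minimizes (?C l) (fst UG) (snd UG) \<and> (AE X in lborel. u l X = fst UG X)" if "l > 0" for l
    by (rule energy_minimizer_minimizes[OF op assms(12)[OF that] fg' assms(13)[OF that]])
      (auto intro: exI[of _ "(_, _)"])
  then have "\<forall>l. \<exists>UG. l > 0 \<longrightarrow> minimizes (?C l) (fst UG) (snd UG) \<and> (AE X in lborel. u l X = fst UG X)"
    by blast
  from choice[OF this] obtain UG where UG: "\<forall>l. l > 0 \<longrightarrow> minimizes (?C l) (fst (UG l)) (snd (UG l))
    \<and> (AE X in lborel. u l X = fst (UG l) X)" ..
  define U G where "U l = fst (UG l)" and "G l = snd (UG l)" for l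
  have U: "minimizes (?C l) (U l) (G l)" and uU: "AE X in lborel. u l X = U l X" if "l > 0" for l
    using UG that by (auto simp: U_def G_def)
  have W: "W0_pair q (?C l) (U l) (G l)" if "l > 0" for l
    using U[OF that] by (simp add: minimizes_def)
  obtain b2 :: "real ^ 'm" where b2: "b2 \<in> Basis" using nonempty_Basis by blast
  \<comment> \<open>The inner product with \<open>(0, b2)\<close> sees only the second coordinate,
    so one bound \<open>D\<close> for \<open>\<omega>\<^sub>2\<close> serves the cylinders of all
    sizes.\<close>
  have nb: "norm (0 :: real ^ 'p, b2) = 1" using b2 by (simp add: norm_Pair)
  obtain D where D: "D > 0" "\<And>y. y \<in> \<omega>\<^sub>2 \<Longrightarrow> norm y \<le> D" using assms(2) unfolding bounded_pos by blast
  obtain C where C: "C \<ge> 0" "\<And>\<Omega> u G. minimizes \<Omega> u G \<Longrightarrow> open \<Omega> \<Longrightarrow> bounded \<Omega> \<Longrightarrow>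
    (\<And>x. x \<in> \<Omega> \<Longrightarrow> \<bar>x \<bullet> (0 :: real ^ 'p, b2)\<bar> \<le> D) \<Longrightarrow>
    Lqd q u (\<lambda>_. 0) \<le> C * (LBINT X. indicator \<Omega> X * g (snd X) powr q')"
    by (rule minimizer_bound[OF nb less_imp_le[OF D(1)]]) blast
  define \<Phi> where "\<Phi> = (LBINT y. g y powr q')"
  have bound: "Lqd q (U l) (\<lambda>_. 0) \<le> C * 2 ^ CARD('p) * \<Phi> * l ^ CARD('p)" if l: "l > 0" for l
  proof -
    let ?A = "box (\<chi> i. - l) (\<chi> i. l) :: (real ^ 'p) set"
    have A: "emeasure lborel ?A = ennreal ((2 * l) ^ CARD('p))" using emeasure_cube[of "- l" l] l by simp
    have "Lqd q (U l) (\<lambda>_. 0) \<le> C * (LBINT X. indicator (?C l) X * g (snd X) powr q')"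
    proof (rule C(2)[OF U[OF l] op bd])
      fix X assume "X \<in> ?C l"
      then have "norm (snd X) \<le> D" using D(2) by (auto simp: cylinder_def)
      then show "\<bar>X \<bullet> (0, b2)\<bar> \<le> D" using Basis_le_norm[OF b2, of "snd X"] by (simp add: inner_prod_def)
    qed
    also have "(LBINT X. indicator (?C l) X * g (snd X) powr q')
        = (LBINT X. indicator ?A (fst X) * g (snd X) powr q')"
      by (rule Bochner_Integration.integral_cong)
        (auto simp: cylinder_eq indicator_def g_out mem_Times_iff)
    also have "\<dots> = measure lborel ?A * \<Phi>"
      unfolding \<Phi>_def by (rule integral_indicator_fst_times_snd(2)[OF _ _ gq]) (simp_all add: A)
    also have "measure lborel ?A = (2 * l) ^ CARD('p)" using A l by (simp add: measure_def)
    finally show ?thesis by (simp add: power_mult_distrib ac_simps)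
  qed
  obtain w where w: "\<And>s :: nat \<Rightarrow> real. filterlim s at_top sequentially \<Longrightarrow> AE X in lborel. (\<lambda>k. U (s k) X) \<longlonglongrightarrow> w (snd X)"
  proof (rule monotone_translates_limit[of U q "ennreal (C * 2 ^ CARD('p) * \<Phi>)"])
    fix l :: real assume l: "l > 0"
    note L = W0_pair_Lqb(1)[OF W[OF l]]
    show "U l \<in> borel_measurable borel" by (rule LqbD[OF L])
    show nn: "AE X in lborel. 0 \<le> U l X" by (rule minimizer_nonneg[OF U[OF l] op bd])
    have "(\<integral>\<^sup>+X. ennreal (U l X powr q) \<partial>lborel) = (\<integral>\<^sup>+X. ennreal (norm (U l X) powr q) \<partial>lborel)"
      by (rule nn_integral_cong_AE) (use nn in \<open>auto elim: eventually_mono\<close>)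
    also have "\<dots> = ennreal (Lqd q (U l) (\<lambda>_. 0))"
      unfolding Lqd_def using Lqb_integrable[OF L] by (simp add: nn_integral_eq_integral)
    also have "\<dots> \<le> ennreal (C * 2 ^ CARD('p) * \<Phi> * l ^ CARD('p))" by (rule ennreal_leI[OF bound[OF l]])
    also have "\<dots> = ennreal (C * 2 ^ CARD('p) * \<Phi>) * ennreal (l ^ CARD('p))"
      using l by (intro ennreal_mult'') simp
    finally show "(\<integral>\<^sup>+X. ennreal (U l X powr q) \<partial>lborel) \<le> ennreal (C * 2 ^ CARD('p) * \<Phi>) * ennreal (l ^ CARD('p))" .
  next
    fix l l' :: real and a :: "real ^ 'p" assume l: "l > 0" "l' > 0" and a: "\<And>i. \<bar>a $ i\<bar> \<le> l' - l"
    show "AE X in lborel. U l (X + (a, 0)) \<le> U l' X"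
    proof (rule minimizer_mono[OF minimizes_translate[OF U[OF l(1)]] U[OF l(2)]])
      show "(\<lambda>X. X - (a, 0)) ` ?C l \<subseteq> ?C l'"
      proof (rule image_subsetI)
        fix X assume "X \<in> ?C l"
        then have X: "- l < fst X $ i" "fst X $ i < l" "snd X \<in> \<omega>\<^sub>2" for i by (auto simp: cylinder_def)
        have "- l' < fst X $ i - a $ i \<and> fst X $ i - a $ i < l'" for i
          using X(1,2)[of i] a[of i] by (simp add: abs_le_iff)
        then show "X - (a, 0) \<in> ?C l'" using X(3) by (auto simp: cylinder_def mem_Times_iff)
      qed
      show "open ((\<lambda>X. X - (a, 0)) ` ?C l)" by (rule open_translation_subtract[OF op])
      show "bounded ((\<lambda>X. X - (a, 0)) ` ?C l)" by (rule bounded_translation_minus[OF bd])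
    qed (use op bd in auto)
  qed (use q0 in auto)
  have "AE X in lebesgue_on (UNIV \<times> \<omega>\<^sub>2). (\<lambda>k. u (s k) X) \<longlonglongrightarrow> w (snd X)"
    if s: "filterlim s at_top sequentially" for s :: "nat \<Rightarrow> real"
  proof -
    have pos: "\<forall>\<^sub>F k in sequentially. 1 \<le> s k" using s by (simp add: filterlim_at_top)
    \<comment> \<open>For each size \<open>u l\<close> and \<open>U l\<close> agree only almost
      everywhere, but a sequence involves countably many sizes; nonpositive ones occur finitely
      often and do not affect the limit.\<close>
    have "AE X in lborel. \<forall>k. s k > 0 \<longrightarrow> u (s k) X = U (s k) X"
      unfolding AE_all_countable
    proof
      fix k
      show "AE X in lborel. s k > 0 \<longrightarrow> u (s k) X = U (s k) X"
        by (cases "s k > 0") (use uU[of "s k"] in auto)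
    qed
    then have "AE X in lborel. (\<lambda>k. u (s k) X) \<longlonglongrightarrow> w (snd X)"
      using w[OF s]
    proof eventually_elim
      case (elim X)
      have "\<forall>\<^sub>F k in sequentially. U (s k) X = u (s k) X"
        using pos by eventually_elim (use elim(1) in force)
      then show ?case using elim(2) by (rule tendsto_cong[THEN iffD1])
    qed
    moreover have "(UNIV \<times> \<omega>\<^sub>2 :: ((real ^ 'p) \<times> (real ^ 'm)) set) \<in> sets lebesgue"
      using assms(1) by (simp add: open_Times)
    ultimately show ?thesis by (subst AE_lebesgue_on_iff) (auto elim: eventually_mono)
  qed
  then show ?thesis by blast
qed

end
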